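(* Let $\Omega\subset\mathbb C^n$ be open, let $\mathcal F$ be a plain sheaf over $\Omega$, let $\mathcal A\subset\mathcal F$ be a finitely generated $\mathcal O$-submodule, and let $\zeta\in\Omega$. Then there are an open neighborhood $U\subset\Omega$ of $\zeta$ and a finitely generated free $\mathcal O|U$-submodule $\mathcal E\subset\mathcal F|U$ that contains $\mathcal A|U$. In particular, plain sheaves are flat: if $\mathcal F$ is a plain sheaf and $\mathcal A\to\mathcal B\to\mathcal C$ is an exact sequence of $\mathcal O$-modules over $\Omega$, then the induced sequence $\mathcal A\otimes_{\mathcal O}\mathcal F\to\mathcal B\otimes_{\mathcal O}\mathcal F\to\mathcal C\otimes_{\mathcal O}\mathcal F$ is exact.
   Context: For a complex Banach space $E$, $\mathcal O^E=\mathcal O^E_\Omega$ denotes the sheaf over $\Omega$ of germs of holomorphic functions with values in $E$; $\mathcal O=\mathcal O^{\mathbb C}$. Each $\mathcal O^E$ is a sheaf of $\mathcal O$-modules (simply "an $\mathcal O$-module"). The sheaves $\mathcal O^E$, $E$ any complex Banach space, are called plain sheaves. An $\mathcal O$-module is finitely generated if it is generated by finitely many sections, i.e. it is the image of a homomorphism from some $\mathcal O^{\oplus k}$, $k<\infty$. *)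

theory Defs
  imports "HOL-Analysis.Analysis" "HOL-Algebra.Module" "HOL-Algebra.Free_Abelian_Groups"
begin

section \<open>Complex Banach spaces and holomorphic maps\<close>

class complex_banach = banach +
  fixes scaleC :: "complex \<Rightarrow> 'a \<Rightarrow> 'a"  (infixr \<open>*\<^sub>C\<close> 75)
  assumes scaleC_add_right: "c *\<^sub>C (x + y) = c *\<^sub>C x + c *\<^sub>C y"
    and scaleC_add_left: "(c + d) *\<^sub>C x = c *\<^sub>C x + d *\<^sub>C x"
    and scaleC_scaleC: "c *\<^sub>C (d *\<^sub>C x) = (c * d) *\<^sub>C x"
    and scaleC_of_real: "complex_of_real r *\<^sub>C x = r *\<^sub>R x"
    and norm_scaleC: "norm (c *\<^sub>C x) = cmod c * norm x"

instantiation complex :: complex_banach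
begin

definition scaleC_complex :: "complex \<Rightarrow> complex \<Rightarrow> complex" where
  "scaleC_complex c z = c * z"

instance
  by standard (simp_all add: scaleC_complex_def algebra_simps norm_mult scaleR_conv_of_real)

end

text \<open>Used for open \<open>U\<close> only: complex Frechet differentiability at every point.\<close>

definition holomorphic_map_on ::
    "(complex ^ 'n \<Rightarrow> 'e::complex_banach) \<Rightarrow> (complex ^ 'n) set \<Rightarrow> bool" where
  "holomorphic_map_on f U \<longleftrightarrow>
     (\<forall>z\<in>U. \<exists>D. (f has_derivative D) (at z) \<and> (\<forall>c v. D (c *s v) = c *\<^sub>C D v))"

section \<open>Sheaves of modules over the holomorphic functions\<close>

text \<open>Functions on \<open>U\<close> are represented extensionally, i.e. with the value \<open>undefined\<close> off \<open>U\<close>,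
  so that equality of sections is equality on \<open>U\<close> and restriction of sections is \<open>restrict\<close>.\<close>

definition hol_ring :: "(complex ^ 'n) set \<Rightarrow> (complex ^ 'n \<Rightarrow> complex) ring" where
  "hol_ring U =
     \<lparr>carrier = {f \<in> extensional U. holomorphic_map_on f U},
      monoid.mult = (\<lambda>f g. \<lambda>z\<in>U. f z * g z),
      one = (\<lambda>z\<in>U. 1),
      ring.zero = (\<lambda>z\<in>U. 0),
      add = (\<lambda>f g. \<lambda>z\<in>U. f z + g z)\<rparr>"

text \<open>The data of a presheaf of modules. Only its values on open subsets of the base are ever
  used, so the restriction of a (pre)sheaf over \<open>\<Omega>\<close> to an open \<open>U \<subseteq> \<Omega>\<close> is the same record, taken
  over \<open>U\<close>. The fields \<open>mult\<close> and \<open>one\<close> that the type of modules inherits from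
  rings are irrelevant and set to \<open>undefined\<close> throughout.\<close>

record ('n, 'a) mod_presheaf =
  sec :: "(complex ^ 'n) set \<Rightarrow> (complex ^ 'n \<Rightarrow> complex, 'a) module"
  res :: "(complex ^ 'n) set \<Rightarrow> (complex ^ 'n) set \<Rightarrow> 'a \<Rightarrow> 'a"

locale O_presheaf =
  fixes \<Omega> :: "(complex ^ 'n) set" and M :: "('n, 'a) mod_presheaf"
  assumes sec_module: "\<lbrakk>open U; U \<subseteq> \<Omega>\<rbrakk> \<Longrightarrow> Module.module (hol_ring U) (sec M U)"
    and res_closed: "\<lbrakk>open U; open V; V \<subseteq> U; U \<subseteq> \<Omega>; s \<in> carrier (sec M U)\<rbrakk>
      \<Longrightarrow> res M U V s \<in> carrier (sec M V)"
    and res_add: "\<lbrakk>open U; open V; V \<subseteq> U; U \<subseteq> \<Omega>; s \<in> carrier (sec M U); t \<in> carrier (sec M U)\<rbrakk>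
      \<Longrightarrow> res M U V (s \<oplus>\<^bsub>sec M U\<^esub> t) = res M U V s \<oplus>\<^bsub>sec M V\<^esub> res M U V t"
    and res_smult: "\<lbrakk>open U; open V; V \<subseteq> U; U \<subseteq> \<Omega>; c \<in> carrier (hol_ring U); s \<in> carrier (sec M U)\<rbrakk>
      \<Longrightarrow> res M U V (c \<odot>\<^bsub>sec M U\<^esub> s) = restrict c V \<odot>\<^bsub>sec M V\<^esub> res M U V s"
    and res_id: "\<lbrakk>open U; U \<subseteq> \<Omega>; s \<in> carrier (sec M U)\<rbrakk> \<Longrightarrow> res M U U s = s"
    and res_res: "\<lbrakk>open U; open V; open W; W \<subseteq> V; V \<subseteq> U; U \<subseteq> \<Omega>; s \<in> carrier (sec M U)\<rbrakk>
      \<Longrightarrow> res M V W (res M U V s) = res M U W s"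

locale O_module = O_presheaf +
  assumes locality: "\<lbrakk>\<And>V. V \<in> \<V> \<Longrightarrow> open V; \<Union>\<V> \<subseteq> \<Omega>;
      s \<in> carrier (sec M (\<Union>\<V>)); t \<in> carrier (sec M (\<Union>\<V>));
      \<And>V. V \<in> \<V> \<Longrightarrow> res M (\<Union>\<V>) V s = res M (\<Union>\<V>) V t\<rbrakk> \<Longrightarrow> s = t"
    and gluing: "\<lbrakk>\<And>V. V \<in> \<V> \<Longrightarrow> open V; \<Union>\<V> \<subseteq> \<Omega>;
      \<And>V. V \<in> \<V> \<Longrightarrow> \<sigma> V \<in> carrier (sec M V);
      \<And>V W. \<lbrakk>V \<in> \<V>; W \<in> \<V>\<rbrakk> \<Longrightarrow> res M V (V \<inter> W) (\<sigma> V) = res M W (V \<inter> W) (\<sigma> W)\<rbrakk>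
      \<Longrightarrow> \<exists>s\<in>carrier (sec M (\<Union>\<V>)). \<forall>V\<in>\<V>. res M (\<Union>\<V>) V s = \<sigma> V"

text \<open>The plain sheaf \<open>\<O>\<^sup>E\<close>, where \<open>E\<close> is the type \<open>'e\<close>.\<close>

definition plain_sheaf :: "('n, complex ^ 'n \<Rightarrow> 'e::complex_banach) mod_presheaf" where
  "plain_sheaf =
     \<lparr>sec = (\<lambda>U.
        \<lparr>carrier = {f \<in> extensional U. holomorphic_map_on f U},
         monoid.mult = undefined, one = undefined,
         ring.zero = (\<lambda>z\<in>U. 0),
         add = (\<lambda>f g. \<lambda>z\<in>U. f z + g z),
         smult = (\<lambda>c f. \<lambda>z\<in>U. c z *\<^sub>C f z)\<rparr>),
      res = (\<lambda>U V f. restrict f V)\<rparr>"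

definition free_sheaf :: "nat \<Rightarrow> ('n, nat \<Rightarrow> complex ^ 'n \<Rightarrow> complex) mod_presheaf" where
  "free_sheaf k =
     \<lparr>sec = (\<lambda>U.
        \<lparr>carrier = {..<k} \<rightarrow>\<^sub>E carrier (hol_ring U),
         monoid.mult = undefined, one = undefined,
         ring.zero = (\<lambda>i\<in>{..<k}. \<zero>\<^bsub>hol_ring U\<^esub>),
         add = (\<lambda>f g. \<lambda>i\<in>{..<k}. f i \<oplus>\<^bsub>hol_ring U\<^esub> g i),
         smult = (\<lambda>c f. \<lambda>i\<in>{..<k}. c \<otimes>\<^bsub>hol_ring U\<^esub> f i)\<rparr>),
      res = (\<lambda>U V f. \<lambda>i\<in>{..<k}. restrict (f i) V)\<rparr>"

definition sheaf_hom :: "(complex ^ 'n) set \<Rightarrow> ('n, 'a) mod_presheaf \<Rightarrow> ('n, 'b) mod_presheaf \<Rightarrow>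
    ((complex ^ 'n) set \<Rightarrow> 'a \<Rightarrow> 'b) \<Rightarrow> bool" where
  "sheaf_hom \<Omega> A B \<phi> \<longleftrightarrow>
     (\<forall>U. open U \<and> U \<subseteq> \<Omega> \<longrightarrow>
        \<phi> U \<in> carrier (sec A U) \<rightarrow> carrier (sec B U) \<and>
        (\<forall>s\<in>carrier (sec A U). \<forall>t\<in>carrier (sec A U).
           \<phi> U (s \<oplus>\<^bsub>sec A U\<^esub> t) = \<phi> U s \<oplus>\<^bsub>sec B U\<^esub> \<phi> U t) \<and>
        (\<forall>c\<in>carrier (hol_ring U). \<forall>s\<in>carrier (sec A U).
           \<phi> U (c \<odot>\<^bsub>sec A U\<^esub> s) = c \<odot>\<^bsub>sec B U\<^esub> \<phi> U s) \<and>
        (\<forall>V. open V \<and> V \<subseteq> U \<longrightarrow>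
           (\<forall>s\<in>carrier (sec A U). \<phi> V (res A U V s) = res B U V (\<phi> U s))))"

definition sheaf_iso :: "(complex ^ 'n) set \<Rightarrow> ('n, 'a) mod_presheaf \<Rightarrow> ('n, 'b) mod_presheaf \<Rightarrow>
    ((complex ^ 'n) set \<Rightarrow> 'a \<Rightarrow> 'b) \<Rightarrow> bool" where
  "sheaf_iso \<Omega> A B \<phi> \<longleftrightarrow> sheaf_hom \<Omega> A B \<phi> \<and>
     (\<forall>U. open U \<and> U \<subseteq> \<Omega> \<longrightarrow> bij_betw (\<phi> U) (carrier (sec A U)) (carrier (sec B U)))"

text \<open>The image is the sheaf image: sections that are locally in the image of \<open>\<phi>\<close>.\<close>

definition image_sheaf :: "('n, 'a) mod_presheaf \<Rightarrow> ('n, 'b) mod_presheaf \<Rightarrow>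
    ((complex ^ 'n) set \<Rightarrow> 'a \<Rightarrow> 'b) \<Rightarrow> (complex ^ 'n) set \<Rightarrow> 'b set" where
  "image_sheaf A B \<phi> U =
     {s \<in> carrier (sec B U). \<forall>x\<in>U. \<exists>V. open V \<and> x \<in> V \<and> V \<subseteq> U \<and>
        res B U V s \<in> \<phi> V ` carrier (sec A V)}"

definition kernel_sheaf :: "('n, 'b) mod_presheaf \<Rightarrow> ('n, 'c) mod_presheaf \<Rightarrow>
    ((complex ^ 'n) set \<Rightarrow> 'b \<Rightarrow> 'c) \<Rightarrow> (complex ^ 'n) set \<Rightarrow> 'b set" where
  "kernel_sheaf B C \<psi> U = {s \<in> carrier (sec B U). \<psi> U s = \<zero>\<^bsub>sec C U\<^esub>}"

definition exact_sheaf_seq :: "(complex ^ 'n) set \<Rightarrow>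
    ('n, 'a) mod_presheaf \<Rightarrow> ((complex ^ 'n) set \<Rightarrow> 'a \<Rightarrow> 'b) \<Rightarrow> ('n, 'b) mod_presheaf \<Rightarrow>
    ((complex ^ 'n) set \<Rightarrow> 'b \<Rightarrow> 'c) \<Rightarrow> ('n, 'c) mod_presheaf \<Rightarrow> bool" where
  "exact_sheaf_seq \<Omega> A \<phi> B \<psi> C \<longleftrightarrow>
     (\<forall>U. open U \<and> U \<subseteq> \<Omega> \<longrightarrow> image_sheaf A B \<phi> U = kernel_sheaf B C \<psi> U)"

text \<open>A subsheaf of \<open>M\<close> is given by its sets of sections.\<close>

definition O_submodule :: "(complex ^ 'n) set \<Rightarrow> ('n, 'a) mod_presheaf \<Rightarrow>
    ((complex ^ 'n) set \<Rightarrow> 'a set) \<Rightarrow> bool" where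
  "O_submodule \<Omega> M A \<longleftrightarrow>
     (\<forall>U. open U \<and> U \<subseteq> \<Omega> \<longrightarrow>
        submodule (A U) (hol_ring U) (sec M U) \<and>
        (\<forall>V. open V \<and> V \<subseteq> U \<longrightarrow> res M U V ` A U \<subseteq> A V) \<and>
        (\<forall>s\<in>carrier (sec M U).
           (\<forall>x\<in>U. \<exists>V. open V \<and> x \<in> V \<and> V \<subseteq> U \<and> res M U V s \<in> A V) \<longrightarrow> s \<in> A U))"

definition subsheaf :: "('n, 'a) mod_presheaf \<Rightarrow> ((complex ^ 'n) set \<Rightarrow> 'a set) \<Rightarrow>
    ('n, 'a) mod_presheaf" where
  "subsheaf M A = \<lparr>sec = (\<lambda>U. (sec M U)\<lparr>carrier := A U\<rparr>), res = res M\<rparr>"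

definition finitely_generated :: "(complex ^ 'n) set \<Rightarrow> ('n, 'a) mod_presheaf \<Rightarrow> bool" where
  "finitely_generated \<Omega> M \<longleftrightarrow>
     (\<exists>k \<phi>. sheaf_hom \<Omega> (free_sheaf k) M \<phi> \<and>
        (\<forall>U. open U \<and> U \<subseteq> \<Omega> \<longrightarrow> image_sheaf (free_sheaf k) M \<phi> U = carrier (sec M U)))"

definition finitely_generated_free :: "(complex ^ 'n) set \<Rightarrow> ('n, 'a) mod_presheaf \<Rightarrow> bool" where
  "finitely_generated_free \<Omega> M \<longleftrightarrow> (\<exists>k \<phi>. sheaf_iso \<Omega> (free_sheaf k) M \<phi>)"

section \<open>Tensor products of modules\<close>

text \<open>The quotient of the free Abelian group on \<open>M \<times> N\<close> by the usual bilinearity relations.\<close>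

definition tensor_relators :: "('r, 'm) ring_scheme \<Rightarrow> ('r, 'a) module \<Rightarrow> ('r, 'b) module \<Rightarrow>
    (('a \<times> 'b) \<Rightarrow>\<^sub>0 int) set" where
  "tensor_relators R M N =
     {frag_of (x \<oplus>\<^bsub>M\<^esub> x', y) - frag_of (x, y) - frag_of (x', y) | x x' y.
        x \<in> carrier M \<and> x' \<in> carrier M \<and> y \<in> carrier N} \<union>
     {frag_of (x, y \<oplus>\<^bsub>N\<^esub> y') - frag_of (x, y) - frag_of (x, y') | x y y'.
        x \<in> carrier M \<and> y \<in> carrier N \<and> y' \<in> carrier N} \<union>
     {frag_of (r \<odot>\<^bsub>M\<^esub> x, y) - frag_of (x, r \<odot>\<^bsub>N\<^esub> y) | r x y.
        r \<in> carrier R \<and> x \<in> carrier M \<and> y \<in> carrier N}"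

abbreviation tensor_free :: "('r, 'a) module \<Rightarrow> ('r, 'b) module \<Rightarrow> (('a \<times> 'b) \<Rightarrow>\<^sub>0 int) monoid" where
  "tensor_free M N \<equiv> free_Abelian_group (carrier M \<times> carrier N)"

definition tensor_kernel :: "('r, 'm) ring_scheme \<Rightarrow> ('r, 'a) module \<Rightarrow> ('r, 'b) module \<Rightarrow>
    (('a \<times> 'b) \<Rightarrow>\<^sub>0 int) set" where
  "tensor_kernel R M N = generate (tensor_free M N) (tensor_relators R M N)"

text \<open>The map \<open>f \<otimes> g\<close> into the tensor product of \<open>M'\<close> and \<open>N'\<close>, on cosets: \<open>x \<otimes> y \<mapsto> f x \<otimes> g y\<close>.
  It does not mention the source; it is well defined whenever \<open>f\<close> and \<open>g\<close> are additive and
  semilinear over the same ring homomorphism (the identity, or a restriction of functions).\<close>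

definition tensor_map :: "('r, 'm) ring_scheme \<Rightarrow> ('r, 'c) module \<Rightarrow> ('r, 'd) module \<Rightarrow>
    ('a \<Rightarrow> 'c) \<Rightarrow> ('b \<Rightarrow> 'd) \<Rightarrow> (('a \<times> 'b) \<Rightarrow>\<^sub>0 int) set \<Rightarrow> (('c \<times> 'd) \<Rightarrow>\<^sub>0 int) set" where
  "tensor_map R M' N' f g X =
     (\<Union>w\<in>X. tensor_kernel R M' N' #>\<^bsub>tensor_free M' N'\<^esub>
        frag_extend (\<lambda>(x, y). frag_of (f x, g y)) w)"

definition tensor_module :: "('r, 'm) ring_scheme \<Rightarrow> ('r, 'a) module \<Rightarrow> ('r, 'b) module \<Rightarrow>
    ('r, (('a \<times> 'b) \<Rightarrow>\<^sub>0 int) set) module" where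
  "tensor_module R M N = (let Q = tensor_free M N Mod tensor_kernel R M N in
     \<lparr>carrier = carrier Q,
      monoid.mult = undefined, one = undefined,
      ring.zero = \<one>\<^bsub>Q\<^esub>,
      add = (\<lambda>X Y. X \<otimes>\<^bsub>Q\<^esub> Y),
      smult = (\<lambda>r. tensor_map R M N (\<lambda>x. r \<odot>\<^bsub>M\<^esub> x) (\<lambda>y. y))\<rparr>)"

section \<open>Sheafification and tensor products of sheaves\<close>

definition germ :: "(complex ^ 'n) set \<Rightarrow> ('n, 'a) mod_presheaf \<Rightarrow> complex ^ 'n \<Rightarrow>
    (complex ^ 'n) set \<Rightarrow> 'a \<Rightarrow> ((complex ^ 'n) set \<times> 'a) set" where
  "germ \<Omega> P x U s =
     {(V, t). open V \<and> x \<in> V \<and> V \<subseteq> \<Omega> \<and> t \<in> carrier (sec P V) \<and>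
        (\<exists>W. open W \<and> x \<in> W \<and> W \<subseteq> U \<inter> V \<and> res P U W s = res P V W t)}"

text \<open>Sections of the sheafification over \<open>U\<close> are the functions on \<open>U\<close> assigning to each \<open>x\<close>
  a germ at \<open>x\<close> that locally come from sections of \<open>P\<close>. In the algebraic operations, the unions
  are over all choices of representatives, which all yield the same germ.\<close>

definition sheafify :: "(complex ^ 'n) set \<Rightarrow> ('n, 'a) mod_presheaf \<Rightarrow>
    ('n, complex ^ 'n \<Rightarrow> ((complex ^ 'n) set \<times> 'a) set) mod_presheaf" where
  "sheafify \<Omega> P =
     \<lparr>sec = (\<lambda>U.
        \<lparr>carrier = {\<sigma> \<in> extensional U. \<forall>x\<in>U. \<exists>V s. open V \<and> x \<in> V \<and> V \<subseteq> U \<and>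
           s \<in> carrier (sec P V) \<and> (\<forall>y\<in>V. \<sigma> y = germ \<Omega> P y V s)},
         monoid.mult = undefined, one = undefined,
         ring.zero = (\<lambda>x\<in>U. germ \<Omega> P x U \<zero>\<^bsub>sec P U\<^esub>),
         add = (\<lambda>\<sigma> \<tau>. \<lambda>x\<in>U. \<Union>{germ \<Omega> P x V (s \<oplus>\<^bsub>sec P V\<^esub> t) | V s t.
           (V, s) \<in> \<sigma> x \<and> (V, t) \<in> \<tau> x}),
         smult = (\<lambda>c \<sigma>. \<lambda>x\<in>U. \<Union>{germ \<Omega> P x V (restrict c V \<odot>\<^bsub>sec P V\<^esub> s) | V s.
           V \<subseteq> U \<and> (V, s) \<in> \<sigma> x})\<rparr>),
      res = (\<lambda>U V \<sigma>. restrict \<sigma> V)\<rparr>"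

definition sheafify_map :: "(complex ^ 'n) set \<Rightarrow> ('n, 'b) mod_presheaf \<Rightarrow>
    ((complex ^ 'n) set \<Rightarrow> 'a \<Rightarrow> 'b) \<Rightarrow> (complex ^ 'n) set \<Rightarrow>
    (complex ^ 'n \<Rightarrow> ((complex ^ 'n) set \<times> 'a) set) \<Rightarrow>
    complex ^ 'n \<Rightarrow> ((complex ^ 'n) set \<times> 'b) set" where
  "sheafify_map \<Omega> Q \<phi> U \<sigma> = (\<lambda>x\<in>U. \<Union>{germ \<Omega> Q x V (\<phi> V s) | V s. (V, s) \<in> \<sigma> x})"

definition tensor_presheaf :: "('n::finite, 'a) mod_presheaf \<Rightarrow> ('n, 'b) mod_presheaf \<Rightarrow>
    ('n, (('a \<times> 'b) \<Rightarrow>\<^sub>0 int) set) mod_presheaf" where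
  "tensor_presheaf A B =
     \<lparr>sec = (\<lambda>U. tensor_module (hol_ring U) (sec A U) (sec B U)),
      res = (\<lambda>U V. tensor_map (hol_ring V) (sec A V) (sec B V) (res A U V) (res B U V))\<rparr>"

definition tensor_sheaf :: "(complex ^ 'n) set \<Rightarrow> ('n, 'a) mod_presheaf \<Rightarrow> ('n, 'b) mod_presheaf \<Rightarrow>
    ('n, complex ^ 'n \<Rightarrow> ((complex ^ 'n) set \<times> (('a \<times> 'b) \<Rightarrow>\<^sub>0 int) set) set) mod_presheaf" where
  "tensor_sheaf \<Omega> A B = sheafify \<Omega> (tensor_presheaf A B)"

text \<open>The homomorphism \<open>\<phi> \<otimes> id\<close> from the tensor product of \<open>A\<close> and \<open>F\<close> to that of \<open>B\<close> and \<open>F\<close>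
  induced by \<open>\<phi> : A \<rightarrow> B\<close>.\<close>

definition tensor_sheaf_map :: "(complex ^ 'n) set \<Rightarrow> ('n, 'b) mod_presheaf \<Rightarrow>
    ('n, 'f) mod_presheaf \<Rightarrow> ((complex ^ 'n) set \<Rightarrow> 'a \<Rightarrow> 'b) \<Rightarrow> (complex ^ 'n) set \<Rightarrow>
    (complex ^ 'n \<Rightarrow> ((complex ^ 'n) set \<times> (('a \<times> 'f) \<Rightarrow>\<^sub>0 int) set) set) \<Rightarrow>
    complex ^ 'n \<Rightarrow> ((complex ^ 'n) set \<times> (('b \<times> 'f) \<Rightarrow>\<^sub>0 int) set) set" where
  "tensor_sheaf_map \<Omega> B F \<phi> =
     sheafify_map \<Omega> (tensor_presheaf B F)
       (\<lambda>U. tensor_map (hol_ring U) (sec B U) (sec F U) (\<phi> U) (\<lambda>f. f))"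

end

theory Submission
  imports Defs "HOL-Complex_Analysis.Complex_Analysis"
begin

text \<open>Near a point, a holomorphic map is the sum of its power series. Order the monomials. Division of
  a Banach-valued germ by finitely many scalar germs, with remainder free of the leading monomials,
  converges as in the scalar case, and the Hahn--Banach theorem reduces the vanishing of the remainder
  to scalar germs. Hence, if the image of a Banach-valued germ under every functional lies in an
  ideal, the germ is a finite combination of elements of the ideal with Banach-valued coefficients;
  the same holds for tuples and modules. Applied to generators \<open>f i\<close> of the submodule and to the
  module of tuples spanned by all \<open>(l (f i))\<close>, this writes the \<open>f i\<close> as scalar combinations of
  germs \<open>q j\<close>, and if there are as few \<open>q j\<close> as possible their values at the point are linearly
  independent, so that they generate a free submodule.

  For flatness, a tensor over the plain sheaf that becomes zero does so because of finitely many
  relations. The Banach-valued maps in these lie in the span of a frame \<open>q j\<close> as above, and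
  comparing coordinates reduces the claim to the exactness of the given sequence.\<close>

text \<open>Generators of A cannot simply be thinned out. For n \<ge> 2 and a nonzero vector v the
  sections z_1 v and z_2 v span a module that is not free near 0, and a free hull must contain new
  elements such as v. So the frame has to be produced by division, and the tuples (l(f_1), ...,
  l(f_k)) tell what to divide by: here they span the multiples of (z_1, z_2), with quotient v. The
  obstacle is the coefficient space. For infinite-dimensional E the E-valued germs are not finitely
  generated over the scalar ones, so no Noetherian argument applies to them; and membership of each
  l(f) in an ideal supplies quotients separately for each l, without a common radius or linearity in
  l. Division by one fixed standard basis removes both defects: it is a single linear recursion on
  coefficients, and its convergence estimate sees only norms. Independence of the q_j is wanted at
  each point near the base point and not just over the germs: coordinates are then unique pointwise,
  hence glue and restrict, and statements about germs at one point become statements about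
  sheaves.\<close>

section \<open>Complex linear functionals\<close>

text \<open>Zorn's lemma is applied to graphs, that is, to subspaces of pairs: an upper bound of a
  chain is then a plain union. The bound \<open>r \<le> norm x\<close> by itself makes such a
  subspace single-valued, since two values over one point give pairs over 0 of either sign. The real
  case comes first because the extension by one vector uses the order of the values.\<close>

lemma hahn_banach_point:
  fixes x0 :: "'a::real_normed_vector"
  shows "\<exists>u::'a \<Rightarrow> real. bounded_linear u \<and> u x0 = norm x0 \<and> (\<forall>x. \<bar>u x\<bar> \<le> norm x)"
proof -
  define \<G> where "\<G> = {G :: ('a \<times> real) set. subspace G \<and> (x0, norm x0) \<in> G \<and> (\<forall>(x, r)\<in>G. r \<le> norm x)}"
  have "t * norm x0 \<le> \<bar>t\<bar> * norm x0" for t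
    by (intro mult_right_mono) auto
  then have "span {(x0, norm x0)} \<in> \<G>"
    using span_base[of "(x0, norm x0)" "{(x0, norm x0)}"] subspace_span[of "{(x0, norm x0)}"]
    unfolding \<G>_def by (auto simp: span_singleton)
  then have ne: "\<G> \<noteq> {}" by blast
  have chain: "\<Union>\<C> \<in> \<G>" if C: "\<C> \<noteq> {}" "subset.chain \<G> \<C>" for \<C>
  proof -
    have "subspace (\<Union>\<C>)"
      unfolding subspace_def
    proof (intro conjI ballI allI)
      show "0 \<in> \<Union>\<C>" using C by (auto simp: \<G>_def subset.chain_def subspace_def)
      fix x y assume "x \<in> \<Union>\<C>" "y \<in> \<Union>\<C>"
      then obtain X Y where "X \<in> \<C>" "Y \<in> \<C>" "x \<in> X" "y \<in> Y" by auto
      moreover then have "X \<subseteq> Y \<or> Y \<subseteq> X" using C(2) by (auto simp: subset.chain_def)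
      ultimately obtain Z where "Z \<in> \<C>" "x \<in> Z" "y \<in> Z" by blast
      moreover then have "subspace Z" using C(2) by (auto simp: subset.chain_def \<G>_def)
      ultimately show "x + y \<in> \<Union>\<C>" by (meson UnionI subspace_add)
    next
      fix c :: real and x assume "x \<in> \<Union>\<C>"
      then obtain X where "X \<in> \<C>" "x \<in> X" by auto
      moreover then have "subspace X" using C(2) by (auto simp: subset.chain_def \<G>_def)
      ultimately show "c *\<^sub>R x \<in> \<Union>\<C>" by (meson UnionI subspace_scale)
    qed
    then show ?thesis using C unfolding \<G>_def subset.chain_def by blast
  qed
  obtain G where G: "G \<in> \<G>" and max: "\<And>X. X \<in> \<G> \<Longrightarrow> G \<subseteq> X \<Longrightarrow> X = G"
    using subset_Zorn_nonempty[OF ne chain] by metis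
  have sub: "subspace G" and xG: "(x0, norm x0) \<in> G" and le: "\<And>x r. (x, r) \<in> G \<Longrightarrow> r \<le> norm x"
    using G by (auto simp: \<G>_def)
  have uniq: "r = s" if "(x, r) \<in> G" "(x, s) \<in> G" for x r s
    using le[of 0 "r - s"] le[of 0 "s - r"] subspace_diff[OF sub that] subspace_diff[OF sub that(2,1)] by simp
  have total: "\<exists>r. (y, r) \<in> G" for y
  proof (rule ccontr)
    assume no: "\<nexists>r. (y, r) \<in> G"
    define L where "L = (\<lambda>(x, r). r - norm (x - y)) ` G"
    have cross: "r - norm (x - y) \<le> norm (x' + y) - r'" if "(x, r) \<in> G" "(x', r') \<in> G" for x r x' r'
    proof -
      have "r + r' \<le> norm (x + x')" using le subspace_add[OF sub that] by simp
      also have "\<dots> \<le> norm (x - y) + norm (x' + y)"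
        using norm_triangle_ineq[of "x - y" "x' + y"] by simp
      finally show ?thesis by simp
    qed
    \<comment> \<open>The value at \<open>y\<close>. By \<open>cross\<close> the numbers
      \<open>r - norm (x - y)\<close> all lie below the numbers \<open>norm (x' + y) - r'\<close>,
      and anything in between would do. The inequalities \<open>a1\<close> and \<open>a2\<close> are
      the cases of the multiples -1 and +1 of \<open>y\<close>; \<open>key\<close> follows from them
      by scaling.\<close>
    define a where "a = Sup L"
    have Lne: "L \<noteq> {}" using xG by (auto simp: L_def)
    have bdd: "bdd_above L" using cross[OF _ xG] unfolding L_def bdd_above_def by fastforce
    have a1: "r - norm (x - y) \<le> a" if "(x, r) \<in> G" for x r
      unfolding a_def by (rule cSup_upper) (use that bdd in \<open>auto simp: L_def\<close>)
    have a2: "a \<le> norm (x + y) - r" if "(x, r) \<in> G" for x r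
      unfolding a_def by (rule cSup_least) (use Lne cross[OF _ that] in \<open>auto simp: L_def\<close>)
    have key: "r + t * a \<le> norm (x + t *\<^sub>R y)" if g: "(x, r) \<in> G" for x r t
    proof -
      consider "t = 0" | "t > 0" | "t < 0" by linarith
      then show ?thesis
      proof cases
        case 1 then show ?thesis using le[OF g] by simp
      next
        case 2
        have "((1/t) *\<^sub>R x, (1/t) * r) \<in> G" using subspace_scale[OF sub g, of "1/t"] by simp
        from a2[OF this] have "a + r / t \<le> norm ((1/t) *\<^sub>R x + y)" by simp
        then have "t * (a + r / t) \<le> t * norm ((1/t) *\<^sub>R x + y)" using 2 by simp
        also have "\<dots> = norm (t *\<^sub>R ((1/t) *\<^sub>R x + y))" using 2 by simp
        finally show ?thesis using 2 by (simp add: algebra_simps)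
      next
        case 3
        have "((1/(-t)) *\<^sub>R x, (1/(-t)) * r) \<in> G" using subspace_scale[OF sub g, of "1/(-t)"] by simp
        from a1[OF this] have "r / (-t) - a \<le> norm ((1/(-t)) *\<^sub>R x - y)" by simp
        then have "(-t) * (r / (-t) - a) \<le> (-t) * norm ((1/(-t)) *\<^sub>R x - y)" using 3
          by (intro mult_left_mono) auto
        also have "\<dots> = norm ((-t) *\<^sub>R ((1/(-t)) *\<^sub>R x - y))" using 3 by (simp del: scaleR_minus_left)
        finally show ?thesis using 3 by (simp add: algebra_simps)
      qed
    qed
    have "span (insert (y, a) G) \<in> \<G>"
      unfolding \<G>_def mem_Collect_eq
    proof (intro conjI)
      show "(x0, norm x0) \<in> span (insert (y, a) G)" using xG by (simp add: span_base)
      show "\<forall>(x, r)\<in>span (insert (y, a) G). r \<le> norm x"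
      proof (clarify)
        fix x r assume "(x, r) \<in> span (insert (y, a) G)"
        then obtain t where "(x, r) - t *\<^sub>R (y, a) \<in> G"
          using span_eq_iff[THEN iffD2, OF sub] by (auto simp: span_breakdown_eq)
        then have "(x - t *\<^sub>R y, r - t * a) \<in> G" by simp
        from key[OF this, of t] show "r \<le> norm x" by simp
      qed
    qed auto
    from max[OF this] have "(y, a) \<in> G"
      using span_superset[of "insert (y, a) G"] by auto
    with no show False by blast
  qed
  define u where "u x = (THE r. (x, r) \<in> G)" for x
  have uG: "(x, u x) \<in> G" for x
    unfolding u_def by (rule theI') (use total uniq in blast)
  have u_eq: "u x = r" if "(x, r) \<in> G" for x r using uniq[OF uG that] .
  have bd: "\<bar>u x\<bar> \<le> norm x" for x
    using le[OF uG[of x]] le[of "-x" "- u x"] subspace_neg[OF sub uG[of x]] by simp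
  have "bounded_linear u"
  proof (rule bounded_linear_intro)
    show "u (x + y) = u x + u y" for x y using u_eq subspace_add[OF sub uG uG] by simp
    show "u (c *\<^sub>R x) = c *\<^sub>R u x" for c x using u_eq subspace_scale[OF sub uG] by simp
    show "norm (u x) \<le> norm x * 1" for x using bd by simp
  qed
  then show ?thesis using bd u_eq[OF xG] by blast
qed

section \<open>Complex scalars and the complex dual\<close>

lemma scaleC_zero_left [simp]: "0 *\<^sub>C x = (0::'e::complex_banach)"
  using scaleC_of_real[of 0 x] by simp

lemma scaleC_one [simp]: "1 *\<^sub>C x = (x::'e::complex_banach)"
  using scaleC_of_real[of 1 x] by simp

lemma bounded_bilinear_scaleC: "bounded_bilinear (\<lambda>c x. c *\<^sub>C (x::'e::complex_banach))"
proof
  show "(a *\<^sub>R c) *\<^sub>C x = a *\<^sub>R c *\<^sub>C x" for a c and x :: 'e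
    by (metis scaleC_of_real scaleC_scaleC scaleR_conv_of_real)
  show "c *\<^sub>C a *\<^sub>R x = a *\<^sub>R c *\<^sub>C x" for a c and x :: 'e
    by (metis mult.commute scaleC_of_real scaleC_scaleC)
  show "\<exists>K. \<forall>c x. norm (c *\<^sub>C (x::'e)) \<le> norm c * norm x * K"
    by (intro exI[of _ 1]) (simp add: norm_scaleC)
qed (simp_all add: scaleC_add_left scaleC_add_right)

interpretation scaleC: bounded_bilinear "\<lambda>c x. c *\<^sub>C (x::'e::complex_banach)"
  by (rule bounded_bilinear_scaleC)

declare scaleC.zero_right [simp]

definition cdual :: "('e::complex_banach \<Rightarrow> complex) \<Rightarrow> bool" where
  "cdual l \<longleftrightarrow> bounded_linear l \<and> (\<forall>c x. l (c *\<^sub>C x) = c * l x)"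

lemma cdual_bounded_linear: "cdual l \<Longrightarrow> bounded_linear l"
  and cdual_scaleC: "cdual l \<Longrightarrow> l (c *\<^sub>C x) = c * l x"
  by (auto simp: cdual_def)

text \<open>Complexify the real functional: u(x) - i u(ix) is the only complex linear map with real
  part u. At \<open>x0\<close> its real part is \<open>norm x0\<close>, so it does not vanish
  there.\<close>

lemma cdual_separates:
  fixes x0 :: "'e::complex_banach"
  assumes "x0 \<noteq> 0"
  obtains l where "cdual l" "l x0 \<noteq> 0"
proof -
  obtain u :: "'e \<Rightarrow> real" where u: "bounded_linear u" "u x0 = norm x0" "\<And>x. \<bar>u x\<bar> \<le> norm x"
    using hahn_banach_point by blast
  interpret u: bounded_linear u by fact
  define l where "l x = Complex (u x) (- u (\<i> *\<^sub>C x))" for x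
  have R: "c *\<^sub>C x = Re c *\<^sub>R x + Im c *\<^sub>R (\<i> *\<^sub>C x)" for c and x :: 'e
  proof -
    have "c *\<^sub>C x = (complex_of_real (Re c) + complex_of_real (Im c) * \<i>) *\<^sub>C x"
      using complex_eq[of c] by (simp add: mult.commute)
    also have "\<dots> = Re c *\<^sub>R x + Im c *\<^sub>R (\<i> *\<^sub>C x)"
      by (simp only: scaleC_add_left scaleC_of_real scaleC_scaleC[symmetric])
    finally show ?thesis .
  qed
  have ii: "\<i> *\<^sub>C \<i> *\<^sub>C x = - x" for x :: 'e
    by (simp add: scaleC_scaleC scaleC.minus_left)
  have lC: "l (c *\<^sub>C x) = c * l x" for c x
  proof -
    have "u (\<i> *\<^sub>C c *\<^sub>C x) = Re c * u (\<i> *\<^sub>C x) - Im c * u x"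
      by (subst R[of c]) (simp add: scaleC.add_right scaleC.scaleR_right ii u.add u.scaleR u.diff u.neg)
    then show ?thesis
      unfolding l_def by (subst R[of c]) (simp add: u.add u.scaleR complex_eq_iff algebra_simps)
  qed
  have "bounded_linear l"
  proof (rule bounded_linear_intro)
    show "l (x + y) = l x + l y" for x y
      by (simp add: l_def u.add scaleC_add_right complex_eq_iff)
    show "l (r *\<^sub>R x) = r *\<^sub>R l x" for r x
      by (simp add: l_def u.scaleR scaleC.scaleR_right complex_eq_iff)
    show "norm (l x) \<le> norm x * 2" for x
    proof -
      have "cmod (l x) \<le> \<bar>Re (l x)\<bar> + \<bar>Im (l x)\<bar>" by (rule cmod_le)
      also have "\<dots> \<le> norm x + norm x"
        using u(3)[of x] u(3)[of "\<i> *\<^sub>C x"] by (simp add: l_def norm_scaleC)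
      finally show ?thesis by simp
    qed
  qed
  moreover have "l x0 \<noteq> 0" using assms u(2) by (simp add: l_def complex_eq_iff)
  ultimately show thesis using that lC by (auto simp: cdual_def)
qed

lemma cdual_eqI:
  fixes x y :: "'e::complex_banach"
  assumes "\<And>l. cdual l \<Longrightarrow> l x = l y"
  shows "x = y"
proof (rule ccontr)
  assume "x \<noteq> y"
  then obtain l where "cdual l" "l (x - y) \<noteq> 0" using cdual_separates[of "x - y"] by auto
  then show False using assms[of l] by (simp add: cdual_def linear_simps)
qed

unbundle no fps_syntax

section \<open>Germs of holomorphic maps\<close>

definition cdiff :: "(complex ^ 'n \<Rightarrow> 'e::complex_banach) \<Rightarrow> complex ^ 'n \<Rightarrow> bool" where
  "cdiff f z \<longleftrightarrow> (\<exists>D. (f has_derivative D) (at z) \<and> (\<forall>c v. D (c *s v) = c *\<^sub>C D v))"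

lemma holomorphic_map_on_iff: "holomorphic_map_on f U \<longleftrightarrow> (\<forall>z\<in>U. cdiff f z)"
  by (simp add: holomorphic_map_on_def cdiff_def)

lemma cdiff_const: "cdiff (\<lambda>z. c) z"
  unfolding cdiff_def by (intro exI[of _ "\<lambda>h. 0"]) (auto simp: scaleC.zero_right)

lemma cdiff_add:
  assumes "cdiff f z" "cdiff g z"
  shows "cdiff (\<lambda>z. f z + g z) z"
proof -
  obtain C D where "(f has_derivative C) (at z)" "\<And>a v. C (a *s v) = a *\<^sub>C C v"
    "(g has_derivative D) (at z)" "\<And>a v. D (a *s v) = a *\<^sub>C D v"
    using assms by (auto simp: cdiff_def)
  then show ?thesis
    unfolding cdiff_def
    by (intro exI[of _ "\<lambda>h. C h + D h"]) (auto intro: has_derivative_add simp: scaleC_add_right)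
qed

lemma cdiff_scaleC:
  fixes c :: "complex ^ 'n \<Rightarrow> complex"
  assumes "cdiff c z" "cdiff f z"
  shows "cdiff (\<lambda>z. c z *\<^sub>C f z) z"
proof -
  obtain C D where C: "(c has_derivative C) (at z)" "\<And>a v. C (a *s v) = a * C v"
    and D: "(f has_derivative D) (at z)" "\<And>a v. D (a *s v) = a *\<^sub>C D v"
    using assms by (auto simp: cdiff_def scaleC_complex_def)
  have "((\<lambda>z. c z *\<^sub>C f z) has_derivative (\<lambda>h. c z *\<^sub>C D h + C h *\<^sub>C f z)) (at z)"
    by (rule scaleC.FDERIV[OF C(1) D(1)])
  moreover have "c z *\<^sub>C D (a *s h) + C (a *s h) *\<^sub>C f z = a *\<^sub>C (c z *\<^sub>C D h + C h *\<^sub>C f z)" for a h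
    by (simp add: C D scaleC_add_right scaleC_scaleC mult.commute)
  ultimately show ?thesis unfolding cdiff_def by blast
qed

lemma cdiff_cdual:
  assumes "cdual l" "cdiff f z"
  shows "cdiff (\<lambda>z. l (f z)) z"
proof -
  obtain D where D: "(f has_derivative D) (at z)" "\<And>a v. D (a *s v) = a *\<^sub>C D v"
    using assms by (auto simp: cdiff_def)
  have "((\<lambda>z. l (f z)) has_derivative (\<lambda>h. l (D h))) (at z)"
    using bounded_linear.has_derivative[OF cdual_bounded_linear[OF assms(1)] D(1)] .
  then show ?thesis
    unfolding cdiff_def scaleC_complex_def
    by (intro exI[of _ "\<lambda>h. l (D h)"]) (simp add: D(2) cdual_scaleC[OF assms(1)])
qed

lemma cdiff_transform:
  assumes "\<forall>\<^sub>F w in nhds z. f w = g w" "cdiff f z"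
  shows "cdiff g z"
proof -
  obtain D where D: "(f has_derivative D) (at z)" "\<And>c v. D (c *s v) = c *\<^sub>C D v"
    using assms(2) by (auto simp: cdiff_def)
  have "(g has_derivative D) (at z)"
    by (rule has_derivative_transform_eventually[OF D(1)])
      (use assms(1) eventually_nhds_x_imp_x in \<open>auto simp: eventually_at_filter elim: eventually_mono\<close>)
  then show ?thesis using D(2) by (auto simp: cdiff_def)
qed

text \<open>Germs at \<open>\<zeta>\<close> are represented by total functions, and two of them are
  the same germ when they agree eventually in \<open>nhds \<zeta>\<close>. Ideals and modules of
  germs are therefore sets of functions closed under such changes.\<close>

definition hol_at :: "complex ^ 'n \<Rightarrow> (complex ^ 'n \<Rightarrow> 'e::complex_banach) \<Rightarrow> bool" where
  "hol_at \<zeta> f \<longleftrightarrow> (\<forall>\<^sub>F z in nhds \<zeta>. cdiff f z)"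

lemma hol_at_const: "hol_at \<zeta> (\<lambda>z. c)"
  by (simp add: hol_at_def cdiff_const)

lemma hol_at_add: "hol_at \<zeta> f \<Longrightarrow> hol_at \<zeta> g \<Longrightarrow> hol_at \<zeta> (\<lambda>z. f z + g z)"
  unfolding hol_at_def by (erule (1) eventually_elim2) (rule cdiff_add)

lemma hol_at_scaleC: "hol_at \<zeta> c \<Longrightarrow> hol_at \<zeta> f \<Longrightarrow> hol_at \<zeta> (\<lambda>z. c z *\<^sub>C f z)"
  unfolding hol_at_def by (erule (1) eventually_elim2) (rule cdiff_scaleC)

lemma hol_at_mult: "hol_at \<zeta> c \<Longrightarrow> hol_at \<zeta> f \<Longrightarrow> hol_at \<zeta> (\<lambda>z. c z * f z :: complex)"
  using hol_at_scaleC[of \<zeta> c f] by (simp add: scaleC_complex_def)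

lemma hol_at_minus: "hol_at \<zeta> f \<Longrightarrow> hol_at \<zeta> (\<lambda>z. - f z)"
  using hol_at_scaleC[OF hol_at_const[of \<zeta> "-1"], of f] by (simp add: scaleC.minus_left)

lemma hol_at_diff: "hol_at \<zeta> f \<Longrightarrow> hol_at \<zeta> g \<Longrightarrow> hol_at \<zeta> (\<lambda>z. f z - g z)"
  using hol_at_add[OF _ hol_at_minus] by fastforce

lemma hol_at_cdual: "cdual l \<Longrightarrow> hol_at \<zeta> f \<Longrightarrow> hol_at \<zeta> (\<lambda>z. l (f z))"
  unfolding hol_at_def by (auto elim: eventually_mono intro: cdiff_cdual)

lemma cdiff_isCont: "cdiff f z \<Longrightarrow> isCont f z"
  unfolding cdiff_def by (blast intro: has_derivative_continuous)

lemma hol_at_isCont: "hol_at \<zeta> f \<Longrightarrow> isCont f \<zeta>"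
  unfolding hol_at_def by (auto dest: eventually_nhds_x_imp_x cdiff_isCont)

lemma hol_at_transform:
  assumes "\<forall>\<^sub>F z in nhds \<zeta>. f z = g z" "hol_at \<zeta> f"
  shows "hol_at \<zeta> g"
proof -
  have "\<forall>\<^sub>F z in nhds \<zeta>. \<forall>\<^sub>F w in nhds z. f w = g w"
    using assms(1) by (simp add: eventually_eventually)
  with assms(2) show ?thesis
    unfolding hol_at_def by eventually_elim (rule cdiff_transform)
qed

lemma cdiff_inverse:
  fixes f :: "complex ^ 'n \<Rightarrow> complex"
  assumes "cdiff f z" "f z \<noteq> 0"
  shows "cdiff (\<lambda>z. inverse (f z)) z"
proof -
  obtain D where D: "(f has_derivative D) (at z)" "\<And>a v. D (a *s v) = a * D v"
    using assms by (auto simp: cdiff_def scaleC_complex_def)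
  have "((\<lambda>z. inverse (f z)) has_derivative (\<lambda>h. - (inverse (f z) * D h * inverse (f z)))) (at z)"
    by (rule Deriv.has_derivative_inverse[OF assms(2) D(1)])
  then show ?thesis unfolding cdiff_def by (intro exI conjI) (auto simp: D scaleC_complex_def)
qed

lemma hol_at_inverse:
  fixes f :: "complex ^ 'n \<Rightarrow> complex"
  assumes "hol_at \<zeta> f" "f \<zeta> \<noteq> 0"
  shows "hol_at \<zeta> (\<lambda>z. inverse (f z))"
proof -
  have "\<forall>\<^sub>F z in nhds \<zeta>. f z \<noteq> 0"
    using hol_at_isCont[OF assms(1)] assms(2)
    by (metis isCont_def t1_space_nhds tendsto_at_iff_tendsto_nhds tendsto_imp_eventually_ne)
  with assms(1) show ?thesis
    unfolding hol_at_def by eventually_elim (rule cdiff_inverse)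
qed

section \<open>Monomials indexed by natural numbers\<close>

text \<open>Following Bohr, the \<open>i\<close>-th variable corresponds to a prime \<open>pr i\<close>, so that the multi-indices
  correspond to the natural numbers that have prime factors in the range of \<open>pr\<close> only. The order of
  the natural numbers is then a monomial order, and the powers \<open>(1/m)^s\<close> are weights for which a
  leading monomial dominates when \<open>s\<close> is large.\<close>

definition pr :: "'n::finite \<Rightarrow> nat" where
  "pr = (SOME f. inj f \<and> (\<forall>i. prime (f i)))"

lemma inj_pr: "inj (pr :: 'n::finite \<Rightarrow> nat)" and prime_pr: "prime (pr (i::'n))"
proof -
  obtain P :: "nat set" where P: "finite P" "card P = CARD('n)" "P \<subseteq> {p. prime p}"
    using infinite_arbitrarily_large[OF primes_infinite] by blast
  obtain f :: "'n \<Rightarrow> nat" where "bij_betw f UNIV P"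
    using finite_same_card_bij[of "UNIV :: 'n set" P] P by auto
  then have "inj f \<and> (\<forall>i. prime (f i))" using P(3) by (auto simp: bij_betw_def)
  then have "inj (pr :: 'n \<Rightarrow> nat) \<and> (\<forall>i. prime (pr (i::'n)))"
    unfolding pr_def by (rule someI[of "\<lambda>f :: 'n \<Rightarrow> nat. inj f \<and> (\<forall>i. prime (f i))"])
  then show "inj (pr :: 'n \<Rightarrow> nat)" "prime (pr (i::'n))" by auto
qed

lemma pr_ge_2: "2 \<le> pr i" and pr_pos: "0 < pr i"
  using prime_ge_2_nat[OF prime_pr[of i]] by auto

lemma pr_eq_iff [simp]: "pr i = pr j \<longleftrightarrow> i = j"
  by (rule inj_eq[OF inj_pr])

text \<open>The multi-indices supported on a set \<open>S\<close> of variables. All variables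
  together give all multi-indices; smaller sets serve the induction over the variables in
  \<open>partial_expansion\<close>.\<close>

definition smooth :: "'n::finite set \<Rightarrow> nat set" where
  "smooth S = {m. m > 0 \<and> (\<forall>q. prime q \<longrightarrow> q dvd m \<longrightarrow> q \<in> pr ` S)}"

lemma smooth_pos: "m \<in> smooth S \<Longrightarrow> m > 0"
  by (simp add: smooth_def)

lemma smooth_1: "1 \<in> smooth S"
  by (auto simp: smooth_def)

lemma smooth_mult: "m \<in> smooth S \<Longrightarrow> k \<in> smooth S \<Longrightarrow> m * k \<in> smooth S"
  by (auto simp: smooth_def prime_dvd_mult_iff)

lemma smooth_dvd: "m \<in> smooth S \<Longrightarrow> k dvd m \<Longrightarrow> k \<in> smooth S"
  by (auto simp: smooth_def intro: dvd_trans Nat.gr0I)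

lemma smooth_pr: "i \<in> S \<Longrightarrow> pr i \<in> smooth S"
  by (auto simp: smooth_def pr_pos dest!: primes_dvd_imp_eq[OF _ prime_pr])

lemma smooth_induct [consumes 1, case_names 1 mult]:
  assumes "m \<in> smooth S" "P 1"
    and step: "\<And>i m. i \<in> S \<Longrightarrow> m \<in> smooth S \<Longrightarrow> P m \<Longrightarrow> P (pr i * m)"
  shows "P m"
  using assms(1)
proof (induction m rule: less_induct)
  case (less m)
  show ?case
  proof (cases "m = 1")
    case False
    then obtain q where q: "prime q" "q dvd m" by (metis prime_factor_nat)
    then obtain i where i: "i \<in> S" "q = pr i" using less.prems by (auto simp: smooth_def)
    obtain k where k: "m = pr i * k" using q i by auto
    have "k \<in> smooth S" using less.prems k by (auto intro: smooth_dvd)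
    moreover have "k < m" proof -
      have "2 * k \<le> pr i * k" using pr_ge_2[of i] by simp
      moreover have "k > 0" using k smooth_pos[OF less.prems] by simp
      ultimately show ?thesis using k by linarith
    qed
    ultimately show ?thesis using less.IH step[OF i(1)] k by blast
  qed (use assms in simp)
qed

text \<open>The exponent of the i-th variable is the multiplicity of its prime. Off
  \<open>smooth UNIV\<close> the value is spurious, because other primes are ignored and
  \<open>mon 0\<close> is 1; this is why coefficient families are made to vanish there.\<close>

definition mon :: "nat \<Rightarrow> complex ^ 'n::finite \<Rightarrow> complex" where
  "mon m z = (\<Prod>i\<in>UNIV. (z $ i) ^ multiplicity (pr i) m)"

lemma mon_1 [simp]: "mon (Suc 0) z = 1"
  by (simp add: mon_def)

lemma mon_mult: "m > 0 \<Longrightarrow> k > 0 \<Longrightarrow> mon (m * k) z = mon m z * mon k z"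
  unfolding mon_def
  by (simp add: prime_elem_multiplicity_mult_distrib prime_pr power_add prod.distrib)

lemma mon_pr [simp]: "mon (pr i) z = z $ i"
proof -
  have "multiplicity (pr j) (pr i) = (if j = i then 1 else 0)" for j
    using prime_pr[of i] prime_pr[of j] pr_eq_iff[of i j]
    by (auto intro!: not_dvd_imp_multiplicity_0 dest: primes_dvd_imp_eq)
  then have "mon (pr i) z = (\<Prod>j\<in>UNIV. if j = i then z $ j else 1)"
    unfolding mon_def by (intro prod.cong) auto
  then show ?thesis by simp
qed

text \<open>With these radii the monomial encoded by m has supremum (1/m)^s on the polydisc: one
  exponent \<open>s\<close> controls all radii, and products of monomials match products of weights.
  Raising \<open>s\<close> shrinks the polydisc to a point and favours small m over large m.\<close>

definition pdisc :: "nat \<Rightarrow> (complex ^ 'n::finite) set" where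
  "pdisc s = {z. \<forall>i. norm (z $ i) \<le> (1 / pr i) ^ s}"

definition opdisc :: "nat \<Rightarrow> (complex ^ 'n::finite) set" where
  "opdisc s = {z. \<forall>i. norm (z $ i) < (1 / pr i) ^ s}"

lemma opdisc_subset: "opdisc s \<subseteq> pdisc s"
  by (auto simp: opdisc_def pdisc_def intro: less_imp_le)

lemma zero_in_opdisc: "0 \<in> opdisc s"
  by (auto simp: opdisc_def pr_pos)

lemma pdisc_mono: "s \<le> t \<Longrightarrow> pdisc t \<subseteq> (pdisc s :: (complex ^ 'n::finite) set)"
proof -
  assume "s \<le> t"
  have "(1 / real (pr i)) ^ t \<le> (1 / pr i) ^ s" for i :: 'n
    using pr_pos[of i] \<open>s \<le> t\<close> by (intro power_decreasing) auto
  then show ?thesis unfolding pdisc_def by (auto intro: order_trans)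
qed

lemma open_opdisc: "open (opdisc s :: (complex ^ 'n::finite) set)"
proof -
  have "opdisc s = (\<Inter>i. {z :: complex ^ 'n. norm (z $ i) < (1 / pr i) ^ s})"
    by (auto simp: opdisc_def)
  then show ?thesis by (simp only:) (intro open_INT finite ballI open_Collect_less continuous_intros)
qed

lemma convex_opdisc: "convex (opdisc s :: (complex ^ 'n::finite) set)"
proof (rule convexI)
  fix x y :: "complex ^ 'n" and u v :: real
  assume xy: "x \<in> opdisc s" "y \<in> opdisc s" and uv: "0 \<le> u" "0 \<le> v" "u + v = 1"
  have "norm ((u *\<^sub>R x + v *\<^sub>R y) $ i) < (1 / pr i) ^ s" for i
  proof -
    have "u *\<^sub>R (x $ i) + v *\<^sub>R (y $ i) \<in> ball 0 ((1 / real (pr i)) ^ s)"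
      by (rule convexD[OF convex_ball]) (use xy uv in \<open>auto simp: opdisc_def\<close>)
    then show ?thesis by simp
  qed
  then show "u *\<^sub>R x + v *\<^sub>R y \<in> opdisc s" by (simp add: opdisc_def)
qed

lemma pdisc_in_nhd:
  assumes "\<forall>\<^sub>F z in nhds (0 :: complex ^ 'n). P z"
  obtains s where "\<forall>z\<in>pdisc s. P z"
proof -
  obtain e where e: "e > 0" "\<And>z. norm z < e \<Longrightarrow> P z"
    using assms by (auto simp: eventually_nhds_metric)
  \<comment> \<open>All primes are at least 2, so each radius is at most (1/2)^s, and the norm is at
    most the sum of the moduli of the coordinates.\<close>
  have lim: "(\<lambda>s. real CARD('n) * (1/2) ^ s) \<longlonglongrightarrow> real CARD('n) * 0"
    by (intro tendsto_intros LIMSEQ_realpow_zero) auto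
  then have "\<forall>\<^sub>F s in sequentially. real CARD('n) * (1/2) ^ s < e"
    using order_tendstoD(2)[OF lim, of e] e(1) by simp
  then obtain s where s: "real CARD('n) * (1/2) ^ s < e"
    by (auto simp: eventually_sequentially)
  have "P z" if z: "z \<in> pdisc s" for z
  proof -
    have "norm z \<le> (\<Sum>i\<in>UNIV. norm (z $ i))"
      unfolding norm_vec_def by (rule L2_set_le_sum) auto
    also have "\<dots> \<le> (\<Sum>i\<in>(UNIV::'n set). (1/2) ^ s)"
    proof (rule sum_mono)
      fix i :: 'n
      have "norm (z $ i) \<le> (1 / pr i) ^ s" using z by (simp add: pdisc_def)
      also have "\<dots> \<le> (1/2) ^ s" using pr_ge_2[of i] by (intro power_mono) (auto simp: field_simps)
      finally show "norm (z $ i) \<le> (1/2) ^ s" .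
    qed
    finally show ?thesis using s by (intro e(2)) simp
  qed
  then show thesis using that by blast
qed

lemma eventually_opdisc: "\<forall>\<^sub>F z in nhds (\<zeta> :: complex ^ 'n::finite). z - \<zeta> \<in> opdisc s"
proof -
  have lim: "((\<lambda>z. z - \<zeta>) \<longlongrightarrow> \<zeta> - \<zeta>) (nhds \<zeta>)" by (intro tendsto_intros filterlim_ident)
  show ?thesis
    by (rule topological_tendstoD[OF lim open_opdisc[of s]]) (simp add: zero_in_opdisc)
qed

lemma norm_mon_le:
  fixes z :: "complex ^ 'n::finite"
  assumes "m \<in> smooth (UNIV :: 'n set)" "z \<in> pdisc s"
  shows "norm (mon m z) \<le> (1 / m) ^ s"
  using assms(1)
proof (induction rule: smooth_induct)
  case (mult i m)
  have "norm (mon (pr i * m) z) = norm (z $ i) * norm (mon m z)"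
    using mult pr_pos[of i] by (simp add: mon_mult smooth_pos norm_mult)
  also have "\<dots> \<le> (1 / pr i) ^ s * (1 / m) ^ s"
    using mult assms(2) by (intro mult_mono) (auto simp: pdisc_def)
  finally show ?case by (simp add: power_divide power_mult_distrib)
qed simp

text \<open>By the product rule each prime factor of m costs one reciprocal radius, bounded by
  \<open>K\<close>. The number of factors is estimated generously by m itself; this suffices because
  raising \<open>s\<close> by one absorbs a factor m.\<close>

lemma mon_has_derivative:
  assumes "m \<in> smooth (UNIV :: 'n set)"
    and K: "\<And>i::'n. real (pr i) ^ s \<le> K"
  shows "\<exists>D. \<forall>z :: complex ^ 'n. (mon m has_derivative D z) (at z) \<and>
    (\<forall>c v. D z (c *s v) = c * D z v) \<and> (z \<in> pdisc s \<longrightarrow> (\<forall>h. norm (D z h) \<le> K * m * (1 / m) ^ s * norm h))"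
  using assms(1)
proof (induction rule: smooth_induct)
  case 1
  have "0 \<le> K" using K[of undefined] by (meson of_nat_0_le_iff order_trans zero_le_power)
  then show ?case by (intro exI[of _ "\<lambda>z h. 0"]) (auto simp: mon_def[abs_def])
next
  case (mult i m)
  then obtain D where D: "\<And>z :: complex ^ 'n. (mon m has_derivative D z) (at z)"
    "\<And>z c v. D z (c *s v) = c * D z v"
    "\<And>z h. z \<in> pdisc s \<Longrightarrow> norm (D z h) \<le> K * m * (1 / m) ^ s * norm h"
    by metis
  have m: "m > 0" using mult smooth_pos by blast
  have eq: "mon (pr i * m) = (\<lambda>z. z $ i * mon m z)"
    using m pr_pos[of i] by (auto simp: mon_mult fun_eq_iff)
  have "(mon (pr i * m) has_derivative (\<lambda>h. z $ i * D z h + h $ i * mon m z)) (at z)" for z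
    unfolding eq by (rule has_derivative_mult)
      (auto intro!: D bounded_linear_imp_has_derivative bounded_linear_vec_nth)
  moreover have "z $ i * D z (c *s v) + (c *s v) $ i * mon m z = c * (z $ i * D z v + v $ i * mon m z)" for z c v
    by (simp add: D algebra_simps)
  moreover have "norm (z $ i * D z h + h $ i * mon m z) \<le> K * real (pr i * m) * (1 / real (pr i * m)) ^ s * norm h"
    if z: "z \<in> pdisc s" for z h
  proof -
    have K1: "1 \<le> K" using K[of i] one_le_power[of "real (pr i)" s] pr_ge_2[of i] by linarith
    have AB: "(1 / real (pr i * m)) ^ s = (1 / pr i) ^ s * (1 / m) ^ s"
      by (simp add: power_divide power_mult_distrib)
    have "norm (z $ i * D z h + h $ i * mon m z) \<le> norm (z $ i) * norm (D z h) + norm (h $ i) * norm (mon m z)"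
      by (metis norm_mult norm_triangle_ineq)
    also have "\<dots> \<le> (1 / pr i) ^ s * (K * m * (1 / m) ^ s * norm h) + norm h * (1 / m) ^ s"
      using z D(3)[OF z] norm_mon_le[OF mult(2) z]
      by (intro add_mono mult_mono) (auto simp: pdisc_def Finite_Cartesian_Product.norm_nth_le)
    also have "norm h * (1 / m) ^ s = (1 / pr i) ^ s * (real (pr i) ^ s * (1 / m) ^ s * norm h)"
      using pr_pos[of i] by (simp add: power_divide)
    also have "\<dots> \<le> (1 / pr i) ^ s * (K * (1 / m) ^ s * norm h)"
      using K[of i] by (intro mult_left_mono mult_right_mono) auto
    also have "(1 / pr i) ^ s * (K * m * (1 / m) ^ s * norm h) + (1 / pr i) ^ s * (K * (1 / m) ^ s * norm h)
       = (K * (real m + 1)) * ((1 / real (pr i * m)) ^ s * norm h)"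
      unfolding AB by (simp only: distrib_left distrib_right mult_ac mult_1_right mult_1)
    also have "\<dots> \<le> (K * real (pr i * m)) * ((1 / real (pr i * m)) ^ s * norm h)"
    proof (intro mult_right_mono mult_left_mono)
      have "m + 1 \<le> 2 * m" using m by simp
      also have "\<dots> \<le> pr i * m" using pr_ge_2[of i] by simp
      finally show "real m + 1 \<le> real (pr i * m)" by (metis of_nat_1 of_nat_add of_nat_mono)
    qed (use K1 in auto)
    finally show ?thesis by (simp only: mult.assoc)
  qed
  ultimately show ?case
    by (intro exI[of _ "\<lambda>z h. z $ i * D z h + h $ i * mon m z"]) blast
qed

section \<open>Power series expansions\<close>

text \<open>The summability condition is finiteness of a weighted l^1 norm with weights (1/m)^s. It
  implies absolute convergence on the polydisc and is the norm in which division is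
  estimated.\<close>

definition expands ::
    "complex ^ 'n::finite \<Rightarrow> nat \<Rightarrow> (nat \<Rightarrow> 'e::complex_banach) \<Rightarrow> (complex ^ 'n \<Rightarrow> 'e) \<Rightarrow> bool" where
  "expands \<zeta> s a f \<longleftrightarrow> (\<forall>m. m \<notin> smooth (UNIV :: 'n set) \<longrightarrow> a m = 0) \<and>
     summable (\<lambda>m. norm (a m) * (1 / m) ^ s) \<and>
     (\<forall>z\<in>pdisc s. (\<lambda>m. mon m z *\<^sub>C a m) sums f (\<zeta> + z))"

lemma norm_term_le:
  fixes z :: "complex ^ 'n::finite"
  assumes "\<And>m. m \<notin> smooth (UNIV :: 'n set) \<Longrightarrow> a m = 0" "z \<in> pdisc s"
  shows "norm (mon m z *\<^sub>C a m) \<le> norm (a m) * (1 / m) ^ s"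
proof (cases "m \<in> smooth (UNIV :: 'n set)")
  case True
  then show ?thesis using norm_mon_le[OF True assms(2)]
    by (simp add: norm_scaleC mult.commute mult_left_mono)
qed (use assms in simp)

lemma summable_weight_mono:
  assumes "summable (\<lambda>m. norm (a m) * (1 / real m) ^ s)" "s \<le> t" "a 0 = 0"
  shows "summable (\<lambda>m. norm (a m) * (1 / real m) ^ t)"
proof (rule summable_comparison_test[OF _ assms(1)], intro exI[of _ 0] allI impI)
  fix m :: nat
  show "norm (norm (a m) * (1 / real m) ^ t) \<le> norm (a m) * (1 / real m) ^ s"
  proof (cases "m = 0")
    case False
    then have "(1 / real m) ^ t \<le> (1 / real m) ^ s"
      using assms(2) by (intro power_decreasing) auto
    then show ?thesis by (simp add: mult_left_mono)
  qed (use assms(3) in simp)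
qed

lemma zero_notin_smooth [simp]: "0 \<notin> smooth S"
  by (simp add: smooth_def)

lemma expands_mono:
  fixes f :: "complex ^ 'n::finite \<Rightarrow> 'e::complex_banach"
  assumes "expands \<zeta> s a f" "s \<le> t"
  shows "expands \<zeta> t a f"
proof -
  have "a 0 = 0" using assms(1) by (auto simp: expands_def)
  then show ?thesis
    using assms summable_weight_mono[of a s t] pdisc_mono[OF assms(2), where 'n='n]
    unfolding expands_def by blast
qed

lemma cdiff_translate:
  assumes "cdiff (\<lambda>z. f (\<zeta> + z)) x"
  shows "cdiff f (\<zeta> + x)"
proof -
  obtain D where D: "((\<lambda>z. f (\<zeta> + z)) has_derivative D) (at x)" "\<And>c v. D (c *s v) = c *\<^sub>C D v"
    using assms by (auto simp: cdiff_def)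
  have "((\<lambda>w. f (\<zeta> + (w - \<zeta>))) has_derivative (\<lambda>h. D h)) (at (\<zeta> + x))"
    by (rule has_derivative_compose[where g = "\<lambda>z. f (\<zeta> + z)"])
      (use D(1) in \<open>auto intro!: derivative_eq_intros\<close>)
  then show ?thesis using D(2) by (auto simp: cdiff_def)
qed

text \<open>Termwise differentiation, carried out on the polydisc of exponent \<open>Suc s\<close>:
  differentiated monomials grow by a factor m, and m (1/m)^(s+1) = (1/m)^s leads back to the given
  summable series.\<close>

lemma expands_hol_at:
  fixes f :: "complex ^ 'n::finite \<Rightarrow> 'e::complex_banach"
  assumes "expands \<zeta> s a f"
  shows "hol_at \<zeta> f"
proof -
  define S where "S = (opdisc (Suc s) :: (complex ^ 'n) set)"
  have supp: "\<And>m. m \<notin> smooth (UNIV :: 'n set) \<Longrightarrow> a m = 0"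
    and summ: "summable (\<lambda>m. norm (a m) * (1 / real m) ^ s)"
    and sums: "\<And>z. z \<in> pdisc s \<Longrightarrow> (\<lambda>m. mon m z *\<^sub>C a m) sums f (\<zeta> + z)"
    using assms by (auto simp: expands_def)
  define K where "K = Max (range (\<lambda>i::'n. real (pr i) ^ Suc s))"
  have K: "real (pr i) ^ Suc s \<le> K" for i :: 'n unfolding K_def by (rule Max_ge) auto
  have K0: "0 \<le> K" using K[of undefined] by (meson of_nat_0_le_iff order_trans zero_le_power)
  obtain D :: "nat \<Rightarrow> complex ^ 'n \<Rightarrow> complex ^ 'n \<Rightarrow> complex" where
    D: "\<And>m z. m \<in> smooth (UNIV :: 'n set) \<Longrightarrow> (mon m has_derivative D m z) (at z)"
    "\<And>m z c v. m \<in> smooth (UNIV :: 'n set) \<Longrightarrow> D m z (c *s v) = c * D m z v"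
    "\<And>m z h. m \<in> smooth (UNIV :: 'n set) \<Longrightarrow> z \<in> pdisc (Suc s) \<Longrightarrow>
       norm (D m z h) \<le> K * m * (1 / m) ^ Suc s * norm h"
  proof -
    have "\<forall>m. \<exists>D. m \<in> smooth (UNIV :: 'n set) \<longrightarrow> (\<forall>z :: complex ^ 'n. (mon m has_derivative D z) (at z) \<and>
      (\<forall>c v. D z (c *s v) = c * D z v) \<and>
      (z \<in> pdisc (Suc s) \<longrightarrow> (\<forall>h. norm (D z h) \<le> K * m * (1 / m) ^ Suc s * norm h)))"
      using mon_has_derivative[OF _ K] by blast
    then obtain D where "\<forall>m. m \<in> smooth (UNIV :: 'n set) \<longrightarrow> (\<forall>z :: complex ^ 'n. (mon m has_derivative D m z) (at z) \<and>
      (\<forall>c v. D m z (c *s v) = c * D m z v) \<and>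
      (z \<in> pdisc (Suc s) \<longrightarrow> (\<forall>h. norm (D m z h) \<le> K * m * (1 / m) ^ Suc s * norm h)))"
      by (rule choice[THEN exE])
    then show thesis by (intro that[of D]) blast+
  qed
  define f' where "f' m z h = D m z h *\<^sub>C a m" for m z h
  define g' where "g' z h = suminf (\<lambda>m. f' m z h)" for z h
  have bound: "norm (f' m z h) \<le> K * (norm (a m) * (1 / m) ^ s) * norm h"
    if z: "z \<in> pdisc (Suc s)" for m z h
  proof (cases "m \<in> smooth (UNIV :: 'n set)")
    case True
    have "norm (f' m z h) = norm (D m z h) * norm (a m)" by (simp add: f'_def norm_scaleC)
    also have "\<dots> \<le> (K * m * (1 / m) ^ Suc s * norm h) * norm (a m)"
      by (rule mult_right_mono[OF D(3)[OF True z]]) simp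
    also have "\<dots> = K * (norm (a m) * (1 / m) ^ s) * norm h" using smooth_pos[OF True] by simp
    finally show ?thesis .
  qed (simp add: f'_def supp scaleC.zero_right)
  have summ': "summable (\<lambda>m. K * (norm (a m) * (1 / m) ^ s) * norm h)" for h :: "complex ^ 'n"
    by (intro summable_mult summable_mult2 summ)
  have sf': "summable (\<lambda>m. f' m z h)" if "z \<in> pdisc (Suc s)" for z h
    by (rule summable_comparison_test[OF _ summ']) (use bound[OF that] in blast)
  have zS: "z \<in> pdisc (Suc s)" "z \<in> pdisc s" if "z \<in> S" for z
    using that opdisc_subset[of "Suc s"] pdisc_mono[of s "Suc s"] by (auto simp: S_def)
  have "\<exists>g. \<forall>x\<in>S. (\<lambda>m. mon m x *\<^sub>C a m) sums g x \<and> (g has_derivative g' x) (at x within S)"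
  proof (rule has_derivative_series)
    show "convex S" unfolding S_def by (rule convex_opdisc)
    show "0 \<in> S" by (simp add: S_def zero_in_opdisc)
    show "(\<lambda>m. mon m (0 :: complex ^ 'n) *\<^sub>C a m) sums f (\<zeta> + 0)"
      using zS(2)[OF \<open>0 \<in> S\<close>] by (rule sums)
    show "((\<lambda>x. mon m x *\<^sub>C a m) has_derivative f' m x) (at x within S)" for m x
    proof (cases "m \<in> smooth (UNIV :: 'n set)")
      case True
      show ?thesis unfolding f'_def
        by (rule bounded_linear.has_derivative[OF scaleC.bounded_linear_left])
          (rule has_derivative_at_withinI[OF D(1)[OF True]])
    next
      case False
      then have "f' m x = (\<lambda>h. 0)" by (simp add: f'_def[abs_def] supp)
      then show ?thesis using False by (simp add: supp)
    qed
    show "\<forall>\<^sub>F n in sequentially. \<forall>x\<in>S. \<forall>h. norm ((\<Sum>i<n. f' i x h) - g' x h) \<le> e * norm h"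
      if e: "e > 0" for e
    proof -
      define b where "b m = norm (a m) * (1 / real m) ^ s" for m
      have sb: "summable b" using summ by (simp add: b_def[abs_def])
      have "(\<lambda>n. K * (suminf b - (\<Sum>i<n. b i))) \<longlonglongrightarrow> K * (suminf b - suminf b)"
        by (intro tendsto_intros summable_LIMSEQ sb)
      then have "\<forall>\<^sub>F n in sequentially. K * (suminf b - (\<Sum>i<n. b i)) < e"
        by (rule order_tendstoD(2)) (use e in simp)
      then show ?thesis
      proof eventually_elim
        case (elim n)
        show ?case
        proof (intro ballI allI)
          fix x h assume x: "x \<in> S"
          have "g' x h = suminf (\<lambda>i. f' (i + n) x h) + (\<Sum>i<n. f' i x h)"
            unfolding g'_def by (rule suminf_split_initial_segment[OF sf'[OF zS(1)[OF x]]])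
          then have "norm ((\<Sum>i<n. f' i x h) - g' x h) = norm (suminf (\<lambda>i. f' (i + n) x h))"
            by simp
          also have "\<dots> \<le> suminf (\<lambda>i. K * b (i + n) * norm h)"
          proof -
            have "summable (\<lambda>i. norm (f' (i + n) x h))"
              by (rule summable_comparison_test[OF _ summable_ignore_initial_segment[OF summ'[of h, folded b_def], of n]])
                (simp add: bound[OF zS(1)[OF x], folded b_def])
            moreover from this have "suminf (\<lambda>i. norm (f' (i + n) x h)) \<le> suminf (\<lambda>i. K * b (i + n) * norm h)"
              using summable_ignore_initial_segment[OF summ'[of h, folded b_def], of n]
              by (intro suminf_le bound[OF zS(1)[OF x], folded b_def])
            ultimately show ?thesis by (rule order_trans[OF summable_norm])
          qed
          also have "\<dots> = K * (suminf b - (\<Sum>i<n. b i)) * norm h"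
            using sb summable_ignore_initial_segment[OF sb, of n]
            by (simp add: suminf_mult suminf_mult2[symmetric] summable_mult suminf_minus_initial_segment)
          also have "\<dots> \<le> e * norm h" using elim by (intro mult_right_mono) auto
          finally show "norm ((\<Sum>i<n. f' i x h) - g' x h) \<le> e * norm h" .
        qed
      qed
    qed
  qed
  then obtain g where g: "\<And>x. x \<in> S \<Longrightarrow> (\<lambda>m. mon m x *\<^sub>C a m) sums g x"
    "\<And>x. x \<in> S \<Longrightarrow> (g has_derivative g' x) (at x within S)" by blast
  have lin: "g' x (c *s h) = c *\<^sub>C g' x h" if "x \<in> S" for x c h
  proof -
    have "c *\<^sub>C g' x h = suminf (\<lambda>m. c *\<^sub>C f' m x h)"
      unfolding g'_def
      by (rule bounded_linear.suminf[OF scaleC.bounded_linear_right sf'[OF zS(1)[OF that]]])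
    also have "(\<lambda>m. c *\<^sub>C f' m x h) = (\<lambda>m. f' m x (c *s h))"
    proof
      fix m show "c *\<^sub>C f' m x h = f' m x (c *s h)"
        by (cases "m \<in> smooth (UNIV :: 'n set)") (simp_all add: f'_def D(2) scaleC_scaleC supp scaleC.zero_right)
    qed
    finally show ?thesis by (simp add: g'_def)
  qed
  have openS: "open S" by (simp add: S_def open_opdisc)
  have gcd: "cdiff g x" if "x \<in> S" for x
    unfolding cdiff_def using g(2)[OF that] lin[OF that] at_within_open[OF that openS] by auto
  have gf: "g x = f (\<zeta> + x)" if "x \<in> S" for x
    using g(1)[OF that] sums[OF zS(2)[OF that]] by (rule sums_unique2)
  have "cdiff f (\<zeta> + x)" if x: "x \<in> S" for x
  proof (rule cdiff_translate, rule cdiff_transform[OF _ gcd[OF x]])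
    show "\<forall>\<^sub>F w in nhds x. g w = f (\<zeta> + w)"
      using eventually_nhds_in_open[OF openS x] by eventually_elim (rule gf)
  qed
  then show ?thesis
    unfolding hol_at_def using eventually_opdisc[of \<zeta> "Suc s"]
    by (auto elim!: eventually_mono simp: S_def) (metis add_diff_cancel_left' diff_add_cancel add.commute)
qed

section \<open>Expansion of holomorphic maps\<close>

definition rad :: "nat \<Rightarrow> 'n::finite \<Rightarrow> real" where
  "rad s i = (1 / pr i) ^ s"

definition circ :: "nat \<Rightarrow> 'n::finite \<Rightarrow> real \<Rightarrow> complex" where
  "circ s i = circlepath 0 (rad s i)"

definition upd :: "complex ^ 'n::finite \<Rightarrow> 'n \<Rightarrow> complex \<Rightarrow> complex ^ 'n" where
  "upd z i w = (\<chi> j. if j = i then w else z $ j)"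

text \<open>The Cauchy integral for the k-th coefficient in the i-th variable. For w =
  \<open>circ s i t\<close> one has dw = 2 pi i w dt, which cancels the prefactor 1/(2 pi i) and one
  of the k + 1 powers of w. The other variables are parameters; the i-th coordinate of
  \<open>z\<close> is overwritten.\<close>

definition taylor_coeff ::
    "nat \<Rightarrow> 'n::finite \<Rightarrow> nat \<Rightarrow> (complex ^ 'n \<Rightarrow> 'e::complex_banach) \<Rightarrow> complex ^ 'n \<Rightarrow> 'e" where
  "taylor_coeff s i k g z = integral {0..1} (\<lambda>t. inverse (circ s i t) ^ k *\<^sub>C g (upd z i (circ s i t)))"

text \<open>The coefficient functions are integrals with parameters, whose continuity is immediate
  but whose complex differentiability is not. The induction over the variables therefore carries
  this property instead: expandability in each variable still to be treated.\<close>

definition coordinate_expansion ::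
    "nat \<Rightarrow> 'n::finite \<Rightarrow> (complex ^ 'n \<Rightarrow> 'e::complex_banach) \<Rightarrow> bool" where
  "coordinate_expansion s j g \<longleftrightarrow> (\<forall>z\<in>pdisc s. \<forall>w. norm w < rad s j \<longrightarrow>
     (\<lambda>m. w ^ m *\<^sub>C taylor_coeff s j m g z) sums g (upd z j w))"

lemma rad_pos: "0 < rad s i"
  by (simp add: rad_def pr_pos)

lemma circ_eq: "circ s i t = rad s i * exp (2 * of_real pi * \<i> * of_real t)"
  by (simp add: circ_def circlepath)

lemma norm_circ [simp]: "norm (circ s i t) = rad s i"
  using rad_pos[of s i] by (simp add: circ_eq norm_mult)

lemma circ_nz [simp]: "circ s i t \<noteq> 0"
  using rad_pos[of s i] norm_circ[of s i t] by (metis norm_zero less_irrefl)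

lemma continuous_on_circ [continuous_intros]:
  "continuous_on A f \<Longrightarrow> continuous_on A (\<lambda>x. circ s i (f x))"
  unfolding circ_eq by (intro continuous_intros)

lemma continuous_on_upd [continuous_intros]:
  assumes "continuous_on A f" "continuous_on A h"
  shows "continuous_on A (\<lambda>x. upd (f x) i (h x))"
  unfolding upd_def
proof (rule continuous_on_vec_lambda)
  fix j show "continuous_on A (\<lambda>x. if j = i then h x else f x $ j)"
    using assms by (cases "j = i") (auto intro!: continuous_intros)
qed

lemma upd_nth [simp]: "upd z i w $ j = (if j = i then w else z $ j)"
  by (simp add: upd_def)

lemma upd_self [simp]: "upd z i (z $ i) = z"
  by (simp add: vec_eq_iff)

lemma upd_commute: "i \<noteq> j \<Longrightarrow> upd (upd z i w) j v = upd (upd z j v) i w"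
  by (simp add: vec_eq_iff)

lemma upd_in_pdisc: "z \<in> pdisc s \<Longrightarrow> norm w \<le> rad s i \<Longrightarrow> upd z i w \<in> pdisc s"
  by (auto simp: pdisc_def rad_def)

lemma compact_pdisc: "compact (pdisc s :: (complex ^ 'n::finite) set)"
proof -
  have "pdisc s = (\<Inter>i. {z :: complex ^ 'n. norm (z $ i) \<le> (1 / pr i) ^ s})"
    by (auto simp: pdisc_def)
  then have "closed (pdisc s :: (complex ^ 'n) set)"
    by (simp only:) (intro closed_INT ballI closed_Collect_le continuous_intros)
  moreover have "norm z \<le> (\<Sum>i\<in>UNIV. rad s (i :: 'n))" if "z \<in> pdisc s" for z :: "complex ^ 'n"
  proof -
    have "norm z \<le> (\<Sum>i\<in>UNIV. norm (z $ i))"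
      unfolding norm_vec_def by (rule L2_set_le_sum) auto
    also have "\<dots> \<le> (\<Sum>i\<in>UNIV. rad s (i :: 'n))"
      using that by (intro sum_mono) (auto simp: pdisc_def rad_def)
    finally show ?thesis .
  qed
  ultimately show ?thesis by (auto simp: compact_eq_bounded_closed bounded_iff)
qed

section \<open>Cauchy coefficients in one variable\<close>

lemma continuous_on_compose_pdisc:
  assumes "continuous_on (pdisc s) g" "continuous_on A f" "\<And>x. x \<in> A \<Longrightarrow> f x \<in> pdisc s"
  shows "continuous_on A (\<lambda>x. g (f x))"
  by (rule continuous_on_compose2[OF assms(1,2)]) (use assms(3) in auto)

lemma continuous_on_taylor_coeff:
  assumes g: "continuous_on (pdisc s) g"
  shows "continuous_on (pdisc s) (taylor_coeff s i k g)"
proof -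
  have "continuous_on (pdisc s \<times> cbox 0 (1::real))
      (\<lambda>(z, t). inverse (circ s i t) ^ k *\<^sub>C g (upd z i (circ s i t)))"
    unfolding case_prod_unfold
    by (intro scaleC.continuous_on continuous_intros continuous_on_compose_pdisc[OF g])
      (auto intro: upd_in_pdisc)
  from integral_continuous_on_param[OF this] show ?thesis
    by (simp add: taylor_coeff_def[abs_def])
qed

lemma continuous_on_integrand:
  assumes g: "continuous_on (pdisc s) g" and z: "z \<in> pdisc s"
  shows "continuous_on {0..1} (\<lambda>t. inverse (circ s i t) ^ k *\<^sub>C g (upd z i (circ s i t)))"
  by (intro scaleC.continuous_on continuous_intros continuous_on_compose_pdisc[OF g])
    (use z in \<open>auto intro: upd_in_pdisc\<close>)

lemma norm_taylor_coeff_le: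
  assumes g: "continuous_on (pdisc s) g" and z: "z \<in> pdisc s"
    and M: "\<And>z. z \<in> pdisc s \<Longrightarrow> norm (g z) \<le> M"
  shows "norm (taylor_coeff s i k g z) \<le> M * inverse (rad s i) ^ k"
proof -
  have "norm (taylor_coeff s i k g z) \<le> (M * inverse (rad s i) ^ k) * (1 - 0)"
    unfolding taylor_coeff_def
  proof (rule integral_bound)
    show "continuous_on {0..1} (\<lambda>t. inverse (circ s i t) ^ k *\<^sub>C g (upd z i (circ s i t)))"
      by (rule continuous_on_integrand[OF g z])
    fix t :: real
    have "norm (inverse (circ s i t) ^ k *\<^sub>C g (upd z i (circ s i t)))
        = inverse (rad s i) ^ k * norm (g (upd z i (circ s i t)))"
      by (simp add: norm_scaleC norm_power norm_inverse)
    also have "\<dots> \<le> inverse (rad s i) ^ k * M"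
      using M[OF upd_in_pdisc[OF z]] rad_pos[of s i] by (intro mult_left_mono) auto
    finally show "norm (inverse (circ s i t) ^ k *\<^sub>C g (upd z i (circ s i t))) \<le> M * inverse (rad s i) ^ k"
      by (simp add: mult.commute)
  qed simp
  then show ?thesis by simp
qed

lemma taylor_coeff_taylor_coeff:
  assumes g: "continuous_on (pdisc s) g" and z: "z \<in> pdisc s"
  shows "taylor_coeff s i k (taylor_coeff s j m g) z = integral {0..1} (\<lambda>t. integral {0..1}
    (\<lambda>u. (inverse (circ s i t) ^ k * inverse (circ s j u) ^ m) *\<^sub>C g (upd (upd z i (circ s i t)) j (circ s j u))))"
  unfolding taylor_coeff_def[of s i]
proof (rule integral_cong)
  fix t :: real
  let ?h = "\<lambda>u. inverse (circ s j u) ^ m *\<^sub>C g (upd (upd z i (circ s i t)) j (circ s j u))"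
  have "?h integrable_on {0..1}"
    by (intro integrable_continuous_real continuous_on_integrand g upd_in_pdisc z) simp
  from integral_linear[OF this scaleC.bounded_linear_right[of "inverse (circ s i t) ^ k"]]
  show "inverse (circ s i t) ^ k *\<^sub>C taylor_coeff s j m g (upd z i (circ s i t)) =
    integral {0..1} (\<lambda>u. (inverse (circ s i t) ^ k * inverse (circ s j u) ^ m) *\<^sub>C
      g (upd (upd z i (circ s i t)) j (circ s j u)))"
    by (simp add: taylor_coeff_def o_def scaleC_scaleC)
qed

text \<open>Fubini for a continuous integrand on the unit square; for distinct variables the two
  substitutions commute as well.\<close>

lemma taylor_coeff_commute:
  assumes g: "continuous_on (pdisc s) g" and z: "z \<in> pdisc s" and "i \<noteq> j"
  shows "taylor_coeff s i k (taylor_coeff s j m g) z = taylor_coeff s j m (taylor_coeff s i k g) z"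
proof -
  let ?G = "\<lambda>t u. (inverse (circ s i t) ^ k * inverse (circ s j u) ^ m) *\<^sub>C g (upd (upd z i (circ s i t)) j (circ s j u))"
  have "continuous_on (cbox (0, 0) (1, 1)) (\<lambda>(t, u). ?G t u)"
    unfolding case_prod_unfold
    by (intro scaleC.continuous_on continuous_intros continuous_on_compose_pdisc[OF g])
      (auto intro!: upd_in_pdisc z)
  from integral_swap_continuous[OF this]
  have "integral {0..1} (\<lambda>t. integral {0..1} (?G t)) = integral {0..1} (\<lambda>u. integral {0..1} (\<lambda>t. ?G t u))"
    by simp
  then show ?thesis
    using assms(3) by (simp add: taylor_coeff_taylor_coeff[OF g z] mult.commute upd_commute)
qed

lemma taylor_bound_summable:
  assumes "norm w < rad s j"
  shows "summable (\<lambda>m. M * (norm w / rad s j) ^ m)"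
  using assms rad_pos[of s j] by (intro summable_mult summable_geometric) auto

lemma norm_taylor_term_le:
  assumes g: "continuous_on (pdisc s) g" and z: "z \<in> pdisc s"
    and M: "\<And>z. z \<in> pdisc s \<Longrightarrow> norm (g z) \<le> M"
  shows "norm (w ^ m *\<^sub>C taylor_coeff s j m g z) \<le> M * (norm w / rad s j) ^ m"
proof -
  have "norm (w ^ m *\<^sub>C taylor_coeff s j m g z) = norm w ^ m * norm (taylor_coeff s j m g z)"
    by (simp add: norm_scaleC norm_power)
  also have "\<dots> \<le> norm w ^ m * (M * inverse (rad s j) ^ m)"
    by (intro mult_left_mono norm_taylor_coeff_le assms) auto
  finally show ?thesis by (simp add: divide_inverse power_mult_distrib mult_ac)
qed

lemma pdisc_bound:
  assumes "continuous_on (pdisc s) (g :: complex ^ 'n::finite \<Rightarrow> 'e::complex_banach)"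
  obtains M where "\<And>z. z \<in> pdisc s \<Longrightarrow> norm (g z) \<le> M" "0 \<le> M"
proof -
  have "bounded (g ` pdisc s)"
    by (intro compact_imp_bounded compact_continuous_image assms compact_pdisc)
  then obtain M where "\<And>z. z \<in> pdisc s \<Longrightarrow> norm (g z) \<le> M" by (auto simp: bounded_iff)
  moreover then have "0 \<le> M"
    using opdisc_subset zero_in_opdisc by (meson norm_ge_zero order_trans subsetD)
  ultimately show thesis using that by blast
qed

text \<open>Integrate the expansion of \<open>g\<close> in the j-th variable over the circle in the
  i-th variable. A geometric majorant makes the series converge uniformly on that circle, and taking
  coefficients in different variables commutes.\<close>

lemma coordinate_expansion_taylor_coeff:
  fixes g :: "complex ^ 'n::finite \<Rightarrow> 'e::complex_banach"
  assumes g: "continuous_on (pdisc s) g" and Q: "coordinate_expansion s j g" and ij: "i \<noteq> j"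
  shows "coordinate_expansion s j (taylor_coeff s i k g)"
  unfolding coordinate_expansion_def
proof (intro ballI allI impI)
  fix z :: "complex ^ 'n" and w :: complex assume z: "z \<in> pdisc s" and w: "norm w < rad s j"
  obtain M where M: "\<And>z. z \<in> pdisc s \<Longrightarrow> norm (g z) \<le> M" "0 \<le> M" using pdisc_bound[OF g] by blast
  let ?e = "\<lambda>t. inverse (circ s i t) ^ k"
  let ?F = "\<lambda>m t. ?e t *\<^sub>C w ^ m *\<^sub>C taylor_coeff s j m g (upd z i (circ s i t))"
  have Z: "upd z i (circ s i t) \<in> pdisc s" for t by (rule upd_in_pdisc[OF z]) simp
  have cont: "continuous_on {0..1} (?F m)" for m
    by (intro scaleC.continuous_on continuous_intros continuous_on_compose_pdisc[OF continuous_on_taylor_coeff[OF g]] Z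
        ballI circ_nz)
  have lim: "(\<lambda>m. ?F m t) sums (?e t *\<^sub>C g (upd (upd z j w) i (circ s i t)))" for t
  proof -
    have "(\<lambda>m. w ^ m *\<^sub>C taylor_coeff s j m g (upd z i (circ s i t))) sums g (upd (upd z i (circ s i t)) j w)"
      using Q Z w by (auto simp: coordinate_expansion_def)
    from bounded_linear.sums[OF scaleC.bounded_linear_right this] show ?thesis
      using ij by (simp add: upd_commute)
  qed
  have "uniform_limit {0..1} (\<lambda>n t. \<Sum>m<n. ?F m t) (\<lambda>t. suminf (\<lambda>m. ?F m t)) sequentially"
  proof (rule Weierstrass_m_test)
    show "summable (\<lambda>m. (inverse (rad s i) ^ k * M) * (norm w / rad s j) ^ m)"
      by (rule taylor_bound_summable[OF w])
    fix m and t :: real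
    have "norm (?F m t) = inverse (rad s i) ^ k * norm (w ^ m *\<^sub>C taylor_coeff s j m g (upd z i (circ s i t)))"
      by (simp only: norm_scaleC[of "?e t"] norm_power norm_inverse norm_circ)
    also have "\<dots> \<le> inverse (rad s i) ^ k * (M * (norm w / rad s j) ^ m)"
      using rad_pos[of s i] by (intro mult_left_mono norm_taylor_term_le g Z M) auto
    finally show "norm (?F m t) \<le> (inverse (rad s i) ^ k * M) * (norm w / rad s j) ^ m"
      by (simp only: mult.assoc)
  qed
  moreover have "(\<lambda>t. suminf (\<lambda>m. ?F m t)) = (\<lambda>t. ?e t *\<^sub>C g (upd (upd z j w) i (circ s i t)))"
    using sums_unique[OF lim] by (intro ext) simp
  ultimately have ul: "uniform_limit {0..1} (\<lambda>n t. \<Sum>m<n. ?F m t)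
      (\<lambda>t. ?e t *\<^sub>C g (upd (upd z j w) i (circ s i t))) sequentially" by simp
  obtain I J where I: "\<And>n. ((\<lambda>t. \<Sum>m<n. ?F m t) has_integral I n) {0..1}"
    and J: "((\<lambda>t. ?e t *\<^sub>C g (upd (upd z j w) i (circ s i t))) has_integral J) {0..1}" and IJ: "I \<longlonglongrightarrow> J"
    by (rule uniform_limit_integral[OF ul]) (auto intro: continuous_on_sum cont)
  have "J = taylor_coeff s i k g (upd z j w)" using integral_unique[OF J] by (simp add: taylor_coeff_def)
  moreover have "I = (\<lambda>n. \<Sum>m<n. w ^ m *\<^sub>C taylor_coeff s j m (taylor_coeff s i k g) z)"
  proof
    fix n
    have "I n = (\<Sum>m<n. integral {0..1} (?F m))"
      using integral_unique[OF I[of n]] cont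
      by (simp add: integral_sum integrable_continuous_real)
    also have "\<dots> = (\<Sum>m<n. w ^ m *\<^sub>C taylor_coeff s i k (taylor_coeff s j m g) z)"
    proof (rule sum.cong[OF refl])
      fix m
      have "(\<lambda>t. ?e t *\<^sub>C taylor_coeff s j m g (upd z i (circ s i t))) integrable_on {0..1}"
        by (intro integrable_continuous_real continuous_on_integrand continuous_on_taylor_coeff g z)
      from integral_linear[OF this scaleC.bounded_linear_right[of "w ^ m"]]
      show "integral {0..1} (?F m) = w ^ m *\<^sub>C taylor_coeff s i k (taylor_coeff s j m g) z"
        by (simp add: taylor_coeff_def[of s i] o_def scaleC_scaleC mult.commute)
    qed
    finally show "I n = (\<Sum>m<n. w ^ m *\<^sub>C taylor_coeff s j m (taylor_coeff s i k g) z)"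
      using taylor_coeff_commute[OF g z ij] by simp
  qed
  ultimately show "(\<lambda>m. w ^ m *\<^sub>C taylor_coeff s j m (taylor_coeff s i k g) z) sums taylor_coeff s i k g (upd z j w)"
    using IJ by (simp add: sums_def)
qed

lemma cdiff_field_differentiable:
  assumes "cdiff g (upd z j w)" "cdual l"
  shows "((\<lambda>w. l (g (upd z j w))) has_field_derivative l ((SOME D. (g has_derivative D) (at (upd z j w)) \<and>
    (\<forall>c v. D (c *s v) = c *\<^sub>C D v)) (axis j 1))) (at w)"
proof -
  define D where "D = (SOME D. (g has_derivative D) (at (upd z j w)) \<and> (\<forall>c v. D (c *s v) = c *\<^sub>C D v))"
  have D: "(g has_derivative D) (at (upd z j w))" "\<And>c v. D (c *s v) = c *\<^sub>C D v"
    using someI_ex[OF assms(1)[unfolded cdiff_def]] by (auto simp: D_def)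
  have eq: "upd z j v = upd z j 0 + v *s axis j 1" for v
    by (simp add: vec_eq_iff axis_def)
  have ax: "bounded_linear (\<lambda>v. v *s axis j (1::complex))"
    by (rule linear_conv_bounded_linear[THEN iffD1], rule linearI)
      (simp_all add: vec_eq_iff axis_def algebra_simps)
  have "((\<lambda>v. upd z j 0 + v *s axis j 1) has_derivative (\<lambda>v. v *s axis j 1)) (at w)"
    by (auto intro!: derivative_eq_intros bounded_linear_imp_has_derivative ax)
  then have "((upd z j) has_derivative (\<lambda>v. v *s axis j 1)) (at w)"
    by (subst eq[abs_def]) 
  from has_derivative_compose[OF this D(1)]
  have "((\<lambda>w. l (g (upd z j w))) has_derivative (\<lambda>v. l (D (v *s axis j 1)))) (at w)"
    by (rule bounded_linear.has_derivative[OF cdual_bounded_linear[OF assms(2)]])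
  then have "((\<lambda>w. l (g (upd z j w))) has_derivative (*) (l (D (axis j 1)))) (at w)"
    by (simp add: D(2) cdual_scaleC[OF assms(2)] mult.commute[of _ "l _"])
  then show ?thesis by (simp add: has_field_derivative_def D_def)
qed

text \<open>Convergence in E comes from the geometric majorant alone; functionals serve to identify
  the sum. Composed with a functional, \<open>g\<close> becomes a scalar function holomorphic on a
  disc, where the classical power series theorem applies.\<close>

lemma coordinate_expansion_cdiff:
  fixes g :: "complex ^ 'n::finite \<Rightarrow> 'e::complex_banach"
  assumes cd: "\<And>z. z \<in> pdisc s \<Longrightarrow> cdiff g z"
  shows "coordinate_expansion s j g"
  unfolding coordinate_expansion_def
proof (intro ballI allI impI)
  fix z :: "complex ^ 'n" and w :: complex assume z: "z \<in> pdisc s" and w: "norm w < rad s j"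
  have g: "continuous_on (pdisc s) g"
    using cd cdiff_isCont by (blast intro: continuous_at_imp_continuous_on)
  obtain M where M: "\<And>z. z \<in> pdisc s \<Longrightarrow> norm (g z) \<le> M" "0 \<le> M" using pdisc_bound[OF g] by blast
  have "summable (\<lambda>m. w ^ m *\<^sub>C taylor_coeff s j m g z)"
    by (rule summable_comparison_test[OF _ taylor_bound_summable[OF w, of M]])
      (use norm_taylor_term_le[OF g z M(1)] in blast)
  then obtain S where S: "(\<lambda>m. w ^ m *\<^sub>C taylor_coeff s j m g z) sums S" by (auto simp: summable_def)
  have "S = g (upd z j w)"
  proof (rule cdual_eqI)
    fix l :: "'e \<Rightarrow> complex" assume l: "cdual l"
    define \<phi> where "\<phi> v = l (g (upd z j v))" for v
    have fd: "\<phi> field_differentiable at v" if "norm v \<le> rad s j" for v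
      using cdiff_field_differentiable[OF cd[OF upd_in_pdisc[OF z that]] l]
      unfolding \<phi>_def[abs_def] field_differentiable_def by blast
    have hol: "\<phi> holomorphic_on cball 0 (rad s j)"
      unfolding holomorphic_on_def
    proof
      fix v :: complex assume "v \<in> cball 0 (rad s j)"
      then have "\<phi> field_differentiable at v" by (intro fd) simp
      then show "\<phi> field_differentiable at v within cball 0 (rad s j)"
        by (rule field_differentiable_at_within)
    qed
    have hol': "\<phi> holomorphic_on ball 0 (rad s j)"
      by (rule holomorphic_on_subset[OF hol]) auto
    \<comment> \<open>Cauchy's formula for the m-th derivative with the contour integral written
      out: the derivative 2 pi i w of the circle path turns it into the integral that defines
      \<open>taylor_coeff\<close>.\<close>
    have coeff: "l (taylor_coeff s j m g z) = (deriv ^^ m) \<phi> 0 / fact m" for m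
    proof -
      have "((\<lambda>u. \<phi> u / (u - 0) ^ Suc m) has_contour_integral (2 * pi * \<i>) / fact m * (deriv ^^ m) \<phi> 0)
          (circlepath 0 (rad s j))"
        by (intro Cauchy_has_contour_integral_higher_derivative_circlepath
            holomorphic_on_imp_continuous_on hol hol') (simp add: rad_pos)
      then have "((\<lambda>t. \<phi> (circ s j t) / (circ s j t) ^ Suc m *
            vector_derivative (circlepath 0 (rad s j)) (at t within {0..1}))
          has_integral (2 * pi * \<i>) / fact m * (deriv ^^ m) \<phi> 0) {0..1}"
        by (simp add: has_contour_integral_def circ_def)
      then have "((\<lambda>t. (2 * pi * \<i>) * (inverse (circ s j t) ^ m * \<phi> (circ s j t)))
          has_integral (2 * pi * \<i>) / fact m * (deriv ^^ m) \<phi> 0) {0..1}"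
      proof (rule has_integral_eq[rotated])
        fix t :: real assume "t \<in> {0..1}"
        then have "vector_derivative (circlepath 0 (rad s j)) (at t within {0..1}) = (2 * pi * \<i>) * circ s j t"
          by (simp add: vector_derivative_circlepath01 circ_eq)
        then show "\<phi> (circ s j t) / (circ s j t) ^ Suc m *
            vector_derivative (circlepath 0 (rad s j)) (at t within {0..1})
          = (2 * pi * \<i>) * (inverse (circ s j t) ^ m * \<phi> (circ s j t))"
          by (simp add: field_simps)
      qed
      then have "((\<lambda>t. inverse (2 * pi * \<i>) * ((2 * pi * \<i>) * (inverse (circ s j t) ^ m * \<phi> (circ s j t))))
          has_integral inverse (2 * pi * \<i>) * ((2 * pi * \<i>) / fact m * (deriv ^^ m) \<phi> 0)) {0..1}"
        by (rule has_integral_mult_right)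
      then have "((\<lambda>t. inverse (circ s j t) ^ m * \<phi> (circ s j t)) has_integral (deriv ^^ m) \<phi> 0 / fact m) {0..1}"
        by (simp add: field_simps)
      moreover have "l (taylor_coeff s j m g z) = integral {0..1} (\<lambda>t. inverse (circ s j t) ^ m * \<phi> (circ s j t))"
      proof -
        have "(\<lambda>t. inverse (circ s j t) ^ m *\<^sub>C g (upd z j (circ s j t))) integrable_on {0..1}"
          by (intro integrable_continuous_real continuous_on_integrand g z)
        from integral_linear[OF this cdual_bounded_linear[OF l]] show ?thesis
          by (simp add: taylor_coeff_def o_def cdual_scaleC[OF l] \<phi>_def)
      qed
      ultimately show ?thesis by (simp add: integral_unique)
    qed
    have "(\<lambda>m. l (w ^ m *\<^sub>C taylor_coeff s j m g z)) sums l S"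
      by (rule bounded_linear.sums[OF cdual_bounded_linear[OF l] S])
    moreover have "(\<lambda>m. (deriv ^^ m) \<phi> 0 / fact m * (w - 0) ^ m) sums \<phi> w"
      by (rule holomorphic_power_series[OF hol']) (use w in simp)
    ultimately show "l S = l (g (upd z j w))"
      by (simp add: cdual_scaleC[OF l] coeff mult.commute \<phi>_def sums_unique2)
  qed
  with S show "(\<lambda>m. w ^ m *\<^sub>C taylor_coeff s j m g z) sums g (upd z j w)" by simp
qed

section \<open>From one-variable expansions to a series in all variables\<close>

lemma smooth_empty: "smooth {} = {1}"
proof -
  have "m = 1" if "m \<in> smooth {}" for m
    using that by (induction rule: smooth_induct) auto
  then show ?thesis using smooth_1[of "{}"] by auto
qed

text \<open>Unique factorization: a multi-index over one more variable amounts to one over the old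
  variables together with an exponent.\<close>

lemma smooth_insert_bij:
  assumes "i \<notin> T"
  shows "bij_betw (\<lambda>(m, k). m * pr i ^ k) (smooth T \<times> UNIV) (smooth (insert i T))"
proof -
  have mult0: "multiplicity (pr i) m = 0" if "m \<in> smooth T" for m
  proof (rule not_dvd_imp_multiplicity_0)
    show "\<not> pr i dvd m"
    proof
      assume "pr i dvd m"
      then have "pr i \<in> pr ` T" using that prime_pr[of i] by (simp add: smooth_def)
      then show False using assms by auto
    qed
  qed
  have mult: "multiplicity (pr i) (m * pr i ^ k) = k" if "m \<in> smooth T" for m k
    using mult0[OF that] smooth_pos[OF that] pr_pos[of i]
    by (simp add: prime_elem_multiplicity_mult_distrib prime_pr multiplicity_same_power)
  have inj: "inj_on (\<lambda>(m, k). m * pr i ^ k) (smooth T \<times> UNIV)"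
  proof (rule inj_onI, clarify)
    fix m k m' k' assume a: "m \<in> smooth T" "m' \<in> smooth T" "m * pr i ^ k = m' * pr i ^ k'"
    then have "k = k'" using mult[OF a(1), of k] mult[OF a(2), of k'] by simp
    with a(3) show "m = m' \<and> k = k'" using pr_pos[of i] by simp
  qed
  have mono: "smooth T \<subseteq> smooth (insert i T)" by (auto simp: smooth_def)
  have pow: "pr i ^ k \<in> smooth (insert i T)" for k
    by (induction k) (auto simp: smooth_1[simplified] intro!: smooth_mult smooth_pr)
  have "n \<in> (\<lambda>(m, k). m * pr i ^ k) ` (smooth T \<times> UNIV)" if "n \<in> smooth (insert i T)" for n
    using that
  proof (induction rule: smooth_induct)
    case 1 then show ?case using smooth_1[of T] by (auto intro!: image_eqI[of _ _ "(1, 0)"])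
  next
    case (mult j n)
    then obtain m k where mk: "m \<in> smooth T" "n = m * pr i ^ k" by auto
    show ?case
    proof (cases "j = i")
      case True
      then show ?thesis using mk by (auto intro!: image_eqI[of _ _ "(m, Suc k)"])
    next
      case False
      then have "pr j * m \<in> smooth T" using mult(1) mk by (auto intro: smooth_mult smooth_pr)
      then show ?thesis using mk by (auto intro!: image_eqI[of _ _ "(pr j * m, k)"])
    qed
  qed
  then show ?thesis using inj mono pow by (auto simp: bij_betw_def intro!: smooth_mult)
qed

lemma mon_power: "m > 0 \<Longrightarrow> mon (m * pr i ^ k) z = mon m z * (z $ i) ^ k"
proof (induction k)
  case (Suc k)
  have "mon (m * pr i ^ Suc k) z = mon (pr i * (m * pr i ^ k)) z" by (simp add: mult_ac)
  also have "\<dots> = z $ i * (mon m z * (z $ i) ^ k)" using Suc pr_pos[of i] by (subst mon_mult) auto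
  finally show ?case by (simp add: mult_ac)
qed simp

lemma inverse_squares_summable_on: "(\<lambda>n. M * (1 / real n) ^ 2) summable_on A"
proof -
  have "summable (\<lambda>n. norm ((1 / real n) ^ 2))"
    using inverse_power_summable[of 2, where 'a=real] by (simp add: power_one_over inverse_eq_divide)
  then have "(\<lambda>n. (1 / real n) ^ 2) summable_on UNIV"
    by (rule norm_summable_imp_summable_on)
  then have "(\<lambda>n. (1 / real n) ^ 2) summable_on A"
    by (rule summable_on_subset_banach) simp
  then show ?thesis by (rule summable_on_cmult_right)
qed

text \<open>Induction over the set \<open>T\<close> of variables already expanded;
  \<open>a m\<close> depends only on the others. The Cauchy estimates multiply along the prime
  factors and give M m^s, so on the polydisc of exponent s + 2 the terms are at most M / m^2. This
  bound is the same at every stage and permits regrouping.\<close>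

lemma partial_expansion:
  fixes g :: "complex ^ 'n::finite \<Rightarrow> 'e::complex_banach"
  assumes g: "continuous_on (pdisc s) g" and Q: "\<And>j. coordinate_expansion s j g"
    and M: "\<forall>z\<in>pdisc s. norm (g z) \<le> M" "0 \<le> M"
    and "finite T"
  shows "\<exists>a. (\<forall>m\<in>smooth T. continuous_on (pdisc s) (a m) \<and> (\<forall>j. j \<notin> T \<longrightarrow> coordinate_expansion s j (a m)) \<and>
      (\<forall>z\<in>pdisc s. norm (a m z) \<le> M * real m ^ s) \<and>
      (\<forall>z\<in>pdisc s. \<forall>z'\<in>pdisc s. (\<forall>j. j \<notin> T \<longrightarrow> z $ j = z' $ j) \<longrightarrow> a m z = a m z')) \<and>
    (\<forall>z\<in>pdisc (s + 2). ((\<lambda>m. mon m z *\<^sub>C a m z) has_sum g z) (smooth T))"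
  using \<open>finite T\<close>
proof (induction T)
  case empty
  have "z = z'" if "\<forall>j. z $ j = z' $ j" for z z' :: "complex ^ 'n" using that by (simp add: vec_eq_iff)
  then show ?case
    using g Q M by (intro exI[of _ "\<lambda>m. g"]) (auto simp: smooth_empty intro!: has_sum_finiteI)
next
  case (insert i T)
  then obtain a where
    ac: "\<And>m. m \<in> smooth T \<Longrightarrow> continuous_on (pdisc s) (a m)"
    and aQ: "\<And>m j. m \<in> smooth T \<Longrightarrow> j \<notin> T \<Longrightarrow> coordinate_expansion s j (a m)"
    and aM: "\<And>m z. m \<in> smooth T \<Longrightarrow> z \<in> pdisc s \<Longrightarrow> norm (a m z) \<le> M * real m ^ s"
    and ad: "\<And>m z z'. m \<in> smooth T \<Longrightarrow> z \<in> pdisc s \<Longrightarrow> z' \<in> pdisc s \<Longrightarrow>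
      (\<And>j. j \<notin> T \<Longrightarrow> z $ j = z' $ j) \<Longrightarrow> a m z = a m z'"
    and as: "\<And>z. z \<in> pdisc (s + 2) \<Longrightarrow> ((\<lambda>m. mon m z *\<^sub>C a m z) has_sum g z) (smooth T)"
    by (elim exE conjE) blast
  let ?B = "\<lambda>(m, k). m * pr i ^ k"
  note bij = smooth_insert_bij[OF insert(2)]
  \<comment> \<open>The index m times the k-th power of the new prime receives the k-th coefficient,
    in the new variable, of the old \<open>a m\<close>; the inverse bijection recovers the pair from
    the product.\<close>
  define b where "b n = (case the_inv_into (smooth T \<times> UNIV) ?B n of (m, k) \<Rightarrow> taylor_coeff s i k (a m))" for n
  have b: "b (m * pr i ^ k) = taylor_coeff s i k (a m)" if "m \<in> smooth T" for m k
    using the_inv_into_f_f[OF bij_betw_imp_inj_on[OF bij], of "(m, k)"] that by (simp add: b_def)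
  have ex: "\<exists>m k. m \<in> smooth T \<and> n = m * pr i ^ k" if "n \<in> smooth (insert i T)" for n
    using that bij unfolding bij_betw_def by force
  have bM: "norm (b n z) \<le> M * real n ^ s" if n: "n \<in> smooth (insert i T)" and z: "z \<in> pdisc s" for n z
  proof -
    obtain m k where mk: "m \<in> smooth T" "n = m * pr i ^ k" using ex[OF n] by blast
    have "norm (taylor_coeff s i k (a m) z) \<le> (M * real m ^ s) * inverse (rad s i) ^ k"
      by (rule norm_taylor_coeff_le[OF ac[OF mk(1)] z aM[OF mk(1)]])
    also have "inverse (rad s i) ^ k = real (pr i ^ k) ^ s"
      by (simp add: rad_def power_divide power_mult[symmetric] mult.commute inverse_eq_divide)
    finally show ?thesis using mk by (simp add: b power_mult_distrib mult_ac)
  qed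
  have "continuous_on (pdisc s) (b n) \<and> (\<forall>j. j \<notin> insert i T \<longrightarrow> coordinate_expansion s j (b n)) \<and>
      (\<forall>z\<in>pdisc s. norm (b n z) \<le> M * real n ^ s) \<and>
      (\<forall>z\<in>pdisc s. \<forall>z'\<in>pdisc s. (\<forall>j. j \<notin> insert i T \<longrightarrow> z $ j = z' $ j) \<longrightarrow> b n z = b n z')"
    if n: "n \<in> smooth (insert i T)" for n
  proof -
    obtain m k where mk: "m \<in> smooth T" "n = m * pr i ^ k" using ex[OF n] by blast
    note bn = b[OF mk(1), of k, folded mk(2)]
    have "b n z = b n z'" if zz: "z \<in> pdisc s" "z' \<in> pdisc s" "\<forall>j. j \<notin> insert i T \<longrightarrow> z $ j = z' $ j" for z z'
    proof -
      have "a m (upd z i (circ s i t)) = a m (upd z' i (circ s i t))" for t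
        by (rule ad[OF mk(1)]) (use zz in \<open>auto intro!: upd_in_pdisc\<close>)
      then show ?thesis by (simp add: bn taylor_coeff_def)
    qed
    moreover have "coordinate_expansion s j (b n)" if "j \<notin> insert i T" for j
      unfolding bn using that
      by (intro coordinate_expansion_taylor_coeff ac[OF mk(1)] aQ[OF mk(1)]) auto
    moreover have "continuous_on (pdisc s) (b n)"
      unfolding bn by (rule continuous_on_taylor_coeff[OF ac[OF mk(1)]])
    ultimately show ?thesis using bM[OF n] by blast
  qed
  moreover have "((\<lambda>n. mon n z *\<^sub>C b n z) has_sum g z) (smooth (insert i T))" if z: "z \<in> pdisc (s + 2)" for z
  proof -
    have zs: "z \<in> pdisc s" using z pdisc_mono[of s "s + 2"] by auto
    let ?F = "\<lambda>n. mon n z *\<^sub>C b n z"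
    have le: "norm (?F n) \<le> M * (1 / real n) ^ 2" if n: "n \<in> smooth (insert i T)" for n
    proof -
      have n': "n \<in> smooth (UNIV :: 'n set)" using n by (auto simp: smooth_def)
      have "norm (?F n) \<le> (1 / real n) ^ (s + 2) * (M * real n ^ s)"
        unfolding norm_scaleC by (intro mult_mono norm_mon_le n' z bM n zs) auto
      also have "\<dots> = M * (1 / real n) ^ 2" using smooth_pos[OF n] by (simp add: power_add power_divide power2_eq_square)
      finally show ?thesis .
    qed
    have "(\<lambda>n. norm (?F n)) summable_on smooth (insert i T)"
      by (rule Infinite_Sum.abs_summable_on_comparison_test'[OF inverse_squares_summable_on le])
    then have "?F summable_on smooth (insert i T)" by (rule abs_summable_summable)
    \<comment> \<open>Absolute summability yields some sum \<open>S\<close> over the finer index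
      set. Summing over the powers of the new prime first recovers the old terms, and the induction
      hypothesis then identifies \<open>S\<close>.\<close>
    then obtain S where S: "(?F has_sum S) (smooth (insert i T))" by (auto simp: summable_on_def)
    then have "((\<lambda>x. ?F (?B x)) has_sum S) (smooth T \<times> UNIV)"
      using has_sum_reindex_bij_betw[OF bij, of ?F S] by simp
    moreover have "((\<lambda>k. ?F (?B (m, k))) has_sum (mon m z *\<^sub>C a m z)) UNIV" if m: "m \<in> smooth T" for m
    proof -
      \<comment> \<open>The step from s to s + 2 also puts the i-th coordinate strictly inside the
        circle of integration.\<close>
      have w: "norm (z $ i) < rad s i"
      proof -
        have "norm (z $ i) \<le> (1 / pr i) ^ (s + 2)" using z by (simp add: pdisc_def)
        also have "\<dots> < (1 / pr i) ^ s" using pr_ge_2[of i] by (intro power_strict_decreasing) auto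
        finally show ?thesis by (simp add: rad_def)
      qed
      let ?G = "\<lambda>k. (z $ i) ^ k *\<^sub>C taylor_coeff s i k (a m) z"
      have "?G sums a m (upd z i (z $ i))"
        using aQ[OF m insert(2)] zs w unfolding coordinate_expansion_def by blast
      moreover have "summable (\<lambda>k. norm (?G k))"
        by (rule summable_comparison_test[OF _ taylor_bound_summable[OF w, of "M * real m ^ s"]])
          (use norm_taylor_term_le[OF ac[OF m] zs aM[OF m]] in auto)
      ultimately have "(?G has_sum a m z) UNIV" by (simp add: norm_summable_imp_has_sum)
      from has_sum_bounded_linear[OF scaleC.bounded_linear_right[of "mon m z"] this]
      show ?thesis using m smooth_pos[OF m] by (simp add: b mon_power scaleC_scaleC)
    qed
    ultimately have "((\<lambda>m. mon m z *\<^sub>C a m z) has_sum S) (smooth T)"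
      by (rule has_sum_SigmaD)
    then have "S = g z" using as[OF z] by (rule has_sum_unique)
    with S show ?thesis by simp
  qed
  ultimately show ?case by (intro exI[of _ b]) blast
qed

text \<open>Once every variable has been expanded, the coefficient functions depend on no variable;
  their values at 0 are the coefficients.\<close>

theorem hol_at_expands:
  fixes f :: "complex ^ 'n::finite \<Rightarrow> 'e::complex_banach"
  assumes "hol_at \<zeta> f"
  obtains s a where "expands \<zeta> s a f"
proof -
  have "\<forall>\<^sub>F z in nhds 0. cdiff f (\<zeta> + z)"
  proof -
    have "((\<lambda>z. \<zeta> + z) \<longlongrightarrow> \<zeta> + 0) (nhds 0)" by (intro tendsto_intros filterlim_ident)
    then show ?thesis using assms unfolding hol_at_def by (simp add: filterlim_iff)
  qed
  then obtain s where s: "\<And>z. z \<in> pdisc s \<Longrightarrow> cdiff f (\<zeta> + z)"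
    by (rule pdisc_in_nhd) blast
  define g where "g z = f (\<zeta> + z)" for z
  have cd: "cdiff g z" if "z \<in> pdisc s" for z
  proof -
    have "cdiff (\<lambda>w. f (\<zeta> + w)) (- \<zeta> + (\<zeta> + z))"
      by (rule cdiff_translate) (use s[OF that] in simp)
    then show ?thesis by (simp add: g_def[abs_def])
  qed
  have gc: "continuous_on (pdisc s) g"
    using cd cdiff_isCont by (blast intro: continuous_at_imp_continuous_on)
  obtain M where M: "\<And>z. z \<in> pdisc s \<Longrightarrow> norm (g z) \<le> M" "0 \<le> M" using pdisc_bound[OF gc] by blast
  obtain a where a: "\<forall>m\<in>smooth (UNIV :: 'n set). continuous_on (pdisc s) (a m) \<and>
      (\<forall>j. j \<notin> UNIV \<longrightarrow> coordinate_expansion s j (a m)) \<and>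
      (\<forall>z\<in>pdisc s. norm (a m z) \<le> M * real m ^ s) \<and>
      (\<forall>z\<in>pdisc s. \<forall>z'\<in>pdisc s. (\<forall>j. j \<notin> UNIV \<longrightarrow> z $ j = z' $ j) \<longrightarrow> a m z = a m z')"
    and as: "\<forall>z\<in>pdisc (s + 2). ((\<lambda>m. mon m z *\<^sub>C a m z) has_sum g z) (smooth (UNIV :: 'n set))"
  proof -
    have ce: "coordinate_expansion s j g" for j by (rule coordinate_expansion_cdiff) (rule cd)
    have "\<forall>z\<in>pdisc s. norm (g z) \<le> M" using M(1) by blast
    from partial_expansion[OF gc ce this M(2) finite[of UNIV]] show thesis
      by (elim exE conjE) (rule that)
  qed
  have aM: "norm (a m z) \<le> M * real m ^ s" if "m \<in> smooth (UNIV :: 'n set)" "z \<in> pdisc s" for m z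
    using a that by blast
  have ad: "a m z = a m z'" if "m \<in> smooth (UNIV :: 'n set)" "z \<in> pdisc s" "z' \<in> pdisc s" for m z z'
    using a that by blast
  have z0: "0 \<in> (pdisc s :: (complex ^ 'n) set)" using zero_in_opdisc opdisc_subset by blast
  define c where "c m = (if m \<in> smooth (UNIV :: 'n set) then a m 0 else 0)" for m
  have "expands \<zeta> (s + 2) c f"
    unfolding expands_def
  proof (intro conjI ballI allI impI)
    show "summable (\<lambda>m. norm (c m) * (1 / real m) ^ (s + 2))"
    proof (rule summable_comparison_test[OF _ summable_on_imp_summable[OF inverse_squares_summable_on]], intro exI allI impI)
      fix m :: nat
      show "norm (norm (c m) * (1 / real m) ^ (s + 2)) \<le> M * (1 / real m) ^ 2"
      proof (cases "m \<in> smooth (UNIV :: 'n set)")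
        case True
        then have "norm (c m) * (1 / real m) ^ (s + 2) \<le> (M * real m ^ s) * (1 / real m) ^ (s + 2)"
          using aM[OF True z0] by (intro mult_right_mono) (auto simp: c_def)
        also have "\<dots> = M * (1 / real m) ^ 2" using smooth_pos[OF True] by (simp add: power_add power_divide power2_eq_square)
        finally show ?thesis by simp
      qed (use M in \<open>simp add: c_def\<close>)
    qed
    fix z :: "complex ^ 'n" assume z: "z \<in> pdisc (s + 2)"
    have zs: "z \<in> pdisc s" using z pdisc_mono[of s "s + 2"] by auto
    have "((\<lambda>m. mon m z *\<^sub>C c m) has_sum g z) UNIV \<longleftrightarrow>
        ((\<lambda>m. mon m z *\<^sub>C a m z) has_sum g z) (smooth (UNIV :: 'n set))"
      by (rule has_sum_cong_neutral) (use ad[OF _ zs z0] in \<open>auto simp: c_def\<close>)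
    then have "((\<lambda>m. mon m z *\<^sub>C c m) has_sum g z) UNIV" using bspec[OF as z] by simp
    then show "(\<lambda>m. mon m z *\<^sub>C c m) sums f (\<zeta> + z)"
      unfolding g_def by (rule has_sum_imp_sums)
  qed (simp add: c_def)
  then show thesis by (rule that)
qed

section \<open>Division with remainder by an ideal\<close>

lemma nat_seq_mono_subseq:
  fixes h :: "nat \<Rightarrow> nat"
  obtains r :: "nat \<Rightarrow> nat" where "strict_mono r" "mono (\<lambda>n. h (r n))"
proof -
  obtain g where g: "strict_mono g" "monoseq (\<lambda>n. h (g n))"
    using seq_monosub[of h] by blast
  show thesis
  proof (cases "incseq (\<lambda>n. h (g n))")
    case True then show thesis using that g by blast
  next
    case False
    then have dec: "decseq (\<lambda>n. h (g n))" using g(2) by (simp add: monoseq_iff)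
    obtain N where N: "\<And>n. h (g N) \<le> h (g n)"
      using ex_has_least_nat[of "\<lambda>n. True" 0 "\<lambda>n. h (g n)"] by auto
    have "h (g (n + N)) = h (g N)" for n
      using N[of "n + N"] decseqD[OF dec, of N "n + N"] by simp
    moreover have "strict_mono (\<lambda>n. g (n + N))" using g(1) by (simp add: strict_mono_def)
    ultimately show thesis using that[of "\<lambda>n. g (n + N)"] by (simp add: mono_def)
  qed
qed

lemma smooth_seq_subseq:
  fixes x :: "nat \<Rightarrow> nat"
  assumes "finite T"
  shows "\<exists>r :: nat \<Rightarrow> nat. strict_mono r \<and> (\<forall>i\<in>T. mono (\<lambda>n. multiplicity (pr i) (x (r n))))"
  using assms
proof (induction T)
  case empty
  show ?case by (intro exI[of _ id]) (simp add: strict_mono_def)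
next
  case (insert i T)
  then obtain r :: "nat \<Rightarrow> nat" where r: "strict_mono r" "\<forall>i\<in>T. mono (\<lambda>n. multiplicity (pr i) (x (r n)))" by blast
  obtain s :: "nat \<Rightarrow> nat" where s: "strict_mono s" "mono (\<lambda>n. multiplicity (pr i) (x (r (s n))))"
    using nat_seq_mono_subseq[of "\<lambda>n. multiplicity (pr i) (x (r n))"] by blast
  have ms: "mono s" using s(1) by (simp add: strict_mono_mono)
  have "mono (\<lambda>n. multiplicity (pr j) (x (r (s n))))" if "j \<in> T" for j
    using r(2) that ms by (fastforce simp: mono_def)
  moreover have "strict_mono (\<lambda>n. r (s n))" using r(1) s(1) by (simp add: strict_mono_def)
  ultimately show ?case using s(2) by (intro exI[of _ "\<lambda>n. r (s n)"]) auto
qed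

text \<open>\<open>D\<close> consists of the elements minimal for divisibility. If it were infinite,
  an injective sequence in it would, after passing to a subsequence once for each variable, have
  nondecreasing multiplicities; its first term would then divide the second without being equal to
  it.\<close>

lemma dickson_smooth:
  assumes "X \<subseteq> smooth (UNIV :: 'n::finite set)"
  obtains D where "finite D" "D \<subseteq> X" "\<And>x. x \<in> X \<Longrightarrow> \<exists>d\<in>D. d dvd x"
proof -
  define D where "D = {x \<in> X. \<forall>y\<in>X. y dvd x \<longrightarrow> y = x}"
  have "\<exists>d\<in>D. d dvd x" if "x \<in> X" for x
    using that
  proof (induction x rule: less_induct)
    case (less x)
    show ?case
    proof (cases "x \<in> D")
      case False
      then obtain y where y: "y \<in> X" "y dvd x" "y \<noteq> x" using less.prems by (auto simp: D_def)
      have "x > 0" using assms less.prems smooth_pos by blast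
      then have "y < x" using y by (simp add: dvd_imp_le le_neq_implies_less)
      then show ?thesis using less.IH y by (meson dvd_trans)
    qed (auto intro: bexI[of _ x])
  qed
  moreover have "finite D"
  proof (rule ccontr)
    assume "infinite D"
    then obtain x :: "nat \<Rightarrow> nat" where x: "inj x" "range x \<subseteq> D"
      using infinite_countable_subset by blast
    obtain r :: "nat \<Rightarrow> nat" where r: "strict_mono r" "\<And>i::'n. mono (\<lambda>n. multiplicity (pr i) (x (r n)))"
      using smooth_seq_subseq[of "UNIV :: 'n set" x] by auto
    have sm: "x n \<in> smooth (UNIV :: 'n set)" for n using x(2) assms by (auto simp: D_def)
    have "x (r 0) dvd x (r 1)"
    proof (rule multiplicity_le_imp_dvd)
      show "x (r 0) \<noteq> 0" using smooth_pos[OF sm] by auto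
      fix p :: nat assume p: "prime p"
      show "multiplicity p (x (r 0)) \<le> multiplicity p (x (r 1))"
      proof (cases "p \<in> range (pr :: 'n \<Rightarrow> nat)")
        case True
        then show ?thesis using r(2) by (auto simp: mono_def)
      next
        case False
        then have "\<not> p dvd x (r 0)" using sm p unfolding smooth_def by blast
        then show ?thesis by (simp add: not_dvd_imp_multiplicity_0)
      qed
    qed
    moreover have "x (r 0) \<in> D" "x (r 1) \<in> D" using x(2) by auto
    ultimately have "x (r 0) = x (r 1)" by (simp add: D_def)
    then have "r 0 = r 1" using x(1) by (simp add: inj_eq)
    then show False using r(1) by (simp add: strict_mono_eq)
  qed
  ultimately show thesis using that[of D] by (auto simp: D_def)
qed

section \<open>Unitriangular systems in weighted l^1 spaces\<close>

fun triangular_solution :: "(nat \<Rightarrow> nat \<Rightarrow> complex) \<Rightarrow> (nat \<Rightarrow> 'e::complex_banach) \<Rightarrow> nat \<Rightarrow> 'e" where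
  "triangular_solution b f m = f m - (\<Sum>d\<in>{..<m}. b d m *\<^sub>C triangular_solution b f d)"

declare triangular_solution.simps [simp del]

lemma triangular_solution_eq:
  assumes "b m m = 1"
  shows "(\<Sum>d\<le>m. b d m *\<^sub>C triangular_solution b f d) = f m"
  using triangular_solution.simps[of b f m] assms
  by (simp add: lessThan_Suc_atMost[symmetric])

text \<open>In the weighted l^1 norm the strictly triangular part of \<open>b\<close> has norm at
  most 1/2, so the identity plus this part has an inverse of norm at most 2. The estimate is made on
  finite sections, where half of the left-hand side may be absorbed before summability is
  known.\<close>

lemma triangular_solution_summable:
  fixes f :: "nat \<Rightarrow> 'e::complex_banach" and w :: "nat \<Rightarrow> real"
  assumes w: "\<And>m. 0 \<le> w m"
    and b: "\<And>d N. (\<Sum>m\<in>{d<..<N}. norm (b d m) * w m) \<le> w d / 2"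
    and f: "summable (\<lambda>m. norm (f m) * w m)"
  shows "summable (\<lambda>m. norm (triangular_solution b f m) * w m)"
proof (rule summableI_nonneg_bounded)
  let ?u = "triangular_solution b f"
  show "0 \<le> norm (?u m) * w m" for m using w by simp
  fix N
  have "(\<Sum>m<N. norm (?u m) * w m) \<le>
      (\<Sum>m<N. norm (f m) * w m + (\<Sum>d<N. if d < m then norm (?u d) * (norm (b d m) * w m) else 0))"
  proof (rule sum_mono)
    fix m assume m: "m \<in> {..<N}"
    have "norm (?u m) \<le> norm (f m) + norm (\<Sum>d<m. b d m *\<^sub>C ?u d)"
      by (subst triangular_solution.simps) (rule norm_triangle_ineq4)
    also have "norm (\<Sum>d<m. b d m *\<^sub>C ?u d) \<le> (\<Sum>d<m. norm (b d m) * norm (?u d))"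
      by (rule order_trans[OF norm_sum]) (simp add: norm_scaleC)
    finally have "norm (?u m) * w m \<le> (norm (f m) + (\<Sum>d<m. norm (b d m) * norm (?u d))) * w m"
      using w by (intro mult_right_mono) auto
    also have "\<dots> = norm (f m) * w m + (\<Sum>d<m. norm (?u d) * (norm (b d m) * w m))"
      by (simp add: distrib_right distrib_left sum_distrib_right sum_distrib_left mult_ac)
    also have "(\<Sum>d<m. norm (?u d) * (norm (b d m) * w m)) =
        (\<Sum>d<N. if d < m then norm (?u d) * (norm (b d m) * w m) else 0)"
      using m by (intro sum.mono_neutral_cong_left) auto
    finally show "norm (?u m) * w m \<le> norm (f m) * w m +
        (\<Sum>d<N. if d < m then norm (?u d) * (norm (b d m) * w m) else 0)" .
  qed
  also have "\<dots> = (\<Sum>m<N. norm (f m) * w m) +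
      (\<Sum>d<N. \<Sum>m<N. if d < m then norm (?u d) * (norm (b d m) * w m) else 0)"
    by (simp only: sum.distrib) (rule arg_cong2[of _ _ _ _ "(+)", OF refl sum.swap])
  also have "(\<Sum>d<N. \<Sum>m<N. if d < m then norm (?u d) * (norm (b d m) * w m) else 0) \<le>
      (\<Sum>d<N. norm (?u d) * (w d / 2))"
  proof (rule sum_mono)
    fix d assume "d \<in> {..<N}"
    have "(\<Sum>m<N. if d < m then norm (?u d) * (norm (b d m) * w m) else 0) =
        norm (?u d) * (\<Sum>m\<in>{d<..<N}. norm (b d m) * w m)"
      unfolding sum_distrib_left by (rule sum.mono_neutral_cong_right) auto
    also have "\<dots> \<le> norm (?u d) * (w d / 2)" by (intro mult_left_mono b) simp
    finally show "(\<Sum>m<N. if d < m then norm (?u d) * (norm (b d m) * w m) else 0) \<le> norm (?u d) * (w d / 2)" .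
  qed
  also have "(\<Sum>d<N. norm (?u d) * (w d / 2)) = (\<Sum>d<N. norm (?u d) * w d) / 2"
    by (simp add: sum_divide_distrib)
  finally have "(\<Sum>m<N. norm (?u m) * w m) \<le> 2 * (\<Sum>m<N. norm (f m) * w m)" by simp
  also have "\<dots> \<le> 2 * suminf (\<lambda>m. norm (f m) * w m)"
    using w by (intro mult_left_mono sum_le_suminf f) auto
  finally show "(\<Sum>m<N. norm (?u m) * w m) \<le> 2 * suminf (\<lambda>m. norm (f m) * w m)" .
qed

text \<open>With \<open>x m\<close> the value of the m-th monomial at a point and \<open>y d\<close>
  that of the series with coefficients \<open>b d\<close>, this rewrites an expansion in monomials
  as one in the functions \<open>y d\<close>. It is an interchange of summations in the double
  series of \<open>x m * b d m\<close> times \<open>u d\<close>, which is absolutely summable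
  because each \<open>b d\<close> has weighted norm at most \<open>2 * w d\<close>.\<close>

lemma triangular_has_sum:
  fixes u :: "nat \<Rightarrow> 'e::complex_banach" and w :: "nat \<Rightarrow> real" and x :: "nat \<Rightarrow> complex"
  assumes w: "\<And>m. 0 \<le> w m" and x: "\<And>m. m \<in> S \<Longrightarrow> norm (x m) \<le> w m"
    and bS: "\<And>d m. d \<in> S \<Longrightarrow> m \<notin> S \<Longrightarrow> b d m = 0"
    and b0: "\<And>d m. m < d \<Longrightarrow> b d m = 0" and b1: "\<And>d. b d d = 1"
    and b: "\<And>d N. (\<Sum>m\<in>{d<..<N}. norm (b d m) * w m) \<le> w d / 2"
    and u: "summable (\<lambda>m. norm (u m) * w m)" and uS: "\<And>m. m \<notin> S \<Longrightarrow> u m = 0"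
    and f: "(\<lambda>m. x m *\<^sub>C (\<Sum>d\<le>m. b d m *\<^sub>C u d)) sums F"
    and y: "\<And>d. d \<in> S \<Longrightarrow> (\<lambda>m. x m * b d m) sums y d"
  shows "((\<lambda>d. y d *\<^sub>C u d) has_sum F) S"
proof -
  let ?H = "\<lambda>(d, m). (x m * b d m) *\<^sub>C u d"
  have le: "norm (x m * b d m) \<le> norm (b d m) * w m" if "d \<in> S" for d m
    using x[of m] bS[OF that, of m] w[of m]
    by (cases "m \<in> S") (auto simp: norm_mult mult.commute[of _ "w m"] intro!: mult_right_mono)
  \<comment> \<open>The diagonal entry contributes \<open>w d\<close> and the tail at most half of
    that.\<close>
  have bN: "(\<Sum>m<N. norm (b d m) * w m) \<le> 2 * w d" for d N
  proof -
    have "(\<Sum>m<N. norm (b d m) * w m) \<le> (\<Sum>m\<in>insert d {d<..<N}. norm (b d m) * w m)"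
    proof -
      have "(\<Sum>m<N. norm (b d m) * w m) = (\<Sum>m\<in>{..<N} \<inter> insert d {d<..<N}. norm (b d m) * w m)"
        by (rule sum.mono_neutral_right) (auto, metis b0 nat_neq_iff)
      also have "\<dots> \<le> (\<Sum>m\<in>insert d {d<..<N}. norm (b d m) * w m)"
        by (rule sum_mono2) (auto simp: w)
      finally show ?thesis .
    qed
    also have "\<dots> = w d + (\<Sum>m\<in>{d<..<N}. norm (b d m) * w m)" by (simp add: b1)
    also have "\<dots> \<le> 2 * w d" using b[of d N] w[of d] by simp
    finally show ?thesis .
  qed
  have sb: "summable (\<lambda>m. norm (b d m) * w m)" for d
    by (rule summableI_nonneg_bounded[OF _ bN]) (simp add: w)
  have sb2: "suminf (\<lambda>m. norm (b d m) * w m) \<le> 2 * w d" for d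
    by (rule suminf_le_const[OF sb bN])
  have row: "(\<lambda>m. norm (?H (d, m))) summable_on UNIV \<and>
      infsum (\<lambda>m. norm (?H (d, m))) UNIV \<le> 2 * (norm (u d) * w d)" if d: "d \<in> S" for d
  proof -
    have hs: "((\<lambda>m. (norm (b d m) * w m) * norm (u d)) has_sum
        (suminf (\<lambda>m. norm (b d m) * w m) * norm (u d))) UNIV"
    proof (rule norm_summable_imp_has_sum)
      show "summable (\<lambda>m. norm ((norm (b d m) * w m) * norm (u d)))"
        using w by (simp add: abs_mult summable_mult2 sb)
      show "(\<lambda>m. (norm (b d m) * w m) * norm (u d)) sums (suminf (\<lambda>m. norm (b d m) * w m) * norm (u d))"
        by (intro sums_mult2 summable_sums sb)
    qed
    have le': "norm (?H (d, m)) \<le> (norm (b d m) * w m) * norm (u d)" for m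
      by (simp only: prod.case norm_scaleC) (intro mult_right_mono le[OF d] norm_ge_zero)
    have s: "(\<lambda>m. norm (?H (d, m))) summable_on UNIV"
      by (rule Infinite_Sum.abs_summable_on_comparison_test'[OF has_sum_imp_summable[OF hs] le'])
    have "infsum (\<lambda>m. norm (?H (d, m))) UNIV \<le> infsum (\<lambda>m. (norm (b d m) * w m) * norm (u d)) UNIV"
      by (rule infsum_mono[OF s has_sum_imp_summable[OF hs] le'])
    also have "\<dots> \<le> (2 * w d) * norm (u d)"
      unfolding infsumI[OF hs] by (intro mult_right_mono sb2 norm_ge_zero)
    finally show ?thesis using s by (simp add: mult_ac)
  qed
  have "(\<lambda>p. norm (?H p)) summable_on (S \<times> UNIV)"
  proof (rule Infinite_Sum.abs_summable_on_Sigma_iff[THEN iffD2], intro conjI ballI)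
    fix d assume "d \<in> S" then show "(\<lambda>m. norm (?H (d, m))) summable_on UNIV" using row by simp
  next
    have "(\<lambda>d. 2 * (norm (u d) * w d)) summable_on UNIV"
    proof (rule norm_summable_imp_summable_on)
      show "summable (\<lambda>d. norm (2 * (norm (u d) * w d)))"
        using summable_mult[OF u, of 2] w by (simp add: abs_mult)
    qed
    then have "(\<lambda>d. 2 * (norm (u d) * w d)) summable_on S"
      by (rule summable_on_subset_banach) simp
    then show "(\<lambda>d. norm (infsum (\<lambda>m. norm (?H (d, m))) UNIV)) summable_on S"
      by (rule Infinite_Sum.abs_summable_on_comparison_test')
        (use row in \<open>auto simp: infsum_nonneg\<close>)
  qed
  then have "?H summable_on (S \<times> UNIV)" by (rule Infinite_Sum.abs_summable_summable)
  then obtain F' where F': "(?H has_sum F') (S \<times> UNIV)" by (auto simp: summable_on_def)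
  have rows: "((\<lambda>m. ?H (d, m)) has_sum (y d *\<^sub>C u d)) UNIV" if d: "d \<in> S" for d
  proof (rule norm_summable_imp_has_sum)
    show "summable (\<lambda>m. norm (?H (d, m)))" using row[OF d] by (blast intro: summable_on_imp_summable)
    show "(\<lambda>m. ?H (d, m)) sums (y d *\<^sub>C u d)"
      using bounded_linear.sums[OF scaleC.bounded_linear_left y[OF d]] by simp
  qed
  have "((\<lambda>d. y d *\<^sub>C u d) has_sum F') S"
    by (rule has_sum_SigmaD[OF F' rows])
  moreover have "((\<lambda>m. x m *\<^sub>C (\<Sum>d\<le>m. b d m *\<^sub>C u d)) has_sum F') UNIV"
  proof (rule has_sum_SigmaD[OF has_sum_swap[THEN iffD1, OF F']])
    fix m
    have "((\<lambda>d. (x m * b d m) *\<^sub>C u d) has_sum (\<Sum>d\<le>m. (x m * b d m) *\<^sub>C u d)) {..m}"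
      by (rule has_sum_finite) simp
    moreover have "((\<lambda>d. (x m * b d m) *\<^sub>C u d) has_sum F'') S \<longleftrightarrow>
        ((\<lambda>d. (x m * b d m) *\<^sub>C u d) has_sum F'') {..m}" for F''
      by (rule has_sum_cong_neutral) (auto simp: uS b0)
    ultimately show "((\<lambda>d. case (m, d) of (x', y) \<Rightarrow> ?H (y, x')) has_sum
        (x m *\<^sub>C (\<Sum>d\<le>m. b d m *\<^sub>C u d))) S"
      by (simp add: scaleC.sum_right scaleC_scaleC)
  qed
  then have "F' = F" using f by (blast dest: has_sum_imp_sums sums_unique2)
  ultimately show ?thesis by simp
qed

text \<open>For k > j the ratio of the weights is at most (j/(j+1))^t after splitting off a fixed
  power, and this tends to 0. So the tail loses against the leading weight once \<open>s\<close> is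
  large, whatever the coefficients. Here the encoding by integers pays off: the order of the
  monomials is the order of their weights.\<close>

lemma leading_term_dominates:
  assumes c: "summable (\<lambda>m. norm (c m) * (1 / real m) ^ s0)" and "j > 0"
  shows "\<forall>\<^sub>F s in sequentially. \<forall>N. (\<Sum>k\<in>{j<..<N}. norm (c k) * (1 / real k) ^ s) \<le> (1 / real j) ^ s / 2"
proof -
  define C where "C = suminf (\<lambda>m. norm (c m) * (1 / real m) ^ s0)"
  have lim: "(\<lambda>t. (C * real j ^ s0) * (real j / real (Suc j)) ^ t) \<longlonglongrightarrow> (C * real j ^ s0) * 0"
    by (intro tendsto_intros LIMSEQ_realpow_zero) auto
  have "\<forall>\<^sub>F t in sequentially. (C * real j ^ s0) * (real j / real (Suc j)) ^ t < 1/2"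
    using order_tendstoD(2)[OF lim, of "1/2"] by simp
  then obtain T where T: "\<And>t. t \<ge> T \<Longrightarrow> (C * real j ^ s0) * (real j / real (Suc j)) ^ t < 1/2"
    by (auto simp: eventually_sequentially)
  show ?thesis unfolding eventually_sequentially
  proof (intro exI[of _ "s0 + T"] allI impI)
    fix s N :: nat assume "s0 + T \<le> s"
    then obtain t where t: "s = s0 + t" "t \<ge> T" by (metis add.assoc le_Suc_ex le_add1)
    have "(\<Sum>k\<in>{j<..<N}. norm (c k) * (1 / real k) ^ s) \<le>
        (\<Sum>k\<in>{j<..<N}. (1 / real (Suc j)) ^ t * (norm (c k) * (1 / real k) ^ s0))"
    proof (rule sum_mono)
      fix k assume k: "k \<in> {j<..<N}"
      have "(1 / real k) ^ t \<le> (1 / real (Suc j)) ^ t"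
        using k by (intro power_mono) (auto simp: field_simps)
      then have "(1 / real k) ^ t * (norm (c k) * (1 / real k) ^ s0) \<le>
          (1 / real (Suc j)) ^ t * (norm (c k) * (1 / real k) ^ s0)"
        by (intro mult_right_mono) auto
      then show "norm (c k) * (1 / real k) ^ s \<le> (1 / real (Suc j)) ^ t * (norm (c k) * (1 / real k) ^ s0)"
        by (simp only: t power_add mult_ac)
    qed
    also have "\<dots> = (1 / real (Suc j)) ^ t * (\<Sum>k\<in>{j<..<N}. norm (c k) * (1 / real k) ^ s0)"
      by (simp only: sum_distrib_left)
    also have "\<dots> \<le> (1 / real (Suc j)) ^ t * C"
      unfolding C_def by (intro mult_left_mono sum_le_suminf c) auto
    also have "\<dots> = (1 / real j) ^ s * ((C * real j ^ s0) * (real j / real (Suc j)) ^ t)"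
      using \<open>j > 0\<close> by (simp add: t power_add power_divide)
    also have "\<dots> \<le> (1 / real j) ^ s * (1 / 2)"
      using less_imp_le[OF T[OF t(2)]] by (intro mult_left_mono) auto
    finally show "(\<Sum>k\<in>{j<..<N}. norm (c k) * (1 / real k) ^ s) \<le> (1 / real j) ^ s / 2" by simp
  qed
qed

section \<open>The division theorem for Banach-valued power series\<close>

lemma expands_series:
  fixes a :: "nat \<Rightarrow> 'e::complex_banach" and \<zeta> :: "complex ^ 'n::finite"
  assumes supp: "\<And>m. m \<notin> smooth (UNIV :: 'n set) \<Longrightarrow> a m = 0"
    and summ: "summable (\<lambda>m. norm (a m) * (1 / real m) ^ s)"
  shows "expands \<zeta> s a (\<lambda>z. suminf (\<lambda>m. mon m (z - \<zeta>) *\<^sub>C a m))"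
proof -
  have "summable (\<lambda>m. mon m z *\<^sub>C a m)" if "z \<in> pdisc s" for z :: "complex ^ 'n"
    by (rule summable_comparison_test[OF _ summ], intro exI allI impI, rule norm_term_le[OF supp that])
  then show ?thesis using assms by (auto simp: expands_def summable_sums)
qed

lemma expands_cdual:
  fixes f :: "complex ^ 'n::finite \<Rightarrow> 'e::complex_banach"
  assumes l: "cdual l" and f: "expands \<zeta> s a f"
  shows "expands \<zeta> s (\<lambda>m. l (a m)) (\<lambda>z. l (f z))"
proof -
  interpret l: bounded_linear l by (rule cdual_bounded_linear[OF l])
  show ?thesis
    unfolding expands_def
  proof (intro conjI allI impI ballI)
    obtain K where K: "\<And>x. norm (l x) \<le> norm x * K" using l.bounded by blast
    have "summable (\<lambda>m. K * (norm (a m) * (1 / real m) ^ s))"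
      using f by (intro summable_mult) (simp add: expands_def)
    then show "summable (\<lambda>m. norm (l (a m)) * (1 / real m) ^ s)"
    proof (rule summable_comparison_test[rotated], intro exI allI impI)
      fix m
      have "norm (l (a m)) * (1 / real m) ^ s \<le> (norm (a m) * K) * (1 / real m) ^ s"
        by (intro mult_right_mono K) simp
      then show "norm (norm (l (a m)) * (1 / real m) ^ s) \<le> K * (norm (a m) * (1 / real m) ^ s)"
        by (simp add: mult_ac)
    qed
    fix z :: "complex ^ 'n" assume "z \<in> pdisc s"
    then have "(\<lambda>m. mon m z *\<^sub>C a m) sums f (\<zeta> + z)" using f by (simp add: expands_def)
    from l.sums[OF this] show "(\<lambda>m. mon m z *\<^sub>C l (a m)) sums l (f (\<zeta> + z))"
      by (simp add: cdual_scaleC[OF l] scaleC_complex_def)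
  qed (use f l.zero in \<open>auto simp: expands_def\<close>)
qed

text \<open>The monomials are replaced by functions \<open>y d\<close>: for d in \<open>X\<close> a
  chosen generator \<open>G e\<close>, with e dividing d, times the monomial d / e, and the monomial
  d itself otherwise. Each has leading term d with coefficient 1, so expanding \<open>f\<close> in
  them is a unitriangular system. The terms with d in \<open>X\<close>, sorted by e, make up the
  products of generators and quotients; the others form the remainder.\<close>

theorem hol_division:
  fixes f :: "complex ^ 'n::finite \<Rightarrow> 'e::complex_banach"
  assumes X: "X \<subseteq> smooth (UNIV :: 'n set)"
    and D: "finite D" "D \<subseteq> X" "\<And>x. x \<in> X \<Longrightarrow> \<exists>d\<in>D. d dvd x"
    and G: "\<And>e. e \<in> D \<Longrightarrow> expands \<zeta> s0 (c e) (G e)"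
    and lead: "\<And>e. e \<in> D \<Longrightarrow> c e e = 1" "\<And>e m. e \<in> D \<Longrightarrow> m < e \<Longrightarrow> c e m = 0"
    and f: "hol_at \<zeta> f"
  obtains s \<rho> r q where "\<And>e. e \<in> D \<Longrightarrow> hol_at \<zeta> (q e)" "expands \<zeta> s \<rho> r" "\<And>m. m \<in> X \<Longrightarrow> \<rho> m = 0"
    "\<forall>\<^sub>F z in nhds \<zeta>. f z = (\<Sum>e\<in>D. G e z *\<^sub>C q e z) + r z"
proof -
  let ?S = "smooth (UNIV :: 'n set)"
  obtain sf af where af: "expands \<zeta> sf af f" using hol_at_expands[OF f] .
  have Dpos: "e > 0" if "e \<in> D" for e using that D(2) X smooth_pos by blast
  \<comment> \<open>One exponent serves all purposes: beyond those of the expansions of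
    \<open>f\<close> and of the generators, and so large that each of the finitely many leading
    terms dominates its tail.\<close>
  have "\<forall>\<^sub>F s in sequentially. \<forall>e\<in>D. \<forall>N. (\<Sum>k\<in>{e<..<N}. norm (c e k) * (1 / real k) ^ s) \<le> (1 / real e) ^ s / 2"
  proof (rule eventually_ball_finite[OF D(1)], intro ballI)
    fix e assume e: "e \<in> D"
    show "\<forall>\<^sub>F s in sequentially. \<forall>N. (\<Sum>k\<in>{e<..<N}. norm (c e k) * (1 / real k) ^ s) \<le> (1 / real e) ^ s / 2"
      by (rule leading_term_dominates[OF _ Dpos[OF e]]) (use G[OF e] in \<open>auto simp: expands_def\<close>)
  qed
  then have "\<forall>\<^sub>F s in sequentially. (\<forall>e\<in>D. \<forall>N. (\<Sum>k\<in>{e<..<N}. norm (c e k) * (1 / real k) ^ s) \<le> (1 / real e) ^ s / 2)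
      \<and> sf \<le> s \<and> s0 \<le> s"
    by (intro eventually_conj eventually_ge_at_top)
  then obtain s where s: "\<And>e N. e \<in> D \<Longrightarrow> (\<Sum>k\<in>{e<..<N}. norm (c e k) * (1 / real k) ^ s) \<le> (1 / real e) ^ s / 2"
    "sf \<le> s" "s0 \<le> s" by (auto simp: eventually_sequentially)
  have Gs: "expands \<zeta> s (c e) (G e)" if "e \<in> D" for e using expands_mono[OF G[OF that] s(3)] .
  have afs: "expands \<zeta> s af f" using expands_mono[OF af s(2)] .
  have c0: "c e m = 0" if "e \<in> D" "m \<notin> ?S" for e m using Gs[OF that(1)] that(2) by (auto simp: expands_def)
  define j where "j x = (SOME e. e \<in> D \<and> e dvd x)" for x
  have j: "j x \<in> D" "j x dvd x" if "x \<in> X" for x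
    using someI_ex[of "\<lambda>e. e \<in> D \<and> e dvd x"] D(3)[OF that] by (auto simp: j_def)
  have jq: "j x * (x div j x) = x" if "x \<in> X" for x using j[OF that] by simp
  have Xpos: "x > 0" if "x \<in> X" for x using that X smooth_pos by blast
  have qS: "x div j x \<in> ?S" if "x \<in> X" for x
    using that X jq[OF that] by (metis dvd_triv_right smooth_dvd subsetD)
  have qpos: "x div j x > 0" if "x \<in> X" for x using smooth_pos[OF qS[OF that]] .
  \<comment> \<open>The coefficient of the monomial m in \<open>y d\<close>. Multiplying a generator
    by a monomial moves its coefficients to the multiples of that monomial, hence the divisibility
    condition.\<close>
  define b where "b d m = (if d \<in> X then if d div j d dvd m then c (j d) (m div (d div j d)) else 0
      else if m = d then 1 else 0)" for d m
  have b_mult: "b d (d div j d * k) = c (j d) k" if "d \<in> X" for d k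
    using that qpos[OF that] by (simp add: b_def)
  have b_nd: "b d m = 0" if "d \<in> X" "m \<notin> range ((*) (d div j d))" for d m
    using that by (auto simp: b_def dvd_def)
  define w where "w m = (1 / real m) ^ s" for m
  have w0: "0 \<le> w m" for m by (simp add: w_def)
  have b0: "b d m = 0" if "m < d" for d m
  proof (cases "d \<in> X \<and> d div j d dvd m")
    case True
    then obtain k where k: "m = d div j d * k" by auto
    have "d div j d * k < d div j d * j d" using that jq[of d] True k by (simp add: mult.commute)
    then have "k < j d" by simp
    then show ?thesis using k True b_mult lead(2) j(1) by simp
  qed (use that in \<open>auto simp: b_def\<close>)
  have b1: "b d d = 1" for d
  proof (cases "d \<in> X")
    case True
    then show ?thesis using b_mult[OF True, of "j d"] jq[OF True] lead(1)[OF j(1)[OF True]]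
      by (simp add: mult.commute)
  qed (simp add: b_def)
  have bS: "b d m = 0" if "d \<in> ?S" "m \<notin> ?S" for d m
  proof (cases "d \<in> X \<and> d div j d dvd m")
    case True
    then obtain k where k: "m = d div j d * k" by auto
    then have "k \<notin> ?S" using smooth_mult[OF qS] True that(2) by blast
    then show ?thesis using k True b_mult c0 j(1) by simp
  qed (use that in \<open>auto simp: b_def\<close>)
  \<comment> \<open>Multiplication by a monomial scales all weights by the same factor, so the
    estimates for the finitely many generators yield one for every d.\<close>
  have btail: "(\<Sum>m\<in>{d<..<N}. norm (b d m) * w m) \<le> w d / 2" for d N
  proof (cases "d \<in> X")
    case True
    let ?q = "d div j d"
    note qp = qpos[OF True]
    have "(\<Sum>m\<in>{d<..<N}. norm (b d m) * w m) = (\<Sum>m\<in>{d<..<N} \<inter> (*) ?q ` {j d<..<N}. norm (b d m) * w m)"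
    proof (rule sum.mono_neutral_right)
      show "\<forall>m\<in>{d<..<N} - {d<..<N} \<inter> (*) ?q ` {j d<..<N}. norm (b d m) * w m = 0"
      proof
        fix m assume m: "m \<in> {d<..<N} - {d<..<N} \<inter> (*) ?q ` {j d<..<N}"
        have "m \<notin> range ((*) ?q)"
        proof
          assume "m \<in> range ((*) ?q)"
          then obtain k where k: "m = ?q * k" by auto
          have "?q * j d < ?q * k" using m k jq[OF True] by (simp add: mult.commute)
          then have "j d < k" by simp
          moreover have "k < N" using m k qp by (auto intro: le_less_trans[of k "?q * k"])
          ultimately show False using m k by auto
        qed
        then show "norm (b d m) * w m = 0" using b_nd[OF True] by simp
      qed
    qed auto
    also have "\<dots> \<le> (\<Sum>m\<in>(*) ?q ` {j d<..<N}. norm (b d m) * w m)"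
      by (rule sum_mono2) (auto simp: w0)
    also have "\<dots> = (\<Sum>k\<in>{j d<..<N}. norm (b d (?q * k)) * w (?q * k))"
      using qp by (subst sum.reindex) (auto simp: inj_on_def)
    also have "\<dots> = w ?q * (\<Sum>k\<in>{j d<..<N}. norm (c (j d) k) * (1 / real k) ^ s)"
      unfolding sum_distrib_left b_mult[OF True]
      by (simp add: w_def power_divide power_mult_distrib mult_ac)
    also have "\<dots> \<le> w ?q * ((1 / real (j d)) ^ s / 2)"
      by (intro mult_left_mono s(1) j(1) True w0)
    also have "\<dots> = w (j d * ?q) / 2"
      by (simp add: w_def power_divide power_mult_distrib)
    finally show ?thesis by (simp only: jq[OF True])
  next
    case False
    then have "(\<Sum>m\<in>{d<..<N}. norm (b d m) * w m) = 0" by (intro sum.neutral) (auto simp: b_def)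
    then show ?thesis using w0 by simp
  qed
  define u where "u = triangular_solution b af"
  have usum: "summable (\<lambda>m. norm (u m) * w m)"
    unfolding u_def by (rule triangular_solution_summable[OF w0 btail])
      (use afs in \<open>auto simp: expands_def w_def\<close>)
  have uS: "u m = 0" if "m \<notin> ?S" for m
    using that
  proof (induction m rule: less_induct)
    case (less m)
    have "(\<Sum>d\<in>{..<m}. b d m *\<^sub>C u d) = 0"
    proof (rule sum.neutral, intro ballI)
      fix d assume "d \<in> {..<m}"
      then show "b d m *\<^sub>C u d = 0" using less bS by (cases "d \<in> ?S") auto
    qed
    then show ?case
      using triangular_solution.simps[of b af m] afs less.prems by (auto simp: u_def expands_def)
  qed
  have ueq: "(\<Sum>d\<le>m. b d m *\<^sub>C u d) = af m" for m
    unfolding u_def by (rule triangular_solution_eq[of b m af, OF b1])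
  define y where "y z d = (if d \<in> X then mon (d div j d) z * G (j d) (\<zeta> + z) else mon d z)" for z d
  define \<rho> where "\<rho> m = (if m \<in> X then 0 else u m)" for m
  define r where "r z = suminf (\<lambda>m. mon m (z - \<zeta>) *\<^sub>C \<rho> m)" for z
  \<comment> \<open>The unknown at d = e k enters the quotient of e exactly when \<open>j\<close>
    assigns d to e; otherwise another generator or the remainder takes it.\<close>
  define qc where "qc e k = (if e * k \<in> X \<and> j (e * k) = e then u (e * k) else 0)" for e k
  define q where "q e z = suminf (\<lambda>k. mon k (z - \<zeta>) *\<^sub>C qc e k)" for e z
  have r: "expands \<zeta> s \<rho> r"
    unfolding r_def[abs_def]
  proof (rule expands_series)
    show "summable (\<lambda>m. norm (\<rho> m) * (1 / real m) ^ s)"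
      by (rule summable_comparison_test[OF _ usum]) (auto simp: \<rho>_def w_def)
  qed (simp add: \<rho>_def uS)
  have q: "expands \<zeta> s (qc e) (q e)" if e: "e \<in> D" for e
    unfolding q_def[abs_def]
  proof (rule expands_series)
    fix m assume "m \<notin> ?S"
    then have "e * m \<notin> ?S" by (meson dvd_triv_right smooth_dvd)
    then show "qc e m = 0" using uS by (simp add: qc_def)
  next
    have sm: "strict_mono ((*) e)" using Dpos[OF e] by (simp add: strict_mono_def)
    define g where "g m = (if m \<in> range ((*) e) then norm (u m) * w m else 0)" for m
    have "summable g"
      by (rule summable_comparison_test[OF _ usum]) (auto simp: g_def w0)
    then have "summable (\<lambda>k. g (e * k))"
      using summable_mono_reindex[OF sm, of g] by (auto simp: g_def)
    \<comment> \<open>Along the multiples of e the weights of e k and of k differ only by the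
      constant factor e^s.\<close>
    then have "summable (\<lambda>k. real e ^ s * g (e * k))" by (rule summable_mult)
    then show "summable (\<lambda>k. norm (qc e k) * (1 / real k) ^ s)"
    proof (rule summable_comparison_test[rotated], intro exI allI impI)
      fix k
      have "real e ^ s * g (e * k) = norm (u (e * k)) * (1 / real k) ^ s"
        using Dpos[OF e] by (simp add: g_def w_def power_divide power_mult_distrib)
      then show "norm (norm (qc e k) * (1 / real k) ^ s) \<le> real e ^ s * g (e * k)"
        by (simp add: qc_def)
    qed
  qed
  have main: "f (\<zeta> + z) = (\<Sum>e\<in>D. G e (\<zeta> + z) *\<^sub>C q e (\<zeta> + z)) + r (\<zeta> + z)" if z: "z \<in> pdisc s" for z
  proof -
    have "((\<lambda>d. y z d *\<^sub>C u d) has_sum f (\<zeta> + z)) ?S"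
    proof (rule triangular_has_sum[OF w0 _ bS b0 b1 btail usum uS, where x = "\<lambda>m. mon m z"])
      show "norm (mon m z) \<le> w m" if "m \<in> ?S" for m using norm_mon_le[OF that z] by (simp add: w_def)
      show "(\<lambda>m. mon m z *\<^sub>C (\<Sum>d\<le>m. b d m *\<^sub>C u d)) sums f (\<zeta> + z)"
        unfolding ueq using afs z by (simp add: expands_def)
      show "(\<lambda>m. mon m z * b d m) sums y z d" if "d \<in> ?S" for d
      proof (cases "d \<in> X")
        case True
        let ?q = "d div j d"
        have sm: "strict_mono ((*) ?q)" using qpos[OF True] by (simp add: strict_mono_def)
        have "(\<lambda>k. mon k z * c (j d) k) sums G (j d) (\<zeta> + z)"
          using Gs[OF j(1)[OF True]] z by (simp add: expands_def scaleC_complex_def)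
        then have "(\<lambda>k. mon ?q z * (mon k z * c (j d) k)) sums (mon ?q z * G (j d) (\<zeta> + z))"
          by (rule sums_mult)
        moreover have "mon ?q z * (mon k z * c (j d) k) = mon (?q * k) z * b d (?q * k)" for k
          using c0[OF j(1)[OF True], of 0] b_mult[OF True, of 0] qpos[OF True]
          by (cases "k = 0") (auto simp: mon_mult b_mult[OF True])
        ultimately show ?thesis
          using sums_mono_reindex[OF sm, of "\<lambda>m. mon m z * b d m"] b_nd[OF True] True
          by (simp add: y_def)
      next
        case False
        show ?thesis
        proof -
          have "(\<lambda>m. mon m z * b d m) = (\<lambda>m. if m = d then mon m z else 0)"
            using False by (auto simp: b_def fun_eq_iff)
          then show ?thesis using False sums_single[of d "\<lambda>m. mon m z"] by (simp add: y_def)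
        qed
      qed
    qed
    moreover have "((\<lambda>d. y z d *\<^sub>C u d) has_sum f (\<zeta> + z)) ?S \<longleftrightarrow> ((\<lambda>d. y z d *\<^sub>C u d) has_sum f (\<zeta> + z)) UNIV"
      by (rule has_sum_cong_neutral) (auto simp: uS)
    ultimately have total: "(\<lambda>d. y z d *\<^sub>C u d) sums f (\<zeta> + z)"
      by (simp add: has_sum_imp_sums)
    have part: "(\<lambda>d. if d \<in> X \<and> j d = e then y z d *\<^sub>C u d else 0) sums (G e (\<zeta> + z) *\<^sub>C q e (\<zeta> + z))"
      if e: "e \<in> D" for e
    proof -
      have sm: "strict_mono ((*) e)" using Dpos[OF e] by (simp add: strict_mono_def)
      have "(\<lambda>k. mon k z *\<^sub>C qc e k) sums q e (\<zeta> + z)"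
        using q[OF e] z by (simp add: expands_def)
      from bounded_linear.sums[OF scaleC.bounded_linear_right this, of "G e (\<zeta> + z)"]
      have "(\<lambda>k. if e * k \<in> X \<and> j (e * k) = e then y z (e * k) *\<^sub>C u (e * k) else 0)
          sums (G e (\<zeta> + z) *\<^sub>C q e (\<zeta> + z))"
        using Dpos[OF e] by (simp add: qc_def y_def scaleC_scaleC mult.commute if_distrib cong: if_cong)
      moreover have "(if d \<in> X \<and> j d = e then y z d *\<^sub>C u d else 0) = 0" if "d \<notin> range ((*) e)" for d
        using that j(2)[of d] by (auto simp: dvd_def)
      ultimately show ?thesis
        using sums_mono_reindex[OF sm, of "\<lambda>d. if d \<in> X \<and> j d = e then y z d *\<^sub>C u d else 0"] by simp
    qed
    have rest: "(\<lambda>d. mon d z *\<^sub>C \<rho> d) sums r (\<zeta> + z)"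
      using r z by (simp add: expands_def)
    have "(\<lambda>d. (\<Sum>e\<in>D. if d \<in> X \<and> j d = e then y z d *\<^sub>C u d else 0) + mon d z *\<^sub>C \<rho> d) sums
        ((\<Sum>e\<in>D. G e (\<zeta> + z) *\<^sub>C q e (\<zeta> + z)) + r (\<zeta> + z))"
      by (intro sums_add sums_sum part rest)
    moreover have "(\<Sum>e\<in>D. if d \<in> X \<and> j d = e then y z d *\<^sub>C u d else 0) + mon d z *\<^sub>C \<rho> d = y z d *\<^sub>C u d" for d
      using j(1)[of d] D(1) by (cases "d \<in> X") (auto simp: \<rho>_def y_def)
    ultimately show ?thesis using total by (simp add: sums_unique2)
  qed
  have "\<forall>\<^sub>F z in nhds \<zeta>. f z = (\<Sum>e\<in>D. G e z *\<^sub>C q e z) + r z"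
    using eventually_opdisc[of \<zeta> s]
  proof eventually_elim
    case (elim z)
    then have "z - \<zeta> \<in> pdisc s" using opdisc_subset by blast
    from main[OF this] show ?case by simp
  qed
  then show thesis
    by (intro that[of q s \<rho> r] r expands_hol_at[OF q]) (simp_all add: \<rho>_def)
qed

section \<open>Ideals of scalar germs\<close>

definition germ_ideal :: "complex ^ 'n \<Rightarrow> (complex ^ 'n \<Rightarrow> complex) set \<Rightarrow> bool" where
  "germ_ideal \<zeta> I \<longleftrightarrow> (\<forall>g\<in>I. hol_at \<zeta> g) \<and> (\<lambda>z. 0) \<in> I \<and>
     (\<forall>g\<in>I. \<forall>h\<in>I. (\<lambda>z. g z + h z) \<in> I) \<and> (\<forall>g\<in>I. \<forall>h. hol_at \<zeta> h \<longrightarrow> (\<lambda>z. h z * g z) \<in> I) \<and>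
     (\<forall>g\<in>I. \<forall>h. (\<forall>\<^sub>F z in nhds \<zeta>. g z = h z) \<longrightarrow> h \<in> I)"

lemma
  assumes "germ_ideal \<zeta> I"
  shows germ_ideal_zero: "(\<lambda>z. 0) \<in> I"
    and germ_ideal_add: "g \<in> I \<Longrightarrow> h \<in> I \<Longrightarrow> (\<lambda>z. g z + h z) \<in> I"
    and germ_ideal_mult: "g \<in> I \<Longrightarrow> hol_at \<zeta> h \<Longrightarrow> (\<lambda>z. h z * g z) \<in> I"
    and germ_ideal_transform: "g \<in> I \<Longrightarrow> \<forall>\<^sub>F z in nhds \<zeta>. g z = h z \<Longrightarrow> h \<in> I"
  using assms unfolding germ_ideal_def by blast+

lemma germ_ideal_sum:
  assumes "germ_ideal \<zeta> I" "\<And>e. e \<in> D \<Longrightarrow> g e \<in> I" "\<And>e. e \<in> D \<Longrightarrow> hol_at \<zeta> (h e)"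
  shows "(\<lambda>z. \<Sum>e\<in>D. h e z * g e z) \<in> I"
  using assms(2,3)
proof (induction D rule: infinite_finite_induct)
  case (insert e D)
  then have "(\<lambda>z. h e z * g e z + (\<Sum>e\<in>D. h e z * g e z)) \<in> I"
    by (intro germ_ideal_add[OF assms(1)] germ_ideal_mult[OF assms(1)]) auto
  then show ?case using insert.hyps by simp
qed (simp_all add: germ_ideal_zero[OF assms(1)])

text \<open>The ideal is generated by elements whose leading monomials generate the leading monomials of
  the ideal. The remainder after division by them vanishes, because its composition with any
  functional lies in the ideal but has no leading monomial there.\<close>

theorem ideal_division:
  fixes f :: "complex ^ 'n::finite \<Rightarrow> 'e::complex_banach"
  assumes I: "germ_ideal \<zeta> I" and f: "hol_at \<zeta> f" and lf: "\<And>l. cdual l \<Longrightarrow> (\<lambda>z. l (f z)) \<in> I"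
  obtains L where "\<And>g q. (g, q) \<in> set L \<Longrightarrow> g \<in> I \<and> hol_at \<zeta> q"
    "\<forall>\<^sub>F z in nhds \<zeta>. f z = (\<Sum>(g, q)\<leftarrow>L. g z *\<^sub>C q z)"
proof -
  \<comment> \<open>Leading exponents of members of \<open>I\<close>; leading means least, since
    small numbers carry the large weights. Any expansion of a member counts, so that later the
    coefficients of the remainder can themselves serve as a witness.\<close>
  define X where "X = {m. \<exists>g s a. g \<in> I \<and> expands \<zeta> s a g \<and> a m \<noteq> 0 \<and> (\<forall>k<m. a k = 0)}"
  have X: "X \<subseteq> smooth (UNIV :: 'n set)" by (auto simp: X_def expands_def)
  obtain D where D: "finite D" "D \<subseteq> X" "\<And>x. x \<in> X \<Longrightarrow> \<exists>d\<in>D. d dvd x"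
    using dickson_smooth[OF X] by blast
  have "\<exists>g s a. g \<in> I \<and> expands \<zeta> s a g \<and> a m = 1 \<and> (\<forall>k<m. a k = 0)" if mX: "m \<in> X" for m
  proof -
    obtain g s a where g: "g \<in> I" "expands \<zeta> s a g" "a m \<noteq> 0" "\<forall>k<m. a k = 0"
      using mX unfolding X_def by blast
    have "expands \<zeta> s (\<lambda>k. inverse (a m) * a k) (\<lambda>z. inverse (a m) * g z)"
      by (rule expands_cdual[OF _ g(2)])
        (simp add: cdual_def scaleC_complex_def bounded_linear_mult_right)
    then show ?thesis
      using g germ_ideal_mult[OF I g(1) hol_at_const[of \<zeta> "inverse (a m)"]]
      by (intro exI[of _ "\<lambda>z. inverse (a m) * g z"] exI[of _ s] exI[of _ "\<lambda>k. inverse (a m) * a k"]) auto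
  qed
  then have "\<forall>e\<in>D. \<exists>p. fst p \<in> I \<and> expands \<zeta> (fst (snd p)) (snd (snd p)) (fst p) \<and>
      snd (snd p) e = 1 \<and> (\<forall>k<e. snd (snd p) k = 0)"
    using D(2) by (simp add: subset_iff)
  then obtain P where P: "\<And>e. e \<in> D \<Longrightarrow> fst (P e) \<in> I \<and> expands \<zeta> (fst (snd (P e))) (snd (snd (P e))) (fst (P e)) \<and>
      snd (snd (P e)) e = 1 \<and> (\<forall>k<e. snd (snd (P e)) k = 0)"
    by (rule bchoice[THEN exE]) blast
  define G where "G e = fst (P e)" for e
  define c where "c e = snd (snd (P e))" for e
  define s0 where "s0 = Max (insert 0 ((\<lambda>e. fst (snd (P e))) ` D))"
  have GI: "G e \<in> I" if "e \<in> D" for e using P[OF that] by (simp add: G_def)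
  have G: "expands \<zeta> s0 (c e) (G e)" if "e \<in> D" for e
    unfolding G_def c_def
    by (rule expands_mono[of _ "fst (snd (P e))"]) (use P[OF that] that D(1) in \<open>auto simp: s0_def intro!: Max_ge\<close>)
  have lead: "c e e = 1" "m < e \<Longrightarrow> c e m = 0" if "e \<in> D" for e m
    using P[OF that] by (auto simp: c_def)
  obtain s \<rho> r q where q: "\<And>e. e \<in> D \<Longrightarrow> hol_at \<zeta> (q e)" and r: "expands \<zeta> s \<rho> r"
    and \<rho>: "\<And>m. m \<in> X \<Longrightarrow> \<rho> m = 0" and ev: "\<forall>\<^sub>F z in nhds \<zeta>. f z = (\<Sum>e\<in>D. G e z *\<^sub>C q e z) + r z"
    by (rule hol_division[OF X D G lead f]) (assumption | rule that)+
  have "l (\<rho> m) = 0" if l: "cdual l" for l m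
  proof (rule ccontr)
    assume nz: "l (\<rho> m) \<noteq> 0"
    define m0 where "m0 = (LEAST m. l (\<rho> m) \<noteq> 0)"
    have m0: "l (\<rho> m0) \<noteq> 0"
      unfolding m0_def by (rule LeastI[of "\<lambda>m. l (\<rho> m) \<noteq> 0", OF nz])
    have m0': "l (\<rho> k) = 0" if "k < m0" for k
      using not_less_Least[OF that[unfolded m0_def]] by simp
    interpret l: bounded_linear l by (rule cdual_bounded_linear[OF l])
    have "(\<lambda>z. l (r z)) \<in> I"
    proof (rule germ_ideal_transform[OF I])
      have "(\<lambda>z. \<Sum>e\<in>D. l (q e z) * G e z) \<in> I"
        by (intro germ_ideal_sum[OF I] GI hol_at_cdual[OF l] q)
      then have "(\<lambda>z. (-1) * (\<Sum>e\<in>D. l (q e z) * G e z)) \<in> I"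
        by (rule germ_ideal_mult[OF I]) (rule hol_at_const)
      then show "(\<lambda>z. l (f z) + (-1) * (\<Sum>e\<in>D. l (q e z) * G e z)) \<in> I"
        by (rule germ_ideal_add[OF I lf[OF l]])
      show "\<forall>\<^sub>F z in nhds \<zeta>. l (f z) + - 1 * (\<Sum>e\<in>D. l (q e z) * G e z) = l (r z)"
        using ev by eventually_elim (simp add: l.add l.sum cdual_scaleC[OF l] mult.commute)
    qed
    moreover have "expands \<zeta> s (\<lambda>m. l (\<rho> m)) (\<lambda>z. l (r z))"
      by (rule expands_cdual[OF l r])
    ultimately have "m0 \<in> X" unfolding X_def using m0 m0' by blast
    then show False using m0 \<rho> l.zero by simp
  qed
  then have rho0: "\<rho> m = 0" for m
    using cdual_separates[of "\<rho> m"] by blast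
  have r0: "r (\<zeta> + z) = 0" if z: "z \<in> pdisc s" for z
  proof -
    have "(\<lambda>m. mon m z *\<^sub>C \<rho> m) sums r (\<zeta> + z)" using r z unfolding expands_def by blast
    then have "(\<lambda>m. 0) sums r (\<zeta> + z)" by (simp only: rho0 scaleC.zero_right)
    then show ?thesis using sums_zero sums_unique2 by blast
  qed
  obtain xs where xs: "set xs = D" "distinct xs" using finite_distinct_list[OF D(1)] by blast
  have "\<forall>\<^sub>F z in nhds \<zeta>. f z = (\<Sum>(g, q)\<leftarrow>map (\<lambda>e. (G e, q e)) xs. g z *\<^sub>C q z)"
    using ev eventually_opdisc[of \<zeta> s]
  proof eventually_elim
    case (elim z)
    then have "r z = 0" using r0[of "z - \<zeta>"] opdisc_subset by auto
    with elim show ?case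
      using xs by (simp add: o_def sum_list_distinct_conv_sum_set)
  qed
  then show thesis
    by (rule that[rotated]) (use xs GI q in auto)
qed

section \<open>Division by a module of tuples and free hulls\<close>

text \<open>Tuples are indexed by all of nat but only their first \<open>k\<close> entries count:
  the last clause leaves the others arbitrary and allows the first \<open>k\<close> to change away
  from \<open>\<zeta>\<close>.\<close>

definition germ_submodule ::
    "complex ^ 'n \<Rightarrow> nat \<Rightarrow> (nat \<Rightarrow> complex ^ 'n \<Rightarrow> complex) set \<Rightarrow> bool" where
  "germ_submodule \<zeta> k N \<longleftrightarrow> (\<forall>c\<in>N. \<forall>i<k. hol_at \<zeta> (c i)) \<and> (\<lambda>i z. 0) \<in> N \<and>
     (\<forall>c\<in>N. \<forall>d\<in>N. (\<lambda>i z. c i z + d i z) \<in> N) \<and>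
     (\<forall>c\<in>N. \<forall>h. hol_at \<zeta> h \<longrightarrow> (\<lambda>i z. h z * c i z) \<in> N) \<and>
     (\<forall>c\<in>N. \<forall>d. (\<forall>i<k. \<forall>\<^sub>F z in nhds \<zeta>. c i z = d i z) \<longrightarrow> d \<in> N)"

lemma
  assumes "germ_submodule \<zeta> k N"
  shows germ_submodule_hol: "c \<in> N \<Longrightarrow> i < k \<Longrightarrow> hol_at \<zeta> (c i)"
    and germ_submodule_zero: "(\<lambda>i z. 0) \<in> N"
    and germ_submodule_add: "c \<in> N \<Longrightarrow> d \<in> N \<Longrightarrow> (\<lambda>i z. c i z + d i z) \<in> N"
    and germ_submodule_mult: "c \<in> N \<Longrightarrow> hol_at \<zeta> h \<Longrightarrow> (\<lambda>i z. h z * c i z) \<in> N"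
    and germ_submodule_transform: "c \<in> N \<Longrightarrow> (\<And>i. i < k \<Longrightarrow> \<forall>\<^sub>F z in nhds \<zeta>. c i z = d i z) \<Longrightarrow> d \<in> N"
  using assms unfolding germ_submodule_def by blast+

lemma germ_submodule_sum_list:
  assumes "germ_submodule \<zeta> k N" "\<And>a q. (a, q) \<in> set L \<Longrightarrow> a \<in> N \<and> hol_at \<zeta> (h q)"
  shows "(\<lambda>i z. \<Sum>(a, q)\<leftarrow>L. h q z * a i z) \<in> N"
  using assms(2)
proof (induction L)
  case (Cons p L)
  obtain a q where p: "p = (a, q)" by fastforce
  have "(\<lambda>i z. h q z * a i z + (\<Sum>(a, q)\<leftarrow>L. h q z * a i z)) \<in> N"
    using Cons p by (intro germ_submodule_add[OF assms(1)] germ_submodule_mult[OF assms(1)]) auto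
  then show ?case by (simp add: p)
qed (simp add: germ_submodule_zero[OF assms(1)])

lemma hol_at_sum_list:
  assumes "\<And>x. x \<in> set L \<Longrightarrow> hol_at \<zeta> (g x)"
  shows "hol_at \<zeta> (\<lambda>z. \<Sum>x\<leftarrow>L. g x z)"
  using assms by (induction L) (auto intro: hol_at_const hol_at_add)

lemma cdual_sum_list:
  "cdual l \<Longrightarrow> l (\<Sum>(a, q)\<leftarrow>L. a i z *\<^sub>C q z) = (\<Sum>(a, q)\<leftarrow>L. l (q z) * a i z)"
  by (induction L) (auto simp: cdual_scaleC linear_simps[OF cdual_bounded_linear] mult.commute)

text \<open>Induction on the length. The last entries of members of \<open>N\<close> form an ideal,
  by which \<open>f k\<close> is divided. Lifting the divisors to members of \<open>N\<close> and
  subtracting the resulting combination leaves a tuple whose last entry vanishes near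
  \<open>\<zeta>\<close>, and the induction hypothesis applies to it with the kernel of the last
  projection.\<close>

theorem module_division:
  fixes f :: "nat \<Rightarrow> complex ^ 'n::finite \<Rightarrow> 'e::complex_banach"
  assumes "germ_submodule \<zeta> k N" "\<And>i. i < k \<Longrightarrow> hol_at \<zeta> (f i)"
    "\<And>l. cdual l \<Longrightarrow> (\<lambda>i z. l (f i z)) \<in> N"
  shows "\<exists>L. (\<forall>(a, q)\<in>set L. a \<in> N \<and> hol_at \<zeta> q) \<and>
    (\<forall>i<k. \<forall>\<^sub>F z in nhds \<zeta>. f i z = (\<Sum>(a, q)\<leftarrow>L. a i z *\<^sub>C q z))"
  using assms
proof (induction k arbitrary: N f)
  case 0
  show ?case by (intro exI[of _ "[]"]) simp
next
  case (Suc k)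
  note N = Suc.prems(1)
  define I where "I = (\<lambda>c. c k) ` N"
  have "hol_at \<zeta> g" if "g \<in> I" for g
    using germ_submodule_hol[OF N] that by (auto simp: I_def)
  moreover have "(\<lambda>z. 0) \<in> I"
    unfolding I_def using germ_submodule_zero[OF N] by (rule rev_image_eqI) simp
  moreover have "(\<lambda>z. g z + h z) \<in> I" if gh: "g \<in> I" "h \<in> I" for g h
  proof -
    obtain c d where "c \<in> N" "g = c k" "d \<in> N" "h = d k" using gh by (auto simp: I_def)
    then show ?thesis
      unfolding I_def by (intro rev_image_eqI[OF germ_submodule_add[OF N, of c d]]) auto
  qed
  moreover have "(\<lambda>z. h z * g z) \<in> I" if gh: "g \<in> I" "hol_at \<zeta> h" for g h
  proof -
    obtain c where "c \<in> N" "g = c k" using gh by (auto simp: I_def)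
    then show ?thesis
      unfolding I_def using gh(2) by (intro rev_image_eqI[OF germ_submodule_mult[OF N, of c h]]) auto
  qed
  moreover have "h \<in> I" if gh: "g \<in> I" "\<forall>\<^sub>F z in nhds \<zeta>. g z = h z" for g h
  proof -
    obtain c where c: "c \<in> N" "g = c k" using gh by (auto simp: I_def)
    have "c(k := h) \<in> N" by (rule germ_submodule_transform[OF N c(1)]) (use c gh in auto)
    then show ?thesis unfolding I_def by (rule rev_image_eqI) simp
  qed
  ultimately have gI: "germ_ideal \<zeta> I" unfolding germ_ideal_def by blast
  have lI: "(\<lambda>z. l (f k z)) \<in> I" if "cdual l" for l
    unfolding I_def using Suc.prems(3)[OF that] by (rule rev_image_eqI) simp
  obtain L0 where L0: "\<And>g q. (g, q) \<in> set L0 \<Longrightarrow> g \<in> I \<and> hol_at \<zeta> q"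
    "\<forall>\<^sub>F z in nhds \<zeta>. f k z = (\<Sum>(g, q)\<leftarrow>L0. g z *\<^sub>C q z)"
    by (rule ideal_division[OF gI Suc.prems(2)[OF lessI] lI]) (assumption | rule that)+
  define lift where "lift g = (SOME c. c \<in> N \<and> c k = g)" for g
  have lift: "lift g \<in> N" "lift g k = g" if "g \<in> I" for g
    using someI_ex[of "\<lambda>c. c \<in> N \<and> c k = g"] that by (auto simp: lift_def I_def)
  define L1 where "L1 = map (\<lambda>(g, q). (lift g, q)) L0"
  have L1: "a \<in> N \<and> hol_at \<zeta> q" if "(a, q) \<in> set L1" for a q
    using that L0(1) lift(1) by (auto simp: L1_def)
  have L1k: "\<forall>\<^sub>F z in nhds \<zeta>. f k z = (\<Sum>(a, q)\<leftarrow>L1. a k z *\<^sub>C q z)"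
  proof -
    have "(\<Sum>(a, q)\<leftarrow>L1. a k z *\<^sub>C q z) = (\<Sum>(g, q)\<leftarrow>L0. g z *\<^sub>C q z)" for z
      unfolding L1_def map_map o_def
      by (rule arg_cong[where f = sum_list], rule map_cong[OF refl]) (use L0(1) lift(2) in auto)
    then show ?thesis using L0(2) by simp
  qed
  define f' where "f' i z = f i z - (\<Sum>(a, q)\<leftarrow>L1. a i z *\<^sub>C q z)" for i z
  \<comment> \<open>The kernel of the last projection as a module of shorter tuples: an entry 0 is
    put in position \<open>k\<close>, whatever stood there.\<close>
  define N' where "N' = {c. c(k := \<lambda>z. 0) \<in> N}"
  have fun_upd_add: "(\<lambda>i z. c i z + d i z)(k := \<lambda>z. 0) = (\<lambda>i z. (c(k := \<lambda>z. 0)) i z + (d(k := \<lambda>z. 0)) i z)"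
    for c d :: "nat \<Rightarrow> complex ^ 'n \<Rightarrow> complex" by (simp add: fun_eq_iff)
  have fun_upd_mult: "(\<lambda>i z. h z * c i z)(k := \<lambda>z. 0) = (\<lambda>i z. h z * (c(k := \<lambda>z. 0)) i z)"
    for h and c :: "nat \<Rightarrow> complex ^ 'n \<Rightarrow> complex" by (simp add: fun_eq_iff)
  have "germ_submodule \<zeta> k N'"
    unfolding germ_submodule_def
  proof (intro conjI ballI allI impI)
    show "hol_at \<zeta> (c i)" if "c \<in> N'" "i < k" for c i
      using germ_submodule_hol[OF N, of "c(k := \<lambda>z. 0)" i] that by (simp add: N'_def)
    show "(\<lambda>i z. 0) \<in> N'" using germ_submodule_zero[OF N] by (simp add: N'_def fun_upd_idem)
    show "(\<lambda>i z. c i z + d i z) \<in> N'" if "c \<in> N'" "d \<in> N'" for c d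
      using germ_submodule_add[OF N] that unfolding N'_def mem_Collect_eq fun_upd_add by blast
    show "(\<lambda>i z. h z * c i z) \<in> N'" if "c \<in> N'" "hol_at \<zeta> h" for c h
      using germ_submodule_mult[OF N] that unfolding N'_def mem_Collect_eq fun_upd_mult by blast
    show "d \<in> N'" if "c \<in> N'" "\<forall>i<k. \<forall>\<^sub>F z in nhds \<zeta>. c i z = d i z" for c d
      unfolding N'_def mem_Collect_eq
      by (rule germ_submodule_transform[OF N, of "c(k := \<lambda>z. 0)"]) (use that in \<open>auto simp: N'_def less_Suc_eq\<close>)
  qed
  moreover have "hol_at \<zeta> (f' i)" if "i < k" for i
    unfolding f'_def[abs_def]
  proof (intro hol_at_diff Suc.prems(2) hol_at_sum_list)
    show "hol_at \<zeta> (\<lambda>z. case x of (a, q) \<Rightarrow> a i z *\<^sub>C q z)" if "x \<in> set L1" for x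
      using L1 that germ_submodule_hol[OF N] \<open>i < k\<close> by (cases x) (auto intro!: hol_at_scaleC)
  qed (use that in simp)
  moreover have "(\<lambda>i z. l (f' i z)) \<in> N'" if l: "cdual l" for l
  proof -
    interpret l: bounded_linear l by (rule cdual_bounded_linear[OF l])
    have "(\<lambda>i z. \<Sum>(a, q)\<leftarrow>L1. l (q z) * a i z) \<in> N"
      by (rule germ_submodule_sum_list[OF N, of L1 "\<lambda>q z. l (q z)"]) (auto dest: L1 intro: hol_at_cdual[OF l])
    then have "(\<lambda>i z. l (f i z) + (-1) * (\<Sum>(a, q)\<leftarrow>L1. l (q z) * a i z)) \<in> N"
      by (intro germ_submodule_add[OF N Suc.prems(3)[OF l]] germ_submodule_mult[OF N, where h = "\<lambda>z. -1"] hol_at_const)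
    then have "(\<lambda>i z. l (f' i z)) \<in> N"
      by (simp add: f'_def l.diff cdual_sum_list[OF l])
    then show ?thesis
      unfolding N'_def mem_Collect_eq
    \<comment> \<open>The last entry vanishes only as a germ; overwriting it by the constant 0 stays
      within \<open>N\<close>.\<close>
    proof (rule germ_submodule_transform[OF N])
      fix i assume "i < Suc k"
      show "\<forall>\<^sub>F z in nhds \<zeta>. l (f' i z) = ((\<lambda>i z. l (f' i z))(k := \<lambda>z. 0)) i z"
      proof (cases "i = k")
        case True
        show ?thesis using L1k by eventually_elim (simp add: True f'_def l.zero)
      qed simp
    qed
  qed
  ultimately obtain L2 where L2: "\<forall>(a, q)\<in>set L2. a \<in> N' \<and> hol_at \<zeta> q"
    "\<forall>i<k. \<forall>\<^sub>F z in nhds \<zeta>. f' i z = (\<Sum>(a, q)\<leftarrow>L2. a i z *\<^sub>C q z)"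
    using Suc.IH[of N' f'] by blast
  define L where "L = L1 @ map (\<lambda>(a, q). (a(k := \<lambda>z. 0), q)) L2"
  have "a \<in> N \<and> hol_at \<zeta> q" if "(a, q) \<in> set L" for a q
    using that L1 L2(1) by (auto simp: L_def N'_def)
  moreover have "\<forall>\<^sub>F z in nhds \<zeta>. f i z = (\<Sum>(a, q)\<leftarrow>L. a i z *\<^sub>C q z)" if "i < Suc k" for i
  proof (cases "i = k")
    case True
    have "(\<Sum>(a, q)\<leftarrow>map (\<lambda>(a, q). (a(k := \<lambda>z. 0), q)) L2. a k z *\<^sub>C q z) = 0" for z
      by (induction L2) auto
    then show ?thesis using L1k True by (simp add: L_def)
  next
    case False
    then have "i < k" using that by simp
    have eq: "(\<Sum>(a, q)\<leftarrow>map (\<lambda>(a, q). (a(k := \<lambda>z. 0), q)) L2. a i z *\<^sub>C q z) = (\<Sum>(a, q)\<leftarrow>L2. a i z *\<^sub>C q z)" for z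
      using False by (induction L2) auto
    have "\<forall>\<^sub>F z in nhds \<zeta>. f' i z = (\<Sum>(a, q)\<leftarrow>L2. a i z *\<^sub>C q z)" using L2(2) \<open>i < k\<close> by blast
    then show ?thesis
      unfolding L_def map_append sum_list_append eq by eventually_elim (simp add: f'_def algebra_simps)
  qed
  ultimately show ?case by (intro exI[of _ L]) auto
qed

text \<open>The span, over the scalar germs, of the tuples (l(f_0), ..., l(f_{k-1})) with l in the
  dual. Each member arises from \<open>f\<close> by a finite combination of functionals with
  holomorphic coefficients, and \<open>free_hull\<close> applies the same combination to other
  germs.\<close>

definition row_module ::
    "complex ^ 'n \<Rightarrow> nat \<Rightarrow> (nat \<Rightarrow> complex ^ 'n \<Rightarrow> 'e::complex_banach) \<Rightarrow> (nat \<Rightarrow> complex ^ 'n \<Rightarrow> complex) set" where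
  "row_module \<zeta> k f = {c. (\<forall>i<k. hol_at \<zeta> (c i)) \<and>
     (\<exists>L. (\<forall>(h, l)\<in>set L. hol_at \<zeta> h \<and> cdual l) \<and>
       (\<forall>i<k. \<forall>\<^sub>F z in nhds \<zeta>. c i z = (\<Sum>(h, l)\<leftarrow>L. h z * l (f i z))))}"

lemma germ_submodule_row_module: "germ_submodule \<zeta> k (row_module \<zeta> k f)"
  unfolding germ_submodule_def
proof (intro conjI ballI allI impI)
  show "hol_at \<zeta> (c i)" if "c \<in> row_module \<zeta> k f" "i < k" for c i
    using that by (simp add: row_module_def)
  show "(\<lambda>i z. 0) \<in> row_module \<zeta> k f"
    by (auto simp: row_module_def hol_at_const intro!: exI[of _ "[]"])
  show "(\<lambda>i z. c i z + d i z) \<in> row_module \<zeta> k f" if cd: "c \<in> row_module \<zeta> k f" "d \<in> row_module \<zeta> k f" for c d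
  proof -
    obtain L where L: "\<forall>(h, l)\<in>set L. hol_at \<zeta> h \<and> cdual l"
      "\<forall>i<k. \<forall>\<^sub>F z in nhds \<zeta>. c i z = (\<Sum>(h, l)\<leftarrow>L. h z * l (f i z))"
      using cd(1) by (auto simp: row_module_def)
    obtain M where M: "\<forall>(h, l)\<in>set M. hol_at \<zeta> h \<and> cdual l"
      "\<forall>i<k. \<forall>\<^sub>F z in nhds \<zeta>. d i z = (\<Sum>(h, l)\<leftarrow>M. h z * l (f i z))"
      using cd(2) by (auto simp: row_module_def)
    have "\<forall>\<^sub>F z in nhds \<zeta>. c i z + d i z = (\<Sum>(h, l)\<leftarrow>L @ M. h z * l (f i z))" if "i < k" for i
    proof -
      have "\<forall>\<^sub>F z in nhds \<zeta>. c i z = (\<Sum>(h, l)\<leftarrow>L. h z * l (f i z))"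
        "\<forall>\<^sub>F z in nhds \<zeta>. d i z = (\<Sum>(h, l)\<leftarrow>M. h z * l (f i z))" using L M that by blast+
      then show ?thesis by eventually_elim simp
    qed
    moreover have "\<forall>(h, l)\<in>set (L @ M). hol_at \<zeta> h \<and> cdual l" using L M by auto
    moreover have "\<forall>i<k. hol_at \<zeta> (\<lambda>z. c i z + d i z)" using cd by (auto simp: row_module_def intro: hol_at_add)
    ultimately show ?thesis unfolding row_module_def mem_Collect_eq by blast
  qed
  show "(\<lambda>i z. g z * c i z) \<in> row_module \<zeta> k f" if c: "c \<in> row_module \<zeta> k f" and g: "hol_at \<zeta> g" for c g
  proof -
    obtain L where L: "\<forall>(h, l)\<in>set L. hol_at \<zeta> h \<and> cdual l"
      "\<forall>i<k. \<forall>\<^sub>F z in nhds \<zeta>. c i z = (\<Sum>(h, l)\<leftarrow>L. h z * l (f i z))"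
      using c by (auto simp: row_module_def)
    let ?M = "map (\<lambda>(h, l). (\<lambda>z. g z * h z, l)) L"
    have eq: "(\<Sum>(h, l)\<leftarrow>?M. h z * l (f i z)) = g z * (\<Sum>(h, l)\<leftarrow>L. h z * l (f i z))" for i z
      by (induction L) (auto simp: algebra_simps)
    have "\<forall>\<^sub>F z in nhds \<zeta>. g z * c i z = (\<Sum>(h, l)\<leftarrow>?M. h z * l (f i z))" if "i < k" for i
    proof -
      have "\<forall>\<^sub>F z in nhds \<zeta>. c i z = (\<Sum>(h, l)\<leftarrow>L. h z * l (f i z))" using L that by blast
      then show ?thesis unfolding eq by eventually_elim simp
    qed
    moreover have "\<forall>(h, l)\<in>set ?M. hol_at \<zeta> h \<and> cdual l" using L g by (auto intro: hol_at_mult)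
    moreover have "\<forall>i<k. hol_at \<zeta> (\<lambda>z. g z * c i z)" using c g by (auto simp: row_module_def intro: hol_at_mult)
    ultimately show ?thesis unfolding row_module_def mem_Collect_eq by blast
  qed
  show "d \<in> row_module \<zeta> k f" if c: "c \<in> row_module \<zeta> k f" and cd: "\<forall>i<k. \<forall>\<^sub>F z in nhds \<zeta>. c i z = d i z" for c d
  proof -
    obtain L where L: "\<forall>(h, l)\<in>set L. hol_at \<zeta> h \<and> cdual l"
      "\<forall>i<k. \<forall>\<^sub>F z in nhds \<zeta>. c i z = (\<Sum>(h, l)\<leftarrow>L. h z * l (f i z))"
      using c by (auto simp: row_module_def)
    have "\<forall>\<^sub>F z in nhds \<zeta>. d i z = (\<Sum>(h, l)\<leftarrow>L. h z * l (f i z))" if "i < k" for i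
    proof -
      have "\<forall>\<^sub>F z in nhds \<zeta>. c i z = (\<Sum>(h, l)\<leftarrow>L. h z * l (f i z))" "\<forall>\<^sub>F z in nhds \<zeta>. c i z = d i z"
        using L cd that by blast+
      then show ?thesis by eventually_elim simp
    qed
    moreover have "\<forall>i<k. hol_at \<zeta> (d i)"
      using c cd hol_at_transform by (fastforce simp: row_module_def)
    ultimately show ?thesis using L(1) unfolding row_module_def mem_Collect_eq by blast
  qed
qed

lemma cdual_in_row_module:
  assumes "\<And>i. i < k \<Longrightarrow> hol_at \<zeta> (f i)" "cdual l"
  shows "(\<lambda>i z. l (f i z)) \<in> row_module \<zeta> k f"
  unfolding row_module_def mem_Collect_eq
  by (intro conjI allI impI exI[of _ "[(\<lambda>z. 1, l)]"] hol_at_cdual[OF assms(2)] assms(1))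
    (simp_all add: hol_at_const assms(2))

text \<open>With the bound 1 / (2 m) on each of the m entries of a row, the matrix differs from the
  identity by at most 1/2 in the maximum norm. In the row of an entry of \<open>t\<close> of largest
  modulus, this forces that modulus to be 0.\<close>

lemma near_identity_kernel:
  fixes B :: "nat \<Rightarrow> nat \<Rightarrow> complex"
  assumes B: "\<And>j p. j < m \<Longrightarrow> p < m \<Longrightarrow> norm ((if p = j then 1 else 0) - B j p) < 1 / (2 * real m)"
    and t: "\<And>j. j < m \<Longrightarrow> (\<Sum>p<m. t p * B j p) = 0" and "j < m"
  shows "t j = 0"
proof -
  define M where "M = Max ((\<lambda>p. norm (t p)) ` {..<m})"
  have le: "norm (t p) \<le> M" if "p < m" for p unfolding M_def using that by (intro Max_ge) auto
  have "M \<in> (\<lambda>p. norm (t p)) ` {..<m}" unfolding M_def using \<open>j < m\<close> by (intro Max_in) auto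
  then obtain p0 where p0: "p0 < m" "M = norm (t p0)" by auto
  have "t p0 = (\<Sum>p<m. t p * (if p = p0 then 1 else 0)) - (\<Sum>p<m. t p * B p0 p)"
    using p0 t by (simp add: sum.delta if_distrib cong: if_cong)
  also have "\<dots> = (\<Sum>p<m. t p * ((if p = p0 then 1 else 0) - B p0 p))"
    by (simp add: sum_subtractf right_diff_distrib)
  finally have "M \<le> (\<Sum>p<m. norm (t p * ((if p = p0 then 1 else 0) - B p0 p)))"
    using p0(2) by (metis (no_types) norm_sum)
  also have "\<dots> \<le> (\<Sum>p<m. M * (1 / (2 * real m)))"
    unfolding norm_mult by (intro sum_mono mult_mono le less_imp_le[OF B] p0(1)) (auto simp: p0(2))
  also have "\<dots> = M / 2" using \<open>j < m\<close> by simp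
  finally have "M \<le> 0" by simp
  then show ?thesis using le[OF \<open>j < m\<close>] by (meson norm_le_zero_iff order_trans)
qed

text \<open>Expand \<open>f\<close> along elements \<open>a j\<close> of its row module with as few terms as possible. Each \<open>a j\<close> is
  in turn a combination of the \<open>a p\<close>, with coefficients obtained by applying functionals to the \<open>q p\<close>.
  By minimality, the matrix of these coefficients is the identity at \<open>\<zeta>\<close>, so that the \<open>q p\<close> are
  linearly independent near \<open>\<zeta>\<close>.\<close>

theorem free_hull:
  fixes f :: "nat \<Rightarrow> complex ^ 'n::finite \<Rightarrow> 'e::complex_banach"
  assumes f: "\<And>i. i < k \<Longrightarrow> hol_at \<zeta> (f i)"
  obtains m :: nat and a q where "\<And>i j. i < k \<Longrightarrow> j < m \<Longrightarrow> hol_at \<zeta> (a j i)" "\<And>j. j < m \<Longrightarrow> hol_at \<zeta> (q j)"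
    "\<And>i. i < k \<Longrightarrow> \<forall>\<^sub>F z in nhds \<zeta>. f i z = (\<Sum>j<m. a j i z *\<^sub>C q j z)"
    "\<forall>\<^sub>F z in nhds \<zeta>. \<forall>t. (\<Sum>j<m. t j *\<^sub>C q j z) = 0 \<longrightarrow> (\<forall>j<m. t j = 0)"
proof -
  let ?N = "row_module \<zeta> k f"
  note N = germ_submodule_row_module[of \<zeta> k f]
  define P where "P L \<longleftrightarrow> (\<forall>(a, q)\<in>set L. a \<in> ?N \<and> hol_at \<zeta> q) \<and>
    (\<forall>i<k. \<forall>\<^sub>F z in nhds \<zeta>. f i z = (\<Sum>(a, q)\<leftarrow>L. a i z *\<^sub>C q z))" for L
  have "\<exists>L. P L" unfolding P_def
    by (rule module_division[OF N]) (auto intro: f cdual_in_row_module)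
  \<comment> \<open>The least number of terms plays the part of a minimal system of generators in
    Nakayama's lemma.\<close>
  then obtain L where L: "P L" and min: "\<And>L'. P L' \<Longrightarrow> length L \<le> length L'"
    using ex_has_least_nat[of P _ length] by blast
  define m where "m = length L"
  define a where "a j = fst (L ! j)" for j
  define q where "q j = snd (L ! j)" for j
  have aq: "a j \<in> ?N" "hol_at \<zeta> (q j)" if "j < m" for j
    using L that nth_mem[of j L] by (auto simp: P_def a_def q_def m_def split_beta)
  have ah: "hol_at \<zeta> (a j i)" if "j < m" "i < k" for i j
    using germ_submodule_hol[OF N aq(1)[OF that(1)] that(2)] .
  have fs: "\<forall>\<^sub>F z in nhds \<zeta>. f i z = (\<Sum>j<m. a j i z *\<^sub>C q j z)" if "i < k" for i
    using L that by (simp add: P_def a_def q_def m_def split_beta sum_list_sum_nth atLeast0LessThan)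
  have "\<exists>K. (\<forall>(h, l)\<in>set K. hol_at \<zeta> h \<and> cdual l) \<and>
      (\<forall>i<k. \<forall>\<^sub>F z in nhds \<zeta>. a j i z = (\<Sum>(h, l)\<leftarrow>K. h z * l (f i z)))" if "j < m" for j
    using aq(1)[OF that] by (simp add: row_module_def)
  then obtain K where Kh: "\<And>j h l. j < m \<Longrightarrow> (h, l) \<in> set (K j) \<Longrightarrow> hol_at \<zeta> h \<and> cdual l"
    and Ka: "\<And>j i. j < m \<Longrightarrow> i < k \<Longrightarrow> \<forall>\<^sub>F z in nhds \<zeta>. a j i z = (\<Sum>(h, l)\<leftarrow>K j. h z * l (f i z))"
  proof -
    assume "\<And>j. j < m \<Longrightarrow> \<exists>K. (\<forall>(h, l)\<in>set K. hol_at \<zeta> h \<and> cdual l) \<and>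
      (\<forall>i<k. \<forall>\<^sub>F z in nhds \<zeta>. a j i z = (\<Sum>(h, l)\<leftarrow>K. h z * l (f i z)))"
    then have "\<forall>j\<in>{..<m}. \<exists>K. (\<forall>(h, l)\<in>set K. hol_at \<zeta> h \<and> cdual l) \<and>
      (\<forall>i<k. \<forall>\<^sub>F z in nhds \<zeta>. a j i z = (\<Sum>(h, l)\<leftarrow>K. h z * l (f i z)))" by blast
    from bchoice[OF this] obtain K where "\<forall>j\<in>{..<m}. (\<forall>(h, l)\<in>set (K j). hol_at \<zeta> h \<and> cdual l) \<and>
      (\<forall>i<k. \<forall>\<^sub>F z in nhds \<zeta>. a j i z = (\<Sum>(h, l)\<leftarrow>K j. h z * l (f i z)))" by blast
    then show thesis by (intro that[of K]) blast+
  qed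
  \<comment> \<open>The combination of functionals that produces \<open>a j\<close> from
    \<open>f\<close>; for fixed z a linear form on E. Applied to the expansion of \<open>f\<close>
    it shows that \<open>a j\<close> is the sum of the \<open>a p\<close> with coefficients
    \<open>B j p\<close>, its values at the \<open>q p\<close>.\<close>
  define lam where "lam j z x = (\<Sum>(h, l)\<leftarrow>K j. h z * l x)" for j z x
  define B where "B j p z = lam j z (q p z)" for j p z
  have lam_sum: "lam j z (\<Sum>p<m. t p *\<^sub>C x p) = (\<Sum>p<m. t p * lam j z (x p))" if "j < m" for j z t x
  proof -
    have "(\<Sum>(h, l)\<leftarrow>M. h z * l (\<Sum>p<m. t p *\<^sub>C x p)) = (\<Sum>p<m. t p * (\<Sum>(h, l)\<leftarrow>M. h z * l (x p)))"
      if "\<forall>(h, l)\<in>set M. cdual l" for M :: "((complex ^ 'n \<Rightarrow> complex) \<times> ('e \<Rightarrow> complex)) list"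
      using that
    proof (induction M)
      case (Cons p M)
      obtain h l where p: "p = (h, l)" by fastforce
      then have l: "cdual l" using Cons.prems by simp
      have "l (\<Sum>p<m. t p *\<^sub>C x p) = (\<Sum>p<m. t p * l (x p))"
        by (simp add: linear_sum[OF bounded_linear.linear[OF cdual_bounded_linear[OF l]]] cdual_scaleC[OF l])
      then show ?case using Cons by (simp add: p algebra_simps sum.distrib sum_distrib_left)
    qed simp
    then show ?thesis unfolding lam_def using Kh[OF that] by blast
  qed
  have Bh: "hol_at \<zeta> (B j p)" if "j < m" "p < m" for j p
    unfolding B_def[abs_def] lam_def
  proof (rule hol_at_sum_list)
    fix x assume x: "x \<in> set (K j)"
    obtain h l where hl: "x = (h, l)" by fastforce
    have "hol_at \<zeta> (\<lambda>z. h z * l (q p z))"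
      using Kh[OF that(1), of h l] x hl hol_at_mult[OF _ hol_at_cdual[OF _ aq(2)[OF that(2)]], of h l]
      by simp
    then show "hol_at \<zeta> (\<lambda>z. case x of (h, l) \<Rightarrow> h z * l (q p z))" by (simp add: hl)
  qed
  have aB: "\<forall>\<^sub>F z in nhds \<zeta>. a j i z = (\<Sum>p<m. a p i z * B j p z)" if "j < m" "i < k" for i j
    using Ka[OF that] fs[OF that(2)]
  proof eventually_elim
    case (elim z)
    have "a j i z = lam j z (\<Sum>p<m. a p i z *\<^sub>C q p z)"
      using elim by (simp add: lam_def)
    then show ?case by (simp add: lam_sum[OF that(1)] B_def)
  qed
  have Bid: "B j p \<zeta> = (if p = j then 1 else 0)" if jp: "j < m" "p < m" for j p
  proof (rule ccontr)
    assume ne: "B j p \<zeta> \<noteq> (if p = j then 1 else 0)"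
    \<comment> \<open>Row \<open>j\<close> of the identity minus \<open>B\<close>, which annihilates
      the tuples \<open>a p\<close>. If its entry at \<open>p\<close> is nonzero at
      \<open>\<zeta>\<close>, that entry is a unit, so \<open>a p\<close> can be eliminated and a
      shorter expansion results.\<close>
    define R where "R p' z = (if p' = j then 1 else 0) - B j p' z" for p' z
    have Rh: "hol_at \<zeta> (R p')" if "p' < m" for p'
      unfolding R_def[abs_def] by (intro hol_at_diff hol_at_const Bh jp that)
    have Rp: "R p \<zeta> \<noteq> 0" using ne by (simp add: R_def)
    define v where "v p' z = - (inverse (R p z) * R p' z)" for p' z
    have vh: "hol_at \<zeta> (v p')" if "p' < m" for p'
      unfolding v_def[abs_def] by (intro hol_at_minus hol_at_mult hol_at_inverse Rh jp that Rp)
    have "\<forall>\<^sub>F z in nhds \<zeta>. R p z \<noteq> 0"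
      using hol_at_isCont[OF Rh[OF jp(2)]] Rp
      by (metis isCont_def t1_space_nhds tendsto_at_iff_tendsto_nhds tendsto_imp_eventually_ne)
    have red: "\<forall>\<^sub>F z in nhds \<zeta>. f i z = (\<Sum>p'\<in>{..<m} - {p}. a p' i z *\<^sub>C (q p' z + v p' z *\<^sub>C q p z))"
      if i: "i < k" for i
      using aB[OF jp(1) i] fs[OF i] \<open>\<forall>\<^sub>F z in nhds \<zeta>. R p z \<noteq> 0\<close>
    proof eventually_elim
      case (elim z)
      have "(\<Sum>p'<m. a p' i z * R p' z) = a j i z - (\<Sum>p'<m. a p' i z * B j p' z)"
      proof -
        have "(\<Sum>p'<m. a p' i z * (if p' = j then 1 else 0)) = a j i z"
          using jp by (simp add: if_distrib sum.delta cong: if_cong)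
        then show ?thesis by (simp only: R_def right_diff_distrib sum_subtractf)
      qed
      then have "(\<Sum>p'<m. a p' i z * R p' z) = 0" using elim by simp
      then have "a p i z * R p z + (\<Sum>p'\<in>{..<m} - {p}. a p' i z * R p' z) = 0"
        using jp by (simp add: sum.remove[of _ p])
      then have "a p i z = inverse (R p z) * - (\<Sum>p'\<in>{..<m} - {p}. a p' i z * R p' z)"
        using elim(3) by (simp add: field_simps eq_neg_iff_add_eq_0)
      also have "\<dots> = (\<Sum>p'\<in>{..<m} - {p}. a p' i z * v p' z)"
        by (simp add: v_def sum_negf sum_distrib_left mult_ac)
      finally have ap: "a p i z = (\<Sum>p'\<in>{..<m} - {p}. a p' i z * v p' z)" .
      have "f i z = a p i z *\<^sub>C q p z + (\<Sum>p'\<in>{..<m} - {p}. a p' i z *\<^sub>C q p' z)"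
        using elim jp by (simp add: sum.remove[of _ p])
      then show ?case
        by (simp add: ap scaleC.sum_left scaleC_add_right scaleC_scaleC sum.distrib add.commute)
    qed
    obtain xs where xs: "set xs = {..<m} - {p}" "distinct xs"
      using finite_distinct_list[of "{..<m} - {p}"] by auto
    define L' where "L' = map (\<lambda>p'. (a p', \<lambda>z. q p' z + v p' z *\<^sub>C q p z)) xs"
    have "P L'"
      unfolding P_def
    proof (intro conjI allI impI)
      show "\<forall>(a, q)\<in>set L'. a \<in> ?N \<and> hol_at \<zeta> q"
        using xs aq jp vh by (auto simp: L'_def intro!: hol_at_add hol_at_scaleC)
      fix i assume "i < k"
      from red[OF this] show "\<forall>\<^sub>F z in nhds \<zeta>. f i z = (\<Sum>(a, q)\<leftarrow>L'. a i z *\<^sub>C q z)"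
        using xs by (simp add: L'_def o_def sum_list_distinct_conv_sum_set)
    qed
    from min[OF this] have "m \<le> card ({..<m} - {p})"
      using xs by (simp add: L'_def m_def distinct_card[symmetric])
    then show False using jp by simp
  qed
  \<comment> \<open>The matrix \<open>B\<close> is the identity at \<open>\<zeta>\<close> and hence
    close to it nearby. Applying the forms \<open>lam j z\<close> to a linear relation among the
    \<open>q p z\<close> gives a vector in the kernel of \<open>B\<close>, so the relation is
    trivial.\<close>
  have "\<forall>\<^sub>F z in nhds \<zeta>. \<forall>j\<in>{..<m}. \<forall>p\<in>{..<m}. norm ((if p = j then 1 else 0) - B j p z) < 1 / (2 * real m)"
  proof (intro eventually_ball_finite finite_lessThan ballI)
    fix j p assume jp: "j \<in> {..<m}" "p \<in> {..<m}"
    have "isCont (\<lambda>z. norm ((if p = j then 1 else 0) - B j p z)) \<zeta>"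
      using hol_at_isCont[OF Bh] jp by (intro continuous_intros) auto
    then have "((\<lambda>z. norm ((if p = j then 1 else 0) - B j p z)) \<longlongrightarrow> norm ((if p = j then 1 else 0) - B j p \<zeta>)) (nhds \<zeta>)"
      unfolding isCont_def by (rule tendsto_at_iff_tendsto_nhds[THEN iffD1])
    moreover have "norm ((if p = j then 1 else 0) - B j p \<zeta>) = 0" using Bid jp by simp
    ultimately have "((\<lambda>z. norm ((if p = j then 1 else 0) - B j p z)) \<longlongrightarrow> 0) (nhds \<zeta>)" by simp
    then show "\<forall>\<^sub>F z in nhds \<zeta>. norm ((if p = j then 1 else 0) - B j p z) < 1 / (2 * real m)"
      by (rule order_tendstoD(2)) (use jp in simp)
  qed
  then have "\<forall>\<^sub>F z in nhds \<zeta>. \<forall>t. (\<Sum>j<m. t j *\<^sub>C q j z) = 0 \<longrightarrow> (\<forall>j<m. t j = 0)"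
  proof eventually_elim
    case (elim z)
    show ?case
    proof (intro allI impI)
      fix t j assume t: "(\<Sum>j<m. t j *\<^sub>C q j z) = 0" and j: "j < m"
      have "(\<Sum>p<m. t p * B i p z) = 0" if "i < m" for i
        using lam_sum[OF that, of z t "\<lambda>p. q p z"] lam_sum[OF that, of z "\<lambda>p. 0" "\<lambda>p. q p z"] t
        by (simp add: B_def)
      then show "t j = 0"
        using near_identity_kernel[of m "\<lambda>j p. B j p z" t j] elim j by blast
    qed
  qed
  then show thesis using that[of m a q] ah aq(2) fs by blast
qed

section \<open>Plain sheaves\<close>

lemma cdiff_restrict_iff:
  assumes "open U" "z \<in> U"
  shows "cdiff (restrict f U) z \<longleftrightarrow> cdiff f z"
proof -
  have ev: "\<forall>\<^sub>F w in nhds z. restrict f U w = f w"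
    using eventually_nhds_in_open[OF assms] by eventually_elim simp
  then have "\<forall>\<^sub>F w in nhds z. f w = restrict f U w" by eventually_elim simp
  with ev show ?thesis by (blast intro: cdiff_transform)
qed

definition hol_sections :: "(complex ^ 'n) set \<Rightarrow> (complex ^ 'n \<Rightarrow> 'e::complex_banach) set" where
  "hol_sections U = {f \<in> extensional U. holomorphic_map_on f U}"

lemma hol_sections_cdiff: "f \<in> hol_sections U \<Longrightarrow> z \<in> U \<Longrightarrow> cdiff f z"
  by (simp add: hol_sections_def holomorphic_map_on_iff)

lemma hol_sections_eqI: "f \<in> hol_sections U \<Longrightarrow> g \<in> hol_sections U \<Longrightarrow> (\<And>z. z \<in> U \<Longrightarrow> f z = g z) \<Longrightarrow> f = g"
  by (auto simp: hol_sections_def intro: extensionalityI)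

lemma restrict_in_hol_sections:
  assumes "open U" "\<And>z. z \<in> U \<Longrightarrow> cdiff f z"
  shows "restrict f U \<in> hol_sections U"
  using assms by (simp add: hol_sections_def holomorphic_map_on_iff cdiff_restrict_iff)

lemma hol_ring_simps [simp]:
  "carrier (hol_ring U) = hol_sections U"
  "\<zero>\<^bsub>hol_ring U\<^esub> = (\<lambda>z\<in>U. 0)" "\<one>\<^bsub>hol_ring U\<^esub> = (\<lambda>z\<in>U. 1)"
  "f \<oplus>\<^bsub>hol_ring U\<^esub> g = (\<lambda>z\<in>U. f z + g z)" "f \<otimes>\<^bsub>hol_ring U\<^esub> g = (\<lambda>z\<in>U. f z * g z)"
  by (simp_all add: hol_ring_def hol_sections_def)

lemma plain_sheaf_simps [simp]:
  "carrier (sec plain_sheaf U) = hol_sections U"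
  "\<zero>\<^bsub>sec plain_sheaf U\<^esub> = (\<lambda>z\<in>U. 0)"
  "f \<oplus>\<^bsub>sec plain_sheaf U\<^esub> g = (\<lambda>z\<in>U. f z + g z)"
  "c \<odot>\<^bsub>sec plain_sheaf U\<^esub> f = (\<lambda>z\<in>U. c z *\<^sub>C f z)"
  "res plain_sheaf U V f = restrict f V"
  by (simp_all add: plain_sheaf_def hol_sections_def)

lemma free_sheaf_simps [simp]:
  "carrier (sec (free_sheaf k) U) = {..<k} \<rightarrow>\<^sub>E hol_sections U"
  "\<zero>\<^bsub>sec (free_sheaf k) U\<^esub> = (\<lambda>i\<in>{..<k}. \<lambda>z\<in>U. 0)"
  "f \<oplus>\<^bsub>sec (free_sheaf k) U\<^esub> g = (\<lambda>i\<in>{..<k}. \<lambda>z\<in>U. f i z + g i z)"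
  "c \<odot>\<^bsub>sec (free_sheaf k) U\<^esub> f = (\<lambda>i\<in>{..<k}. \<lambda>z\<in>U. c z * f i z)"
  "res (free_sheaf k) U V f = (\<lambda>i\<in>{..<k}. restrict (f i) V)"
  by (simp_all add: free_sheaf_def)

lemma subsheaf_simps [simp]:
  "carrier (sec (subsheaf M A) U) = A U"
  "x \<oplus>\<^bsub>sec (subsheaf M A) U\<^esub> y = x \<oplus>\<^bsub>sec M U\<^esub> y"
  "c \<odot>\<^bsub>sec (subsheaf M A) U\<^esub> y = c \<odot>\<^bsub>sec M U\<^esub> y"
  "res (subsheaf M A) = res M"
  by (simp_all add: subsheaf_def)

lemma hol_sections_ops:
  assumes "open U"
  shows hol_sections_const: "(\<lambda>z\<in>U. c) \<in> hol_sections U"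
    and hol_sections_add: "f \<in> hol_sections U \<Longrightarrow> g \<in> hol_sections U \<Longrightarrow> (\<lambda>z\<in>U. f z + g z) \<in> hol_sections U"
    and hol_sections_scaleC: "h \<in> hol_sections U \<Longrightarrow> f \<in> hol_sections U \<Longrightarrow> (\<lambda>z\<in>U. h z *\<^sub>C f z) \<in> hol_sections U"
    and hol_sections_restrict: "V \<subseteq> U \<Longrightarrow> open V \<Longrightarrow> f \<in> hol_sections U \<Longrightarrow> restrict f V \<in> hol_sections V"
  by (auto intro!: restrict_in_hol_sections assms intro: cdiff_const cdiff_add cdiff_scaleC hol_sections_cdiff)

lemma hol_sections_mult:
  fixes h f :: "complex ^ 'n \<Rightarrow> complex"
  assumes "open U" "h \<in> hol_sections U" "f \<in> hol_sections U"
  shows "(\<lambda>z\<in>U. h z * f z) \<in> hol_sections U"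
  using hol_sections_scaleC[OF assms] by (simp add: scaleC_complex_def)

lemma cring_hol_ring:
  assumes "open U"
  shows "cring (hol_ring U)"
proof (rule cringI)
  have neg: "\<exists>g\<in>hol_sections U. (\<lambda>z\<in>U. g z + f z) = (\<lambda>z\<in>U. 0)" if "f \<in> hol_sections U"
    for f :: "complex ^ 'a \<Rightarrow> complex"
    by (rule bexI[of _ "\<lambda>z\<in>U. (-1) * f z"])
      (use hol_sections_mult[OF assms hol_sections_const[OF assms, of "-1"] that] in \<open>simp_all add: restrict_def fun_eq_iff cong: if_cong\<close>)
  show "abelian_group (hol_ring U)"
    by (rule abelian_groupI)
      (simp_all add: hol_sections_const hol_sections_add assms neg,
       auto simp: add_ac hol_sections_def fun_eq_iff extensional_def)
  show "comm_monoid (hol_ring U)"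
    by (rule comm_monoidI)
      (auto simp: hol_sections_const hol_sections_mult assms mult_ac intro!: restrict_ext,
       auto simp: hol_sections_def fun_eq_iff extensional_def)
qed (auto simp: algebra_simps intro!: restrict_ext)

lemma module_plain_sheaf:
  assumes "open U"
  shows "module (hol_ring U) (sec (plain_sheaf :: ('n, complex ^ 'n \<Rightarrow> 'e::complex_banach) mod_presheaf) U)"
proof (rule moduleI[OF cring_hol_ring[OF assms]])
  have neg: "\<exists>g\<in>hol_sections U. (\<lambda>z\<in>U. g z + f z) = (\<lambda>z\<in>U. 0)" if "f \<in> hol_sections U"
    for f :: "complex ^ 'n \<Rightarrow> 'e"
    by (rule bexI[OF _ hol_sections_scaleC[OF assms hol_sections_const[OF assms, of "-1"] that]])
      (auto simp: scaleC.minus_left intro!: restrict_ext)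
  show "abelian_group (sec (plain_sheaf :: ('n, complex ^ 'n \<Rightarrow> 'e) mod_presheaf) U)"
    by (rule abelian_groupI)
      (simp_all add: hol_sections_const hol_sections_add assms neg,
       auto simp: add_ac hol_sections_def fun_eq_iff extensional_def)
qed (auto simp: hol_sections_scaleC assms scaleC_add_left scaleC_add_right scaleC_scaleC intro!: restrict_ext,
     auto simp: hol_sections_def fun_eq_iff extensional_def)

lemma O_presheaf_plain_sheaf: "O_presheaf \<Omega> plain_sheaf"
  by (rule O_presheaf.intro)
    (simp_all add: module_plain_sheaf hol_sections_restrict,
     auto simp: hol_sections_def extensional_def fun_eq_iff restrict_def)

text \<open>Independence is asked at every point of \<open>U\<close>, not just over the ring of
  functions; coordinates with respect to \<open>q\<close> are then determined pointwise.\<close>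

definition frame ::
    "(complex ^ 'n) set \<Rightarrow> nat \<Rightarrow> (nat \<Rightarrow> complex ^ 'n \<Rightarrow> 'e::complex_banach) \<Rightarrow> bool" where
  "frame U m q \<longleftrightarrow> open U \<and> (\<forall>j<m. \<forall>z\<in>U. cdiff (q j) z) \<and>
     (\<forall>z\<in>U. \<forall>t. (\<Sum>j<m. t j *\<^sub>C q j z) = 0 \<longrightarrow> (\<forall>j<m. t j = 0))"

lemma frame_unique:
  assumes "frame U m q" "z \<in> U" "(\<Sum>j<m. t j *\<^sub>C q j z) = (\<Sum>j<m. u j *\<^sub>C q j z)" "j < m"
  shows "t j = u j"
proof -
  have "(\<Sum>j<m. (t j - u j) *\<^sub>C q j z) = 0"
    using assms(3) by (simp add: scaleC.diff_left sum_subtractf)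
  moreover have "\<forall>t. (\<Sum>j<m. t j *\<^sub>C q j z) = 0 \<longrightarrow> (\<forall>j<m. t j = 0)"
    using assms(1,2) by (simp add: frame_def)
  ultimately have "t j - u j = 0" using \<open>j < m\<close> by (auto dest: spec[where x = "\<lambda>j. t j - u j"])
  then show ?thesis by simp
qed

text \<open>Finitely many eventual properties hold together on one open set. Independence is among
  them because \<open>free_hull\<close> gives it at all nearby points.\<close>

lemma local_frame:
  fixes f :: "nat \<Rightarrow> complex ^ 'n::finite \<Rightarrow> 'e::complex_banach"
  assumes "open \<Omega>" "\<zeta> \<in> \<Omega>" "\<And>i. i < k \<Longrightarrow> f i \<in> hol_sections \<Omega>"
  obtains U m a q where "\<zeta> \<in> U" "U \<subseteq> \<Omega>" "frame U m q"
    "\<And>i j z. i < k \<Longrightarrow> j < m \<Longrightarrow> z \<in> U \<Longrightarrow> cdiff (a j i) z"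
    "\<And>i z. i < k \<Longrightarrow> z \<in> U \<Longrightarrow> f i z = (\<Sum>j<m. a j i z *\<^sub>C q j z)"
proof -
  have "hol_at \<zeta> (f i)" if "i < k" for i
    unfolding hol_at_def using eventually_nhds_in_open[OF assms(1,2)]
    by eventually_elim (rule hol_sections_cdiff[OF assms(3)[OF that]])
  then obtain m :: nat and a q where
    a: "\<And>i j. i < k \<Longrightarrow> j < m \<Longrightarrow> hol_at \<zeta> (a j i)" and q: "\<And>j. j < m \<Longrightarrow> hol_at \<zeta> (q j)"
    and f: "\<And>i. i < k \<Longrightarrow> \<forall>\<^sub>F z in nhds \<zeta>. f i z = (\<Sum>j<m. a j i z *\<^sub>C q j z)"
    and ind: "\<forall>\<^sub>F z in nhds \<zeta>. \<forall>t. (\<Sum>j<m. t j *\<^sub>C q j z) = 0 \<longrightarrow> (\<forall>j<m. t j = 0)"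
    by (rule free_hull[of k \<zeta> f]) (assumption | rule that)+
  have "\<forall>\<^sub>F z in nhds \<zeta>. \<forall>i\<in>{..<k}. \<forall>j\<in>{..<m}. cdiff (a j i) z"
    using a by (intro eventually_ball_finite finite_lessThan ballI) (auto simp: hol_at_def)
  moreover have "\<forall>\<^sub>F z in nhds \<zeta>. \<forall>j\<in>{..<m}. cdiff (q j) z"
    using q by (intro eventually_ball_finite finite_lessThan ballI) (auto simp: hol_at_def)
  moreover have "\<forall>\<^sub>F z in nhds \<zeta>. \<forall>i\<in>{..<k}. f i z = (\<Sum>j<m. a j i z *\<^sub>C q j z)"
    using f by (intro eventually_ball_finite finite_lessThan ballI) auto
  ultimately have "\<forall>\<^sub>F z in nhds \<zeta>. z \<in> \<Omega> \<and> (\<forall>i\<in>{..<k}. \<forall>j\<in>{..<m}. cdiff (a j i) z) \<and>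
      (\<forall>j\<in>{..<m}. cdiff (q j) z) \<and> (\<forall>i\<in>{..<k}. f i z = (\<Sum>j<m. a j i z *\<^sub>C q j z)) \<and>
      (\<forall>t. (\<Sum>j<m. t j *\<^sub>C q j z) = 0 \<longrightarrow> (\<forall>j<m. t j = 0))"
    using ind by (intro eventually_conj eventually_nhds_in_open[OF assms(1,2)])
  then obtain U where U: "open U" "\<zeta> \<in> U" "\<forall>z\<in>U. z \<in> \<Omega> \<and> (\<forall>i\<in>{..<k}. \<forall>j\<in>{..<m}. cdiff (a j i) z) \<and>
      (\<forall>j\<in>{..<m}. cdiff (q j) z) \<and> (\<forall>i\<in>{..<k}. f i z = (\<Sum>j<m. a j i z *\<^sub>C q j z)) \<and>
      (\<forall>t. (\<Sum>j<m. t j *\<^sub>C q j z) = 0 \<longrightarrow> (\<forall>j<m. t j = 0))"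
    unfolding eventually_nhds by blast
  show thesis
  proof (rule that[of U m q a])
    show "frame U m q" unfolding frame_def using U by blast
  qed (use U in blast)+
qed

section \<open>The free sheaf spanned by a frame\<close>

definition span_map ::
    "nat \<Rightarrow> (nat \<Rightarrow> complex ^ 'n \<Rightarrow> 'e::complex_banach) \<Rightarrow> (complex ^ 'n) set \<Rightarrow>
     (nat \<Rightarrow> complex ^ 'n \<Rightarrow> complex) \<Rightarrow> complex ^ 'n \<Rightarrow> 'e" where
  "span_map m q V c = (\<lambda>z\<in>V. \<Sum>j<m. c j z *\<^sub>C q j z)"

definition span_sheaf ::
    "nat \<Rightarrow> (nat \<Rightarrow> complex ^ 'n \<Rightarrow> 'e::complex_banach) \<Rightarrow> (complex ^ 'n) set \<Rightarrow> (complex ^ 'n \<Rightarrow> 'e) set" where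
  "span_sheaf m q V = span_map m q V ` ({..<m} \<rightarrow>\<^sub>E hol_sections V)"

lemma cdiff_sum: "(\<And>i. i \<in> I \<Longrightarrow> cdiff (f i) z) \<Longrightarrow> cdiff (\<lambda>z. \<Sum>i\<in>I. f i z) z"
  by (induction I rule: infinite_finite_induct) (auto intro: cdiff_const cdiff_add)

lemma span_map_hol:
  assumes "frame U m q" "open V" "V \<subseteq> U" "c \<in> {..<m} \<rightarrow>\<^sub>E hol_sections V"
  shows "span_map m q V c \<in> hol_sections V"
  unfolding span_map_def
proof (rule restrict_in_hol_sections[OF assms(2)], rule cdiff_sum)
  fix z j assume "z \<in> V" "j \<in> {..<m}"
  then show "cdiff (\<lambda>z. c j z *\<^sub>C q j z) z"
    using assms by (intro cdiff_scaleC hol_sections_cdiff[of "c j" V]) (auto simp: frame_def)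
qed

lemma in_span_sheafI:
  assumes "open V" "s \<in> extensional V" "\<And>j z. j < m \<Longrightarrow> z \<in> V \<Longrightarrow> cdiff (c j) z"
    "\<And>z. z \<in> V \<Longrightarrow> s z = (\<Sum>j<m. c j z *\<^sub>C q j z)"
  shows "s \<in> span_sheaf m q V"
  unfolding span_sheaf_def
proof (rule image_eqI)
  show "(\<lambda>j\<in>{..<m}. restrict (c j) V) \<in> {..<m} \<rightarrow>\<^sub>E hol_sections V"
    using assms by (auto intro!: restrict_in_hol_sections)
  show "s = span_map m q V (\<lambda>j\<in>{..<m}. restrict (c j) V)"
    by (rule extensionalityI[OF assms(2)]) (auto simp: span_map_def assms(4))
qed

lemma span_sheafE:
  assumes "s \<in> span_sheaf m q V"
  obtains c where "c \<in> {..<m} \<rightarrow>\<^sub>E hol_sections V" "s = span_map m q V c"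
  using assms by (auto simp: span_sheaf_def)

text \<open>Since coordinates are unique at each point, local ones fit together automatically: a
  pointwise choice of coordinates must coincide, on each small set, with the holomorphic coordinates
  found there.\<close>

lemma span_sheaf_local:
  assumes q: "frame U m q" and V: "open V" "V \<subseteq> U" and s: "s \<in> hol_sections V"
    and loc: "\<And>x. x \<in> V \<Longrightarrow> \<exists>W. open W \<and> x \<in> W \<and> W \<subseteq> V \<and> restrict s W \<in> span_sheaf m q W"
  shows "s \<in> span_sheaf m q V"
proof -
  define c where "c j z = (SOME t. s z = (\<Sum>j<m. t j *\<^sub>C q j z)) j" for j z
  have *: "(j < m \<longrightarrow> cdiff (c j) x) \<and> s x = (\<Sum>j<m. c j x *\<^sub>C q j x)" if x: "x \<in> V" for x j
  proof -
    obtain W where W: "open W" "x \<in> W" "W \<subseteq> V" "restrict s W \<in> span_sheaf m q W" using loc[OF x] by blast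
    obtain d where d: "d \<in> {..<m} \<rightarrow>\<^sub>E hol_sections W" "restrict s W = span_map m q W d"
      using span_sheafE[OF W(4)] .
    have sd: "s z = (\<Sum>j<m. d j z *\<^sub>C q j z)" if "z \<in> W" for z
      using fun_cong[OF d(2), of z] that by (simp add: span_map_def)
    have sc: "s z = (\<Sum>j<m. c j z *\<^sub>C q j z)" if "z \<in> W" for z
      unfolding c_def by (rule someI[of "\<lambda>t. s z = (\<Sum>j<m. t j *\<^sub>C q j z)" "\<lambda>j. d j z"]) (rule sd[OF that])
    have cd: "d j z = c j z" if "z \<in> W" "j < m" for j z
      by (rule frame_unique[OF q _ _ that(2), where z = z]) (use that W V sd sc in auto)
    show ?thesis
    proof (cases "j < m")
      case True
      have "cdiff (d j) x" using d True W(2) by (auto intro: hol_sections_cdiff)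
      moreover have "\<forall>\<^sub>F z in nhds x. d j z = c j z"
        using eventually_nhds_in_open[OF W(1,2)] by eventually_elim (rule cd[OF _ True])
      ultimately show ?thesis using cdiff_transform sc[OF W(2)] by blast
    qed (use sc[OF W(2)] in \<open>auto\<close>)
  qed
  show ?thesis
    by (rule in_span_sheafI[OF V(1), of s m c]) (use * s in \<open>auto simp: hol_sections_def\<close>)
qed

lemma O_submodule_span_sheaf:
  fixes q :: "nat \<Rightarrow> complex ^ 'n::finite \<Rightarrow> 'e::complex_banach"
  assumes q: "frame U m q"
  shows "O_submodule U plain_sheaf (span_sheaf m q)"
  unfolding O_submodule_def
proof (intro allI impI conjI ballI)
  fix V assume "open V \<and> V \<subseteq> U"
  then have V: "open V" "V \<subseteq> U" by auto
  have sub: "span_sheaf m q V \<subseteq> hol_sections V"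
    unfolding span_sheaf_def using span_map_hol[OF q V] by blast
  have cd: "cdiff (c j) z" if "c \<in> {..<m} \<rightarrow>\<^sub>E hol_sections V" "j < m" "z \<in> V" for c j z
    using that by (auto intro: hol_sections_cdiff)
  have smult: "(\<lambda>z\<in>V. h z *\<^sub>C s z) \<in> span_sheaf m q V" if h: "h \<in> hol_sections V" and s: "s \<in> span_sheaf m q V" for h s
  proof -
    obtain c where c: "c \<in> {..<m} \<rightarrow>\<^sub>E hol_sections V" "s = span_map m q V c" using span_sheafE[OF s] .
    show ?thesis
    proof (rule in_span_sheafI[OF V(1)])
      show "cdiff (\<lambda>z. h z * c j z) z" if "j < m" "z \<in> V" for j z
        using cdiff_scaleC[OF hol_sections_cdiff[OF h that(2)] cd[OF c(1) that]]
        by (simp add: scaleC_complex_def)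
    qed (auto simp: c(2) span_map_def scaleC.sum_right scaleC_scaleC)
  qed
  interpret M: module "hol_ring V" "sec (plain_sheaf :: ('n, complex ^ 'n \<Rightarrow> 'e) mod_presheaf) V"
    by (rule module_plain_sheaf[OF V(1)])
  show "submodule (span_sheaf m q V) (hol_ring V) (sec plain_sheaf V)"
  proof (rule M.submoduleI)
    show "span_sheaf m q V \<subseteq> carrier (sec plain_sheaf V)" using sub by simp
    show "\<zero>\<^bsub>sec plain_sheaf V\<^esub> \<in> span_sheaf m q V"
      by (rule in_span_sheafI[OF V(1), of _ m "\<lambda>j z. 0"]) (auto intro: cdiff_const)
    show "h \<odot>\<^bsub>sec plain_sheaf V\<^esub> s \<in> span_sheaf m q V"
      if "h \<in> carrier (hol_ring V)" "s \<in> span_sheaf m q V" for h s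
      using smult that by simp
    show "\<ominus>\<^bsub>sec plain_sheaf V\<^esub> s \<in> span_sheaf m q V" if s: "s \<in> span_sheaf m q V" for s
    proof -
      have sh: "s \<in> hol_sections V" using s sub by blast
      have "\<ominus>\<^bsub>sec plain_sheaf V\<^esub> s = (\<lambda>z\<in>V. (\<lambda>z\<in>V. -1) z *\<^sub>C s z)"
        using M.M.minus_equality[of "\<lambda>z\<in>V. (\<lambda>z\<in>V. -1) z *\<^sub>C s z" s] sh
          hol_sections_scaleC[OF V(1) hol_sections_const[OF V(1), of "-1"] sh]
        by (simp add: scaleC.minus_left restrict_def cong: if_cong)
      then show ?thesis using smult[OF hol_sections_const[OF V(1)] s] by simp
    qed
    show "s \<oplus>\<^bsub>sec plain_sheaf V\<^esub> t \<in> span_sheaf m q V"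
      if st: "s \<in> span_sheaf m q V" "t \<in> span_sheaf m q V" for s t
    proof -
      obtain c where c: "c \<in> {..<m} \<rightarrow>\<^sub>E hol_sections V" "s = span_map m q V c" using span_sheafE[OF st(1)] .
      obtain d where d: "d \<in> {..<m} \<rightarrow>\<^sub>E hol_sections V" "t = span_map m q V d" using span_sheafE[OF st(2)] .
      show ?thesis
      proof (rule in_span_sheafI[OF V(1)])
        show "cdiff (\<lambda>z. c j z + d j z) z" if "j < m" "z \<in> V" for j z
          using cdiff_add[OF cd[OF c(1) that] cd[OF d(1) that]] .
      qed (auto simp: c(2) d(2) span_map_def sum.distrib scaleC_add_left)
    qed
  qed
  show "res plain_sheaf V W ` span_sheaf m q V \<subseteq> span_sheaf m q W" if W: "open W \<and> W \<subseteq> V" for W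
  proof (rule image_subsetI)
    fix s assume "s \<in> span_sheaf m q V"
    then obtain c where c: "c \<in> {..<m} \<rightarrow>\<^sub>E hol_sections V" "s = span_map m q V c" by (rule span_sheafE)
    show "res plain_sheaf V W s \<in> span_sheaf m q W"
      by (rule in_span_sheafI[of W _ m c]) (use W c cd[OF c(1)] in \<open>auto simp: span_map_def\<close>)
  qed
  show "s \<in> span_sheaf m q V" if "s \<in> carrier (sec plain_sheaf V)"
    "\<forall>x\<in>V. \<exists>W. open W \<and> x \<in> W \<and> W \<subseteq> V \<and> res plain_sheaf V W s \<in> span_sheaf m q W" for s
    using span_sheaf_local[OF q V, of s] that by simp
qed

lemma finitely_generated_free_span_sheaf:
  fixes q :: "nat \<Rightarrow> complex ^ 'n::finite \<Rightarrow> 'e::complex_banach"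
  assumes q: "frame U m q"
  shows "finitely_generated_free U (subsheaf plain_sheaf (span_sheaf m q))"
  unfolding finitely_generated_free_def
proof (intro exI)
  show "sheaf_iso U (free_sheaf m) (subsheaf plain_sheaf (span_sheaf m q)) (span_map m q)"
    unfolding sheaf_iso_def sheaf_hom_def
  proof (intro conjI allI impI ballI)
    fix V assume "open V \<and> V \<subseteq> U"
    then have V: "open V" "V \<subseteq> U" by auto
    show "span_map m q V \<in> carrier (sec (free_sheaf m) V) \<rightarrow> carrier (sec (subsheaf plain_sheaf (span_sheaf m q)) V)"
      by (simp add: span_sheaf_def)
    show "span_map m q V (s \<oplus>\<^bsub>sec (free_sheaf m) V\<^esub> t) =
        span_map m q V s \<oplus>\<^bsub>sec (subsheaf plain_sheaf (span_sheaf m q)) V\<^esub> span_map m q V t" for s t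
      by (auto simp: span_map_def scaleC_add_left sum.distrib)
    show "span_map m q V (c \<odot>\<^bsub>sec (free_sheaf m) V\<^esub> s) =
        c \<odot>\<^bsub>sec (subsheaf plain_sheaf (span_sheaf m q)) V\<^esub> span_map m q V s" for c s
      by (auto simp: span_map_def scaleC_scaleC scaleC.sum_right)
    show "span_map m q W (res (free_sheaf m) V W s) = res (subsheaf plain_sheaf (span_sheaf m q)) V W (span_map m q V s)"
      if "open W \<and> W \<subseteq> V" for W s
      using that by (auto simp: span_map_def fun_eq_iff)
    have "inj_on (span_map m q V) ({..<m} \<rightarrow>\<^sub>E hol_sections V)"
    proof (rule inj_onI)
      fix c d assume cd: "c \<in> {..<m} \<rightarrow>\<^sub>E hol_sections V" "d \<in> {..<m} \<rightarrow>\<^sub>E hol_sections V"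
        and eq: "span_map m q V c = span_map m q V d"
      show "c = d"
      proof (rule PiE_ext[OF cd])
        fix j assume j: "j \<in> {..<m}"
        show "c j = d j"
        proof (rule hol_sections_eqI)
          fix z assume z: "z \<in> V"
          show "c j z = d j z"
            by (rule frame_unique[OF q, of z "\<lambda>j. c j z" "\<lambda>j. d j z"])
              (use fun_cong[OF eq, of z] z V j in \<open>auto simp: span_map_def\<close>)
        qed (use cd j in auto)
      qed
    qed
    then show "bij_betw (span_map m q V) (carrier (sec (free_sheaf m) V))
        (carrier (sec (subsheaf plain_sheaf (span_sheaf m q)) V))"
      by (simp add: bij_betw_def span_sheaf_def)
  qed
qed

text \<open>A homomorphism from the free sheaf is determined by the images of the unit tuples over
  \<open>\<Omega>\<close>, and these are the \<open>f i\<close>. Sections of \<open>A\<close> are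
  combinations of them only locally, because surjectivity refers to the sheaf image.\<close>

lemma finitely_generated_sections:
  fixes A :: "(complex ^ 'n::finite) set \<Rightarrow> (complex ^ 'n \<Rightarrow> 'e::complex_banach) set"
  assumes \<Omega>: "open \<Omega>" and sub: "O_submodule \<Omega> plain_sheaf A" and fg: "finitely_generated \<Omega> (subsheaf plain_sheaf A)"
  obtains k :: nat and f where "\<And>i. i < k \<Longrightarrow> f i \<in> hol_sections \<Omega>"
    "\<And>V s x. open V \<Longrightarrow> V \<subseteq> \<Omega> \<Longrightarrow> s \<in> A V \<Longrightarrow> x \<in> V \<Longrightarrow> \<exists>W c. open W \<and> x \<in> W \<and> W \<subseteq> V \<and>
       (\<forall>i<k. c i \<in> hol_sections W) \<and> (\<forall>z\<in>W. s z = (\<Sum>i<k. c i z *\<^sub>C f i z))"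
proof -
  obtain k \<psi> where \<psi>: "sheaf_hom \<Omega> (free_sheaf k) (subsheaf plain_sheaf A) \<psi>"
    and im: "\<And>U. open U \<Longrightarrow> U \<subseteq> \<Omega> \<Longrightarrow> image_sheaf (free_sheaf k) (subsheaf plain_sheaf A) \<psi> U = A U"
    using fg by (auto simp: finitely_generated_def)
  have AU: "A U \<subseteq> hol_sections U" if "open U" "U \<subseteq> \<Omega>" for U
    using sub that by (auto simp: O_submodule_def submodule_def subgroup_def)
  have \<psi>c: "\<psi> U \<in> ({..<k} \<rightarrow>\<^sub>E hol_sections U) \<rightarrow> A U"
    and \<psi>a: "s \<in> {..<k} \<rightarrow>\<^sub>E hol_sections U \<Longrightarrow> t \<in> {..<k} \<rightarrow>\<^sub>E hol_sections U \<Longrightarrow>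
      \<psi> U (\<lambda>i\<in>{..<k}. \<lambda>z\<in>U. s i z + t i z) = (\<lambda>z\<in>U. \<psi> U s z + \<psi> U t z)"
    and \<psi>m: "h \<in> hol_sections U \<Longrightarrow> s \<in> {..<k} \<rightarrow>\<^sub>E hol_sections U \<Longrightarrow>
      \<psi> U (\<lambda>i\<in>{..<k}. \<lambda>z\<in>U. h z * s i z) = (\<lambda>z\<in>U. h z *\<^sub>C \<psi> U s z)"
    and \<psi>r: "open V \<Longrightarrow> V \<subseteq> U \<Longrightarrow> s \<in> {..<k} \<rightarrow>\<^sub>E hol_sections U \<Longrightarrow>
      \<psi> V (\<lambda>i\<in>{..<k}. restrict (s i) V) = restrict (\<psi> U s) V"
    if "open U" "U \<subseteq> \<Omega>" for U V s t h
    using \<psi> that unfolding sheaf_hom_def by (simp_all del: PiE_restrict)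
  define e where "e U n = (\<lambda>i\<in>{..<k}. \<lambda>z\<in>U. if i = n then 1 else 0 :: complex)" for U :: "(complex ^ 'n) set" and n :: nat
  have eh: "e U n \<in> {..<k} \<rightarrow>\<^sub>E hol_sections U" if "open U" for U n
    unfolding e_def using hol_sections_const[OF that] by auto
  define f where "f n = \<psi> \<Omega> (e \<Omega> n)" for n
  have fh: "f n \<in> hol_sections \<Omega>" for n
    using \<psi>c[OF \<Omega> order_refl] eh[OF \<Omega>, of n] AU[OF \<Omega> order_refl] by (auto simp: f_def)
  have fr: "\<psi> W (e W n) z = f n z" if W: "open W" "W \<subseteq> \<Omega>" "z \<in> W" for W n z
  proof -
    have "(\<lambda>i\<in>{..<k}. restrict (e \<Omega> n i) W) = e W n"
      using W by (auto simp: e_def fun_eq_iff)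
    then have "\<psi> W (e W n) = restrict (f n) W"
      using \<psi>r[OF \<Omega> order_refl W(1,2) eh[OF \<Omega>, of n]] by (simp add: f_def)
    then show ?thesis using W by simp
  qed
  have comb: "\<psi> W c z = (\<Sum>i<k. c i z *\<^sub>C f i z)"
    if W: "open W" "W \<subseteq> \<Omega>" and c: "c \<in> {..<k} \<rightarrow>\<^sub>E hol_sections W" and z: "z \<in> W" for W c z
  proof -
    \<comment> \<open>Additivity concerns two summands at a time, so the tuple is built up entry by
      entry; \<open>tr n\<close> keeps the first \<open>n\<close> entries.\<close>
    define tr where "tr n = (\<lambda>i\<in>{..<k}. \<lambda>z\<in>W. if i < n then c i z else 0)" for n
    have trh: "tr n \<in> {..<k} \<rightarrow>\<^sub>E hol_sections W" for n
    proof (rule PiE_I)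
      fix i assume i: "i \<in> {..<k}"
      then have ci: "c i \<in> hol_sections W" using c by auto
      then have "(\<lambda>z\<in>W. c i z) = c i" by (auto simp: hol_sections_def intro: extensional_restrict)
      then show "tr n i \<in> hol_sections W"
        using i ci hol_sections_const[OF W(1), of 0] by (cases "i < n") (simp_all add: tr_def)
    qed (simp add: tr_def)
    have trn: "n \<le> k \<Longrightarrow> \<psi> W (tr n) z = (\<Sum>i<n. c i z *\<^sub>C f i z)" for n
    proof (induction n)
      case 0
      \<comment> \<open>The zero tuple is written as 0 times itself, so that compatibility with
        scalars yields its image.\<close>
      have tr0: "(\<lambda>i\<in>{..<k}. \<lambda>z\<in>W. (\<lambda>z\<in>W. 0) z * tr 0 i z) = tr 0"
        by (auto simp: tr_def fun_eq_iff)
      have "\<psi> W (\<lambda>i\<in>{..<k}. \<lambda>z\<in>W. (\<lambda>z\<in>W. 0) z * tr 0 i z) = (\<lambda>z\<in>W. (\<lambda>z\<in>W. 0) z *\<^sub>C \<psi> W (tr 0) z)"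
        by (rule \<psi>m[OF W hol_sections_const[OF W(1)] trh])
      from fun_cong[OF this[unfolded tr0], of z] show ?case using z by simp
    next
      case (Suc n)
      have cn: "c n \<in> hol_sections W" by (rule PiE_mem[OF c]) (use Suc.prems in simp)
      define b where "b = (\<lambda>i\<in>{..<k}. \<lambda>z\<in>W. c n z * e W n i z)"
      have bh: "b \<in> {..<k} \<rightarrow>\<^sub>E hol_sections W"
        using eh[OF W(1), of n] hol_sections_mult[OF W(1) cn] by (auto simp: b_def)
      have "tr (Suc n) = (\<lambda>i\<in>{..<k}. \<lambda>z\<in>W. tr n i z + b i z)"
        using Suc.prems by (auto simp: tr_def b_def e_def fun_eq_iff less_Suc_eq)
      then have "\<psi> W (tr (Suc n)) = (\<lambda>z\<in>W. \<psi> W (tr n) z + \<psi> W b z)"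
        using \<psi>a[OF W trh bh] by simp
      moreover have "\<psi> W b = (\<lambda>z\<in>W. c n z *\<^sub>C \<psi> W (e W n) z)"
        unfolding b_def by (rule \<psi>m[OF W cn eh[OF W(1)]])
      ultimately show ?case using Suc z fr[OF W z] by simp
    qed
    have "tr k = c"
    proof (rule PiE_ext[OF trh c])
      fix i assume i: "i \<in> {..<k}"
      then show "tr k i = c i"
        using c by (auto simp: tr_def hol_sections_def fun_eq_iff extensional_def PiE_iff)
    qed
    then show ?thesis using trn[of k] by simp
  qed
  show thesis
  proof (rule that[of k f])
    show "f i \<in> hol_sections \<Omega>" for i by (rule fh)
    fix V s x assume V: "open V" "V \<subseteq> \<Omega>" and s: "s \<in> A V" and x: "x \<in> V"
    have "s \<in> image_sheaf (free_sheaf k) (subsheaf plain_sheaf A) \<psi> V" using im[OF V] s by simp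
    then obtain W where W: "open W" "x \<in> W" "W \<subseteq> V" "restrict s W \<in> \<psi> W ` ({..<k} \<rightarrow>\<^sub>E hol_sections W)"
      using x unfolding image_sheaf_def by auto
    then obtain c where c: "c \<in> {..<k} \<rightarrow>\<^sub>E hol_sections W" "restrict s W = \<psi> W c" by blast
    have "W \<subseteq> \<Omega>" using W V by blast
    have "s z = (\<Sum>i<k. c i z *\<^sub>C f i z)" if "z \<in> W" for z
      using comb[OF W(1) \<open>W \<subseteq> \<Omega>\<close> c(1) that] fun_cong[OF c(2), of z] that by simp
    then show "\<exists>W c. open W \<and> x \<in> W \<and> W \<subseteq> V \<and>
       (\<forall>i<k. c i \<in> hol_sections W) \<and> (\<forall>z\<in>W. s z = (\<Sum>i<k. c i z *\<^sub>C f i z))"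
      using W c(1) by blast
  qed
qed

text \<open>The free sheaf is spanned by a frame for the generators. A section of \<open>A\<close>
  is locally a combination of generators, hence locally in the span, and
  \<open>span_sheaf_local\<close> passes to the whole open set.\<close>

theorem finitely_generated_in_free:
  fixes A :: "(complex ^ 'n::finite) set \<Rightarrow> (complex ^ 'n \<Rightarrow> 'e::complex_banach) set"
  assumes \<Omega>: "open \<Omega>" and sub: "O_submodule \<Omega> plain_sheaf A"
    and fg: "finitely_generated \<Omega> (subsheaf plain_sheaf A)" and "\<zeta> \<in> \<Omega>"
  shows "\<exists>U E. open U \<and> \<zeta> \<in> U \<and> U \<subseteq> \<Omega> \<and> O_submodule U plain_sheaf E \<and>
    finitely_generated_free U (subsheaf plain_sheaf E) \<and> (\<forall>V. open V \<and> V \<subseteq> U \<longrightarrow> A V \<subseteq> E V)"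
proof -
  obtain k :: nat and f where f: "\<And>i. i < k \<Longrightarrow> f i \<in> hol_sections \<Omega>"
    and A: "\<And>V s x. open V \<Longrightarrow> V \<subseteq> \<Omega> \<Longrightarrow> s \<in> A V \<Longrightarrow> x \<in> V \<Longrightarrow> \<exists>W c. open W \<and> x \<in> W \<and> W \<subseteq> V \<and>
       (\<forall>i<k. c i \<in> hol_sections W) \<and> (\<forall>z\<in>W. s z = (\<Sum>i<k. c i z *\<^sub>C f i z))"
    by (rule finitely_generated_sections[OF \<Omega> sub fg]) (assumption | rule that)+
  obtain U m a q where U: "\<zeta> \<in> U" "U \<subseteq> \<Omega>" and q: "frame U m q"
    and a: "\<And>i j z. i < k \<Longrightarrow> j < m \<Longrightarrow> z \<in> U \<Longrightarrow> cdiff (a j i) z"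
    and fa: "\<And>i z. i < k \<Longrightarrow> z \<in> U \<Longrightarrow> f i z = (\<Sum>j<m. a j i z *\<^sub>C q j z)"
    by (rule local_frame[OF \<Omega> \<open>\<zeta> \<in> \<Omega>\<close>, where k = k and f = f]) (assumption | rule f | rule that)+
  have "A V \<subseteq> span_sheaf m q V" if V: "open V" "V \<subseteq> U" for V
  proof
    fix s assume s: "s \<in> A V"
    have V\<Omega>: "V \<subseteq> \<Omega>" using V U by blast
    have sh: "s \<in> hol_sections V"
      using sub V(1) V\<Omega> s by (auto simp: O_submodule_def submodule_def subgroup_def)
    show "s \<in> span_sheaf m q V"
    proof (rule span_sheaf_local[OF q V sh])
      fix x assume "x \<in> V"
      then obtain W c where W: "open W" "x \<in> W" "W \<subseteq> V" and c: "\<And>i. i < k \<Longrightarrow> c i \<in> hol_sections W"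
        and sc: "\<And>z. z \<in> W \<Longrightarrow> s z = (\<Sum>i<k. c i z *\<^sub>C f i z)"
        using A[OF V(1) V\<Omega> s] by metis
      have "restrict s W \<in> span_sheaf m q W"
      proof (rule in_span_sheafI[OF W(1)])
        show "cdiff (\<lambda>z. \<Sum>i<k. c i z * a j i z) z" if "j < m" "z \<in> W" for j z
        proof (rule cdiff_sum)
          fix i assume "i \<in> {..<k}"
          then have "cdiff (c i) z" "cdiff (a j i) z"
            using c a that W V by (auto intro: hol_sections_cdiff)
          from cdiff_scaleC[OF this] show "cdiff (\<lambda>z. c i z * a j i z) z"
            by (simp add: scaleC_complex_def)
        qed
        fix z assume z: "z \<in> W"
        have "s z = (\<Sum>i<k. \<Sum>j<m. (c i z * a j i z) *\<^sub>C q j z)"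
          using z W V fa by (subst sc) (auto simp: scaleC.sum_right scaleC_scaleC intro!: sum.cong)
        also have "\<dots> = (\<Sum>j<m. (\<Sum>i<k. c i z * a j i z) *\<^sub>C q j z)"
          by (subst sum.swap) (simp add: scaleC.sum_left)
        finally show "restrict s W z = (\<Sum>j<m. (\<Sum>i<k. c i z * a j i z) *\<^sub>C q j z)"
          using z by simp
      qed simp
      then show "\<exists>W. open W \<and> x \<in> W \<and> W \<subseteq> V \<and> restrict s W \<in> span_sheaf m q W" using W by blast
    qed
  qed
  moreover have "open U" using q by (simp add: frame_def)
  ultimately show ?thesis
    using U O_submodule_span_sheaf[OF q] finitely_generated_free_span_sheaf[OF q] by blast
qed

section \<open>Exactness of sheafified sequences\<close>

definition functorial :: "(complex ^ 'n) set \<Rightarrow> ('n, 'a) mod_presheaf \<Rightarrow> bool" where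
  "functorial \<Omega> P \<longleftrightarrow>
     (\<forall>U V s. open U \<and> open V \<and> V \<subseteq> U \<and> U \<subseteq> \<Omega> \<and> s \<in> carrier (sec P U) \<longrightarrow> res P U V s \<in> carrier (sec P V)) \<and>
     (\<forall>U V W s. open U \<and> open V \<and> open W \<and> W \<subseteq> V \<and> V \<subseteq> U \<and> U \<subseteq> \<Omega> \<and> s \<in> carrier (sec P U) \<longrightarrow>
        res P V W (res P U V s) = res P U W s)"

lemma
  assumes "functorial \<Omega> P"
  shows functorial_closed: "\<lbrakk>open U; open V; V \<subseteq> U; U \<subseteq> \<Omega>; s \<in> carrier (sec P U)\<rbrakk> \<Longrightarrow>
      res P U V s \<in> carrier (sec P V)"
    and functorial_res: "\<lbrakk>open U; open V; open W; W \<subseteq> V; V \<subseteq> U; U \<subseteq> \<Omega>; s \<in> carrier (sec P U)\<rbrakk> \<Longrightarrow>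
      res P V W (res P U V s) = res P U W s"
  using assms by (simp_all add: functorial_def)

definition natural_map :: "(complex ^ 'n) set \<Rightarrow> ('n, 'a) mod_presheaf \<Rightarrow> ('n, 'b) mod_presheaf \<Rightarrow>
    ((complex ^ 'n) set \<Rightarrow> 'a \<Rightarrow> 'b) \<Rightarrow> bool" where
  "natural_map \<Omega> P Q \<phi> \<longleftrightarrow> (\<forall>U s. open U \<and> U \<subseteq> \<Omega> \<and> s \<in> carrier (sec P U) \<longrightarrow>
     \<phi> U s \<in> carrier (sec Q U) \<and> (\<forall>V. open V \<and> V \<subseteq> U \<longrightarrow> \<phi> V (res P U V s) = res Q U V (\<phi> U s)))"

lemma
  assumes "natural_map \<Omega> P Q \<phi>" "open U" "U \<subseteq> \<Omega>" "s \<in> carrier (sec P U)"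
  shows natural_map_closed: "\<phi> U s \<in> carrier (sec Q U)"
    and natural_map_res: "open V \<Longrightarrow> V \<subseteq> U \<Longrightarrow> \<phi> V (res P U V s) = res Q U V (\<phi> U s)"
  using assms by (simp_all add: natural_map_def)

section \<open>Germs of presheaf sections\<close>

lemma germ_subset:
  assumes P: "functorial \<Omega> P" and U: "open U" "U \<subseteq> \<Omega>" and V: "open V" "V \<subseteq> \<Omega>"
    and s: "s \<in> carrier (sec P U)" and t: "t \<in> carrier (sec P V)"
    and W: "open W" "x \<in> W" "W \<subseteq> U \<inter> V" and eq: "res P U W s = res P V W t"
  shows "germ \<Omega> P x U s \<subseteq> germ \<Omega> P x V t"
proof
  fix p assume "p \<in> germ \<Omega> P x U s"
  then obtain T r W' where p: "p = (T, r)" and T: "open T" "x \<in> T" "T \<subseteq> \<Omega>" "r \<in> carrier (sec P T)"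
    and W': "open W'" "x \<in> W'" "W' \<subseteq> U \<inter> T" "res P U W' s = res P T W' r"
    by (auto simp: germ_def)
  let ?W = "W \<inter> W'"
  have oW: "open ?W" using W(1) W'(1) by blast
  have "res P V ?W t = res P W ?W (res P V W t)"
    using W by (intro functorial_res[OF P V(1) W(1) oW, symmetric] V t) auto
  also have "\<dots> = res P U ?W s"
    unfolding eq[symmetric] using W by (intro functorial_res[OF P U(1) W(1) oW] U s) auto
  also have "\<dots> = res P W' ?W (res P U W' s)"
    using W' by (intro functorial_res[OF P U(1) W'(1) oW, symmetric] U s) auto
  also have "\<dots> = res P T ?W r"
    unfolding W'(4) using W' by (intro functorial_res[OF P T(1) W'(1) oW] T) auto
  finally have "res P V ?W t = res P T ?W r" .
  then show "p \<in> germ \<Omega> P x V t"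
    unfolding germ_def using p T oW W W' by blast
qed

lemma germ_eqI:
  assumes "functorial \<Omega> P" "open U" "U \<subseteq> \<Omega>" "open V" "V \<subseteq> \<Omega>"
    "s \<in> carrier (sec P U)" "t \<in> carrier (sec P V)" "open W" "x \<in> W" "W \<subseteq> U \<inter> V" "res P U W s = res P V W t"
  shows "germ \<Omega> P x U s = germ \<Omega> P x V t"
  using germ_subset[OF assms] germ_subset[OF assms(1,4,5,2,3,7,6,8,9) _ assms(11)[symmetric]] assms(10)
  by blast

lemma germ_self:
  assumes "open V" "V \<subseteq> \<Omega>" "x \<in> V" "t \<in> carrier (sec P V)"
  shows "(V, t) \<in> germ \<Omega> P x V t"
  using assms by (auto simp: germ_def)

lemma germ_eqD:
  assumes "germ \<Omega> P x U s = germ \<Omega> P x V t" "open V" "V \<subseteq> \<Omega>" "x \<in> V" "t \<in> carrier (sec P V)"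
  obtains W where "open W" "x \<in> W" "W \<subseteq> U \<inter> V" "res P U W s = res P V W t"
proof -
  have "(V, t) \<in> germ \<Omega> P x U s" using germ_self[OF assms(2-5)] assms(1) by simp
  then show thesis using that by (auto simp: germ_def)
qed

lemma germ_res:
  assumes P: "functorial \<Omega> P" and U: "open U" "U \<subseteq> \<Omega>" and V: "open V" "V \<subseteq> U" "x \<in> V"
    and s: "s \<in> carrier (sec P U)"
  shows "germ \<Omega> P x V (res P U V s) = germ \<Omega> P x U s"
proof (rule germ_eqI[OF P V(1) _ U _ s V(1,3)])
  show "res P V V (res P U V s) = res P U V s"
    by (rule functorial_res[OF P U(1) V(1) V(1) order_refl V(2) U(2) s])
qed (use assms in \<open>auto intro: functorial_closed[OF P]\<close>)

text \<open>By naturality all representatives of a germ have the same image germ, so the union in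
  the definition of \<open>sheafify_map\<close> is taken over a single set.\<close>

lemma sheafify_map_germ:
  assumes P: "functorial \<Omega> P" and Q: "functorial \<Omega> Q" and \<phi>: "natural_map \<Omega> P Q \<phi>"
    and V: "open V" "V \<subseteq> \<Omega>" "x \<in> V" and s: "s \<in> carrier (sec P V)"
    and x: "x \<in> U" and \<sigma>: "\<sigma> x = germ \<Omega> P x V s"
  shows "sheafify_map \<Omega> Q \<phi> U \<sigma> x = germ \<Omega> Q x V (\<phi> V s)"
proof -
  have "germ \<Omega> Q x T (\<phi> T r) = germ \<Omega> Q x V (\<phi> V s)" if Tr: "(T, r) \<in> \<sigma> x" for T r
  proof -
    obtain W where T: "open T" "x \<in> T" "T \<subseteq> \<Omega>" "r \<in> carrier (sec P T)"
      and W: "open W" "x \<in> W" "W \<subseteq> V" "W \<subseteq> T" "res P V W s = res P T W r"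
      using Tr[unfolded \<sigma> germ_def] by auto
    show ?thesis
    proof (rule germ_eqI[OF Q T(1,3) V(1,2)])
      show "open W" "x \<in> W" "W \<subseteq> T \<inter> V" using W by auto
      show "\<phi> T r \<in> carrier (sec Q T)" "\<phi> V s \<in> carrier (sec Q V)"
        using natural_map_closed[OF \<phi>] T V s by auto
      have "res Q T W (\<phi> T r) = \<phi> W (res P T W r)"
        using natural_map_res[OF \<phi> T(1,3,4) W(1,4)] by simp
      also have "\<dots> = res Q V W (\<phi> V s)"
        unfolding W(5)[symmetric] by (rule natural_map_res[OF \<phi> V(1,2) s W(1,3)])
      finally show "res Q T W (\<phi> T r) = res Q V W (\<phi> V s)" .
    qed
  qed
  moreover have "(V, s) \<in> \<sigma> x" unfolding \<sigma> by (rule germ_self[OF V s])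
  ultimately have "{germ \<Omega> Q x T (\<phi> T r) | T r. (T, r) \<in> \<sigma> x} = {germ \<Omega> Q x V (\<phi> V s)}" by blast
  then show ?thesis using x by (simp add: sheafify_map_def)
qed

lemma sheafify_simps:
  "carrier (sec (sheafify \<Omega> P) U) = {\<sigma> \<in> extensional U. \<forall>x\<in>U. \<exists>V s. open V \<and> x \<in> V \<and> V \<subseteq> U \<and>
     s \<in> carrier (sec P V) \<and> (\<forall>y\<in>V. \<sigma> y = germ \<Omega> P y V s)}"
  "\<zero>\<^bsub>sec (sheafify \<Omega> P) U\<^esub> = (\<lambda>x\<in>U. germ \<Omega> P x U \<zero>\<^bsub>sec P U\<^esub>)"
  "res (sheafify \<Omega> P) U V \<sigma> = restrict \<sigma> V"
  by (simp_all add: sheafify_def)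

text \<open>Exactness after sheafification is checked on representatives: \<open>comp\<close> makes
  the presheaves a complex, and \<open>lift\<close> solves the lifting problem after shrinking
  around a point, which is all that the sheaf image asks for.\<close>

theorem sheafify_exact:
  assumes P: "functorial \<Omega> P" and Q: "functorial \<Omega> Q" and S: "functorial \<Omega> S"
    and \<phi>: "natural_map \<Omega> P Q \<phi>" and \<psi>: "natural_map \<Omega> Q S \<psi>"
    and zero: "\<And>U. open U \<Longrightarrow> U \<subseteq> \<Omega> \<Longrightarrow> \<zero>\<^bsub>sec S U\<^esub> \<in> carrier (sec S U)"
      "\<And>U V. open U \<Longrightarrow> U \<subseteq> \<Omega> \<Longrightarrow> open V \<Longrightarrow> V \<subseteq> U \<Longrightarrow> res S U V \<zero>\<^bsub>sec S U\<^esub> = \<zero>\<^bsub>sec S V\<^esub>"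
    and comp: "\<And>U s. open U \<Longrightarrow> U \<subseteq> \<Omega> \<Longrightarrow> s \<in> carrier (sec P U) \<Longrightarrow> \<psi> U (\<phi> U s) = \<zero>\<^bsub>sec S U\<^esub>"
    and lift: "\<And>U s x. open U \<Longrightarrow> U \<subseteq> \<Omega> \<Longrightarrow> s \<in> carrier (sec Q U) \<Longrightarrow> \<psi> U s = \<zero>\<^bsub>sec S U\<^esub> \<Longrightarrow> x \<in> U \<Longrightarrow>
      \<exists>W t. open W \<and> x \<in> W \<and> W \<subseteq> U \<and> t \<in> carrier (sec P W) \<and> \<phi> W t = res Q U W s"
  shows "exact_sheaf_seq \<Omega> (sheafify \<Omega> P) (sheafify_map \<Omega> Q \<phi>) (sheafify \<Omega> Q) (sheafify_map \<Omega> S \<psi>) (sheafify \<Omega> S)"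
  unfolding exact_sheaf_seq_def
proof (intro allI impI)
  fix U assume "open U \<and> U \<subseteq> \<Omega>"
  then have U: "open U" "U \<subseteq> \<Omega>" by auto
  have zgerm: "germ \<Omega> S x V \<zero>\<^bsub>sec S V\<^esub> = germ \<Omega> S x U \<zero>\<^bsub>sec S U\<^esub>" if "open V" "V \<subseteq> U" "x \<in> V" for x V
    using germ_res[OF S U that zero(1)[OF U]] zero(2)[OF U that(1,2)] by simp
  show "image_sheaf (sheafify \<Omega> P) (sheafify \<Omega> Q) (sheafify_map \<Omega> Q \<phi>) U =
      kernel_sheaf (sheafify \<Omega> Q) (sheafify \<Omega> S) (sheafify_map \<Omega> S \<psi>) U"
  proof (rule equalityI; rule subsetI)
    fix \<sigma> assume \<sigma>: "\<sigma> \<in> image_sheaf (sheafify \<Omega> P) (sheafify \<Omega> Q) (sheafify_map \<Omega> Q \<phi>) U"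
    have "sheafify_map \<Omega> S \<psi> U \<sigma> x = germ \<Omega> S x U \<zero>\<^bsub>sec S U\<^esub>" if x: "x \<in> U" for x
    proof -
      obtain V \<tau> where V: "open V" "x \<in> V" "V \<subseteq> U" and \<tau>: "\<tau> \<in> carrier (sec (sheafify \<Omega> P) V)"
        "restrict \<sigma> V = sheafify_map \<Omega> Q \<phi> V \<tau>"
      proof -
        have "\<exists>V. open V \<and> x \<in> V \<and> V \<subseteq> U \<and> res (sheafify \<Omega> Q) U V \<sigma> \<in>
            sheafify_map \<Omega> Q \<phi> V ` carrier (sec (sheafify \<Omega> P) V)"
          using \<sigma> x by (simp only: image_sheaf_def mem_Collect_eq)
        then show thesis
          by (elim exE conjE imageE) (rule that, assumption+, simp only: sheafify_simps(3))
      qed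
      obtain T t where T: "open T" "x \<in> T" "T \<subseteq> V" "t \<in> carrier (sec P T)" "\<tau> x = germ \<Omega> P x T t"
      proof -
        have "\<forall>x\<in>V. \<exists>T t. open T \<and> x \<in> T \<and> T \<subseteq> V \<and> t \<in> carrier (sec P T) \<and> (\<forall>y\<in>T. \<tau> y = germ \<Omega> P y T t)"
          using \<tau>(1) by (simp only: sheafify_simps(1) mem_Collect_eq, elim conjE)
        from bspec[OF this V(2)] show thesis
          by (elim exE conjE) (rule that, assumption+, erule (1) bspec)
      qed
      have T\<Omega>: "T \<subseteq> \<Omega>" using T V U by blast
      have \<phi>t: "\<phi> T t \<in> carrier (sec Q T)" by (rule natural_map_closed[OF \<phi> T(1) T\<Omega> T(4)])
      have "\<sigma> x = sheafify_map \<Omega> Q \<phi> V \<tau> x" using fun_cong[OF \<tau>(2), of x] V by simp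
      also have "\<dots> = germ \<Omega> Q x T (\<phi> T t)"
        by (rule sheafify_map_germ[where \<sigma> = \<tau>, OF P Q \<phi> T(1) T\<Omega> T(2,4) V(2) T(5)])
      finally have "sheafify_map \<Omega> S \<psi> U \<sigma> x = germ \<Omega> S x T (\<psi> T (\<phi> T t))"
        by (intro sheafify_map_germ[OF Q S \<psi> T(1) T\<Omega> T(2) \<phi>t x])
      then show ?thesis using comp[OF T(1) T\<Omega> T(4)] zgerm[OF T(1) _ T(2)] T V by auto
    qed
    then have "sheafify_map \<Omega> S \<psi> U \<sigma> = \<zero>\<^bsub>sec (sheafify \<Omega> S) U\<^esub>"
      unfolding sheafify_simps by (auto simp: sheafify_map_def fun_eq_iff)
    then show "\<sigma> \<in> kernel_sheaf (sheafify \<Omega> Q) (sheafify \<Omega> S) (sheafify_map \<Omega> S \<psi>) U"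
      using \<sigma> by (simp add: kernel_sheaf_def image_sheaf_def)
  next
    fix \<sigma> assume "\<sigma> \<in> kernel_sheaf (sheafify \<Omega> Q) (sheafify \<Omega> S) (sheafify_map \<Omega> S \<psi>) U"
    then have \<sigma>: "\<sigma> \<in> carrier (sec (sheafify \<Omega> Q) U)" "sheafify_map \<Omega> S \<psi> U \<sigma> = \<zero>\<^bsub>sec (sheafify \<Omega> S) U\<^esub>"
      by (auto simp: kernel_sheaf_def)
    have "\<exists>V. open V \<and> x \<in> V \<and> V \<subseteq> U \<and> restrict \<sigma> V \<in> sheafify_map \<Omega> Q \<phi> V ` carrier (sec (sheafify \<Omega> P) V)"
      if x: "x \<in> U" for x
    proof -
      obtain V s where V: "open V" "x \<in> V" "V \<subseteq> U" and s: "s \<in> carrier (sec Q V)"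
        and \<sigma>s: "\<And>y. y \<in> V \<Longrightarrow> \<sigma> y = germ \<Omega> Q y V s"
      proof -
        have "\<forall>x\<in>U. \<exists>T t. open T \<and> x \<in> T \<and> T \<subseteq> U \<and> t \<in> carrier (sec Q T) \<and> (\<forall>y\<in>T. \<sigma> y = germ \<Omega> Q y T t)"
          using \<sigma>(1) by (simp only: sheafify_simps(1) mem_Collect_eq, elim conjE)
        from bspec[OF this x] show thesis
          by (elim exE conjE) (rule that, assumption+, erule (1) bspec)
      qed
      have V\<Omega>: "V \<subseteq> \<Omega>" using V U by blast
      have "germ \<Omega> S x V (\<psi> V s) = sheafify_map \<Omega> S \<psi> U \<sigma> x"
        by (rule sheafify_map_germ[where \<sigma> = \<sigma>, OF Q S \<psi> V(1) V\<Omega> V(2) s x \<sigma>s[OF V(2)], symmetric])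
      also have "\<dots> = germ \<Omega> S x U \<zero>\<^bsub>sec S U\<^esub>" using x by (simp add: \<sigma>(2) sheafify_simps)
      \<comment> \<open>Equal germs have equal restrictions to some \<open>W\<close>; from here on
        the restricted section itself, and not only its germ, is killed by
        \<open>\<psi>\<close>.\<close>
      finally obtain W where W: "open W" "x \<in> W" "W \<subseteq> V \<inter> U" "res S V W (\<psi> V s) = res S U W \<zero>\<^bsub>sec S U\<^esub>"
        by (rule germ_eqD[OF _ U x zero(1)[OF U]])
      let ?s = "res Q V W s"
      have W\<Omega>: "W \<subseteq> \<Omega>" and WV: "W \<subseteq> V" using W U by auto
      have sW: "?s \<in> carrier (sec Q W)" by (rule functorial_closed[OF Q V(1) W(1) WV V\<Omega> s])
      have "\<psi> W ?s = \<zero>\<^bsub>sec S W\<^esub>"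
        using natural_map_res[OF \<psi> V(1) V\<Omega> s W(1) WV] W zero(2)[OF U W(1)] by auto
      from lift[OF W(1) W\<Omega> sW this W(2)]
      obtain T t where T: "open T" "x \<in> T" "T \<subseteq> W" "t \<in> carrier (sec P T)" "\<phi> T t = res Q W T ?s" by blast
      have T\<Omega>: "T \<subseteq> \<Omega>" using T W\<Omega> by blast
      have TV: "T \<subseteq> V" using T WV by blast
      have eqs: "res Q W T ?s = res Q V T s"
        by (rule functorial_res[OF Q V(1) W(1) T(1) T(3) WV V\<Omega> s])
      define \<tau> where "\<tau> = (\<lambda>y\<in>T. germ \<Omega> P y T t)"
      have "\<tau> \<in> carrier (sec (sheafify \<Omega> P) T)"
        unfolding sheafify_simps using T by (auto simp: \<tau>_def)
      moreover have "restrict \<sigma> T = sheafify_map \<Omega> Q \<phi> T \<tau>"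
      proof
        fix y show "restrict \<sigma> T y = sheafify_map \<Omega> Q \<phi> T \<tau> y"
        proof (cases "y \<in> T")
          case True
          have "sheafify_map \<Omega> Q \<phi> T \<tau> y = germ \<Omega> Q y T (\<phi> T t)"
            by (rule sheafify_map_germ[OF P Q \<phi> T(1) T\<Omega> True T(4) True]) (simp add: \<tau>_def True)
          also have "\<dots> = germ \<Omega> Q y V s"
            unfolding T(5) eqs by (rule germ_res[OF Q V(1) V\<Omega> T(1) TV True s])
          finally show ?thesis using \<sigma>s[of y] True TV by auto
        qed (simp add: sheafify_map_def)
      qed
      ultimately show ?thesis using T V TV by blast
    qed
    then show "\<sigma> \<in> image_sheaf (sheafify \<Omega> P) (sheafify \<Omega> Q) (sheafify_map \<Omega> Q \<phi>) U"
      using \<sigma>(1) by (simp add: image_sheaf_def sheafify_simps(3))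
  qed
qed

section \<open>Tensor products\<close>

abbreviation keys where "keys \<equiv> Poly_Mapping.keys"

lemma keys_tensor_relators:
  assumes "module R M" "module R N" "k \<in> tensor_relators R M N"
  shows "keys k \<subseteq> carrier M \<times> carrier N"
proof -
  interpret M: module R M by fact
  interpret N: module R N by fact
  have 3: "keys (a - b - c) \<subseteq> S" if "keys a \<subseteq> S" "keys b \<subseteq> S" "keys c \<subseteq> S" for a b c :: "'x \<Rightarrow>\<^sub>0 int" and S
    using that keys_diff[of "a - b" c] keys_diff[of a b] by blast
  have 2: "keys (a - b) \<subseteq> S" if "keys a \<subseteq> S" "keys b \<subseteq> S" for a b :: "'x \<Rightarrow>\<^sub>0 int" and S
    using that keys_diff[of a b] by blast
  show ?thesis
    using assms(3) unfolding tensor_relators_def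
    by (elim UnE CollectE exE conjE; simp only:; intro 3 2; simp)
qed

lemma tensor_kernel_subgroup:
  assumes "module R M" "module R N"
  shows "subgroup (tensor_kernel R M N) (tensor_free M N)"
  unfolding tensor_kernel_def
  by (rule group.generate_is_subgroup) (use keys_tensor_relators[OF assms] in auto)

lemma
  assumes MN: "module R M" "module R N"
  shows tensor_kernel_keys: "k \<in> tensor_kernel R M N \<Longrightarrow> keys k \<subseteq> carrier M \<times> carrier N"
    and tensor_kernel_0: "0 \<in> tensor_kernel R M N"
    and tensor_kernel_add: "k \<in> tensor_kernel R M N \<Longrightarrow> l \<in> tensor_kernel R M N \<Longrightarrow> k + l \<in> tensor_kernel R M N"
    and tensor_kernel_uminus: "k \<in> tensor_kernel R M N \<Longrightarrow> - k \<in> tensor_kernel R M N"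
    and tensor_kernel_diff: "k \<in> tensor_kernel R M N \<Longrightarrow> l \<in> tensor_kernel R M N \<Longrightarrow> k - l \<in> tensor_kernel R M N"
proof -
  note S = tensor_kernel_subgroup[OF MN]
  show keys: "keys k \<subseteq> carrier M \<times> carrier N" if "k \<in> tensor_kernel R M N" for k
    using subgroup.mem_carrier[OF S that] by simp
  show "0 \<in> tensor_kernel R M N" using subgroup.one_closed[OF S] by simp
  show add: "k + l \<in> tensor_kernel R M N" if "k \<in> tensor_kernel R M N" "l \<in> tensor_kernel R M N" for k l
    using subgroup.m_closed[OF S that] by simp
  show neg: "- k \<in> tensor_kernel R M N" if "k \<in> tensor_kernel R M N" for k
    using subgroup.m_inv_closed[OF S that] keys[OF that] by simp
  show "k - l \<in> tensor_kernel R M N" if "k \<in> tensor_kernel R M N" "l \<in> tensor_kernel R M N" for k l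
    using add[OF that(1) neg[OF that(2)]] by simp
qed

lemma tensor_relators_in_kernel: "k \<in> tensor_relators R M N \<Longrightarrow> k \<in> tensor_kernel R M N"
  unfolding tensor_kernel_def by (rule generate.incl)

lemma
  shows tensor_rel_add_left: "x \<in> carrier M \<Longrightarrow> x' \<in> carrier M \<Longrightarrow> y \<in> carrier N \<Longrightarrow>
      frag_of (x \<oplus>\<^bsub>M\<^esub> x', y) - frag_of (x, y) - frag_of (x', y) \<in> tensor_kernel R M N"
    and tensor_rel_add_right: "x \<in> carrier M \<Longrightarrow> y \<in> carrier N \<Longrightarrow> y' \<in> carrier N \<Longrightarrow>
      frag_of (x, y \<oplus>\<^bsub>N\<^esub> y') - frag_of (x, y) - frag_of (x, y') \<in> tensor_kernel R M N"
    and tensor_rel_smult: "r \<in> carrier R \<Longrightarrow> x \<in> carrier M \<Longrightarrow> y \<in> carrier N \<Longrightarrow>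
      frag_of (r \<odot>\<^bsub>M\<^esub> x, y) - frag_of (x, r \<odot>\<^bsub>N\<^esub> y) \<in> tensor_kernel R M N"
  by (rule tensor_relators_in_kernel, unfold tensor_relators_def, blast)+

text \<open>Because 0 + 0 = 0, the additivity relator at zero entries collapses to minus the
  generator in question.\<close>

lemma
  assumes "module R M" "module R N"
  shows tensor_zero_left: "y \<in> carrier N \<Longrightarrow> frag_of (\<zero>\<^bsub>M\<^esub>, y) \<in> tensor_kernel R M N"
    and tensor_zero_right: "x \<in> carrier M \<Longrightarrow> frag_of (x, \<zero>\<^bsub>N\<^esub>) \<in> tensor_kernel R M N"
proof -
  interpret M: module R M by fact
  interpret N: module R N by fact
  show "frag_of (\<zero>\<^bsub>M\<^esub>, y) \<in> tensor_kernel R M N" if "y \<in> carrier N"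
    using tensor_kernel_uminus[OF assms tensor_rel_add_left[of "\<zero>\<^bsub>M\<^esub>" M "\<zero>\<^bsub>M\<^esub>" y N R]] that by simp
  show "frag_of (x, \<zero>\<^bsub>N\<^esub>) \<in> tensor_kernel R M N" if "x \<in> carrier M"
    using tensor_kernel_uminus[OF assms tensor_rel_add_right[of x M "\<zero>\<^bsub>N\<^esub>" N "\<zero>\<^bsub>N\<^esub>" R]] that by simp
qed

section \<open>Classes of formal sums and the maps induced on them\<close>

definition tensor_class ::
    "('r, 'm) ring_scheme \<Rightarrow> ('r, 'a) module \<Rightarrow> ('r, 'b) module \<Rightarrow> (('a \<times> 'b) \<Rightarrow>\<^sub>0 int) \<Rightarrow> (('a \<times> 'b) \<Rightarrow>\<^sub>0 int) set" where
  "tensor_class R M N w = tensor_kernel R M N #>\<^bsub>tensor_free M N\<^esub> w"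

lemma tensor_class_eq: "tensor_class R M N w = {k + w | k. k \<in> tensor_kernel R M N}"
  by (auto simp: tensor_class_def r_coset_def)

lemma tensor_class_eq_iff:
  assumes MN: "module R M" "module R N"
  shows "tensor_class R M N w = tensor_class R M N v \<longleftrightarrow> w - v \<in> tensor_kernel R M N"
proof
  assume "tensor_class R M N w = tensor_class R M N v"
  moreover have "w \<in> tensor_class R M N w"
    using tensor_kernel_0[OF MN] unfolding tensor_class_eq by force
  ultimately show "w - v \<in> tensor_kernel R M N" by (auto simp: tensor_class_eq)
next
  have sub: "tensor_class R M N w \<subseteq> tensor_class R M N v" if "w - v \<in> tensor_kernel R M N" for w v
  proof
    fix x assume "x \<in> tensor_class R M N w"
    then obtain k where k: "k \<in> tensor_kernel R M N" "x = k + w" by (auto simp: tensor_class_eq)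
    have "k + (w - v) \<in> tensor_kernel R M N" by (rule tensor_kernel_add[OF MN k(1) that])
    moreover have "x = (k + (w - v)) + v" using k by simp
    ultimately show "x \<in> tensor_class R M N v" unfolding tensor_class_eq by blast
  qed
  assume d: "w - v \<in> tensor_kernel R M N"
  have "v - w \<in> tensor_kernel R M N" using tensor_kernel_uminus[OF MN d] by simp
  with d show "tensor_class R M N w = tensor_class R M N v" using sub by blast
qed

lemma tensor_module_carrier:
  "carrier (tensor_module R M N) = {tensor_class R M N w | w. keys w \<subseteq> carrier M \<times> carrier N}"
  by (auto simp: tensor_module_def Let_def FactGroup_def RCOSETS_def tensor_class_def)

lemma tensor_module_zero:
  "\<zero>\<^bsub>tensor_module R M N\<^esub> = tensor_class R M N 0"
  by (auto simp: tensor_module_def Let_def FactGroup_def tensor_class_eq)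

definition tensor_frag :: "('a \<Rightarrow> 'c) \<Rightarrow> ('b \<Rightarrow> 'd) \<Rightarrow> (('a \<times> 'b) \<Rightarrow>\<^sub>0 int) \<Rightarrow> (('c \<times> 'd) \<Rightarrow>\<^sub>0 int)" where
  "tensor_frag f g = frag_extend (\<lambda>(x, y). frag_of (f x, g y))"

lemma tensor_frag_simps [simp]:
  "tensor_frag f g 0 = 0" "tensor_frag f g (frag_of (x, y)) = frag_of (f x, g y)"
  "tensor_frag f g (v + w) = tensor_frag f g v + tensor_frag f g w"
  "tensor_frag f g (v - w) = tensor_frag f g v - tensor_frag f g w"
  "tensor_frag f g (- w) = - tensor_frag f g w"
  by (simp_all add: tensor_frag_def frag_extend_add frag_extend_diff frag_extend_minus)

lemma tensor_frag_keys:
  assumes "keys w \<subseteq> A \<times> B" "f ` A \<subseteq> C" "g ` B \<subseteq> D"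
  shows "keys (tensor_frag f g w) \<subseteq> C \<times> D"
proof -
  have "keys (tensor_frag f g w) \<subseteq> (\<Union>p\<in>keys w. keys (case p of (x, y) \<Rightarrow> frag_of (f x, g y)))"
    unfolding tensor_frag_def by (rule keys_frag_extend)
  also have "\<dots> \<subseteq> C \<times> D"
    using assms by (fastforce simp: image_subset_iff)
  finally show ?thesis .
qed

lemma tensor_frag_cong:
  assumes "keys w \<subseteq> A \<times> B" "\<And>x. x \<in> A \<Longrightarrow> f x = f' x" "\<And>y. y \<in> B \<Longrightarrow> g y = g' y"
  shows "tensor_frag f g w = tensor_frag f' g' w"
  unfolding tensor_frag_def by (rule frag_extend_eq) (use assms in auto)

lemma tensor_frag_tensor_frag:
  "tensor_frag f' g' (tensor_frag f g w) = tensor_frag (\<lambda>x. f' (f x)) (\<lambda>y. g' (g y)) w"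
  by (induction w rule: free_Abelian_group_induct[where S = UNIV]) auto

text \<open>One notion for both kinds of maps to be tensored: homomorphisms over one ring, where
  \<open>\<theta>\<close> is the identity, and restrictions of sections, where
  \<open>\<theta>\<close> restricts the scalars.\<close>

definition semilinear ::
    "('r, 'm) ring_scheme \<Rightarrow> ('s, 'k) ring_scheme \<Rightarrow> ('r \<Rightarrow> 's) \<Rightarrow> ('r, 'a) module \<Rightarrow> ('s, 'c) module \<Rightarrow> ('a \<Rightarrow> 'c) \<Rightarrow> bool" where
  "semilinear R S \<theta> M M' f \<longleftrightarrow> f ` carrier M \<subseteq> carrier M' \<and> \<theta> ` carrier R \<subseteq> carrier S \<and>
     (\<forall>x\<in>carrier M. \<forall>y\<in>carrier M. f (x \<oplus>\<^bsub>M\<^esub> y) = f x \<oplus>\<^bsub>M'\<^esub> f y) \<and>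
     (\<forall>r\<in>carrier R. \<forall>x\<in>carrier M. f (r \<odot>\<^bsub>M\<^esub> x) = \<theta> r \<odot>\<^bsub>M'\<^esub> f x)"

lemma tensor_frag_kernel:
  assumes MN: "module R M" "module R N" and MN': "module S M'" "module S N'"
    and f: "semilinear R S \<theta> M M' f" and g: "semilinear R S \<theta> N N' g"
    and w: "w \<in> tensor_kernel R M N"
  shows "tensor_frag f g w \<in> tensor_kernel S M' N'"
proof -
  have rel: "tensor_frag f g k \<in> tensor_kernel S M' N'" if "k \<in> tensor_relators R M N" for k
    using that unfolding tensor_relators_def
  proof (elim UnE CollectE exE conjE)
    fix x x' y assume "k = frag_of (x \<oplus>\<^bsub>M\<^esub> x', y) - frag_of (x, y) - frag_of (x', y)"
      "x \<in> carrier M" "x' \<in> carrier M" "y \<in> carrier N"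
    then show ?thesis
      using f g tensor_rel_add_left[of "f x" M' "f x'" "g y" N' S] by (auto simp: semilinear_def)
  next
    fix x y y' assume "k = frag_of (x, y \<oplus>\<^bsub>N\<^esub> y') - frag_of (x, y) - frag_of (x, y')"
      "x \<in> carrier M" "y \<in> carrier N" "y' \<in> carrier N"
    then show ?thesis
      using f g tensor_rel_add_right[of "f x" M' "g y" N' "g y'" S] by (auto simp: semilinear_def)
  next
    fix r x y assume "k = frag_of (r \<odot>\<^bsub>M\<^esub> x, y) - frag_of (x, r \<odot>\<^bsub>N\<^esub> y)"
      "r \<in> carrier R" "x \<in> carrier M" "y \<in> carrier N"
    then show ?thesis
      using f g tensor_rel_smult[of "\<theta> r" S "f x" M' "g y" N'] by (auto simp: semilinear_def)
  qed
  show ?thesis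
    using w unfolding tensor_kernel_def[of R]
  proof (induction rule: generate.induct)
    case one then show ?case by (simp add: tensor_kernel_0[OF MN'])
  next
    case (incl h) then show ?case by (rule rel)
  next
    case (inv h)
    then show ?case
      using tensor_kernel_uminus[OF MN' rel[OF inv]] keys_tensor_relators[OF MN inv] by simp
  next
    case (eng h1 h2) then show ?case by (simp add: tensor_kernel_add[OF MN'])
  qed
qed

lemma tensor_map_class:
  assumes MN: "module R M" "module R N" and MN': "module S M'" "module S N'"
    and f: "semilinear R S \<theta> M M' f" and g: "semilinear R S \<theta> N N' g"
  shows "tensor_map S M' N' f g (tensor_class R M N w) = tensor_class S M' N' (tensor_frag f g w)"
proof -
  have const: "tensor_class S M' N' (tensor_frag f g v) = tensor_class S M' N' (tensor_frag f g w)"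
    if v: "v \<in> tensor_class R M N w" for v
  proof -
    obtain k where k: "k \<in> tensor_kernel R M N" "v = k + w" using v by (auto simp: tensor_class_eq)
    then show ?thesis
      using tensor_frag_kernel[OF MN MN' f g k(1)] by (simp add: tensor_class_eq_iff[OF MN'])
  qed
  have mem: "w \<in> tensor_class R M N w"
    using tensor_kernel_0[OF MN] unfolding tensor_class_eq by force
  show ?thesis
    unfolding tensor_map_def tensor_class_def[of S, symmetric] tensor_frag_def[symmetric]
    by (rule UN_constant_eq[OF mem], rule ballI, erule const)
qed

text \<open>All second entries, including the sum and the multiple, lie in \<open>Y\<close>. A
  vanishing tensor has a certificate with finite \<open>Y\<close>, and a finite set of sections fits
  into a single frame; the first entries are left free.\<close>

definition tensor_relators_over ::
    "('r, 'm) ring_scheme \<Rightarrow> ('r, 'a) module \<Rightarrow> ('r, 'b) module \<Rightarrow> 'b set \<Rightarrow> (('a \<times> 'b) \<Rightarrow>\<^sub>0 int) set" where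
  "tensor_relators_over R M N Y =
     {frag_of (x \<oplus>\<^bsub>M\<^esub> x', y) - frag_of (x, y) - frag_of (x', y) | x x' y.
        x \<in> carrier M \<and> x' \<in> carrier M \<and> y \<in> Y} \<union>
     {frag_of (x, y \<oplus>\<^bsub>N\<^esub> y') - frag_of (x, y) - frag_of (x, y') | x y y'.
        x \<in> carrier M \<and> y \<in> Y \<and> y' \<in> Y \<and> y \<oplus>\<^bsub>N\<^esub> y' \<in> Y} \<union>
     {frag_of (r \<odot>\<^bsub>M\<^esub> x, y) - frag_of (x, r \<odot>\<^bsub>N\<^esub> y) | r x y.
        r \<in> carrier R \<and> x \<in> carrier M \<and> y \<in> Y \<and> r \<odot>\<^bsub>N\<^esub> y \<in> Y}"

lemma tensor_relators_over_mono: "Y \<subseteq> Z \<Longrightarrow> tensor_relators_over R M N Y \<subseteq> tensor_relators_over R M N Z"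
  unfolding tensor_relators_over_def by blast

text \<open>An element of a generated subgroup is a word in finitely many relators; \<open>Y\<close>
  collects their second entries.\<close>

lemma tensor_kernel_finite_support:
  assumes MN: "module R M" "module R N" and "w \<in> tensor_kernel R M N"
  shows "\<exists>Y. finite Y \<and> Y \<subseteq> carrier N \<and> w \<in> generate (tensor_free M N) (tensor_relators_over R M N Y)"
proof -
  interpret N: module R N by (rule MN(2))
  have rel: "\<exists>Y. finite Y \<and> Y \<subseteq> carrier N \<and> k \<in> tensor_relators_over R M N Y"
    if "k \<in> tensor_relators R M N" for k
    using that unfolding tensor_relators_def
  proof (elim UnE CollectE exE conjE)
    fix x x' y assume "k = frag_of (x \<oplus>\<^bsub>M\<^esub> x', y) - frag_of (x, y) - frag_of (x', y)"
      "x \<in> carrier M" "x' \<in> carrier M" "y \<in> carrier N"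
    then show ?thesis
      by (intro exI[of _ "{y}"]) (simp, unfold tensor_relators_over_def, blast)
  next
    fix x y y' assume "k = frag_of (x, y \<oplus>\<^bsub>N\<^esub> y') - frag_of (x, y) - frag_of (x, y')"
      "x \<in> carrier M" "y \<in> carrier N" "y' \<in> carrier N"
    then show ?thesis
      by (intro exI[of _ "{y, y', y \<oplus>\<^bsub>N\<^esub> y'}"]) (simp, unfold tensor_relators_over_def, blast)
  next
    fix r x y assume "k = frag_of (r \<odot>\<^bsub>M\<^esub> x, y) - frag_of (x, r \<odot>\<^bsub>N\<^esub> y)"
      "r \<in> carrier R" "x \<in> carrier M" "y \<in> carrier N"
    then show ?thesis
      by (intro exI[of _ "{y, r \<odot>\<^bsub>N\<^esub> y}"]) (simp, unfold tensor_relators_over_def, blast)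
  qed
  show ?thesis
    using assms(3) unfolding tensor_kernel_def
  proof (induction rule: generate.induct)
    case one
    show ?case by (intro exI[of _ "{}"] conjI generate.one) auto
  next
    case (incl h) then show ?case using rel generate.incl by metis
  next
    case (inv h) then show ?case using rel generate.inv by metis
  next
    case (eng h1 h2)
    then obtain Y1 Y2 where Y: "finite Y1" "Y1 \<subseteq> carrier N" "finite Y2" "Y2 \<subseteq> carrier N"
      "h1 \<in> generate (tensor_free M N) (tensor_relators_over R M N Y1)"
      "h2 \<in> generate (tensor_free M N) (tensor_relators_over R M N Y2)" by blast
    have "generate (tensor_free M N) (tensor_relators_over R M N Y) \<subseteq>
        generate (tensor_free M N) (tensor_relators_over R M N (Y1 \<union> Y2))" if "Y \<subseteq> Y1 \<union> Y2" for Y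
      by (rule group.mono_generate) (use tensor_relators_over_mono[OF that] in auto)
    then show ?case
      using Y by (intro exI[of _ "Y1 \<union> Y2"] conjI generate.eng) auto
  qed
qed

text \<open>The universal property of the tensor product, relative to \<open>Y\<close>. It is stated
  for homomorphisms on the free group because frame coordinates are available, and linear, only on a
  finite set of sections, which is no submodule.\<close>

lemma hom_tensor_relators_over:
  assumes MN: "module R M" "module R N" and P: "abelian_group P"
    and h: "h \<in> hom (tensor_free M N) (add_monoid P)"
    and Y: "Y \<subseteq> carrier N"
    and add_left: "\<And>x x' y. x \<in> carrier M \<Longrightarrow> x' \<in> carrier M \<Longrightarrow> y \<in> Y \<Longrightarrow>
      h (frag_of (x \<oplus>\<^bsub>M\<^esub> x', y)) = h (frag_of (x, y)) \<oplus>\<^bsub>P\<^esub> h (frag_of (x', y))"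
    and add_right: "\<And>x y y'. x \<in> carrier M \<Longrightarrow> y \<in> Y \<Longrightarrow> y' \<in> Y \<Longrightarrow> y \<oplus>\<^bsub>N\<^esub> y' \<in> Y \<Longrightarrow>
      h (frag_of (x, y \<oplus>\<^bsub>N\<^esub> y')) = h (frag_of (x, y)) \<oplus>\<^bsub>P\<^esub> h (frag_of (x, y'))"
    and smult: "\<And>r x y. r \<in> carrier R \<Longrightarrow> x \<in> carrier M \<Longrightarrow> y \<in> Y \<Longrightarrow> r \<odot>\<^bsub>N\<^esub> y \<in> Y \<Longrightarrow>
      h (frag_of (r \<odot>\<^bsub>M\<^esub> x, y)) = h (frag_of (x, r \<odot>\<^bsub>N\<^esub> y))"
    and w: "w \<in> generate (tensor_free M N) (tensor_relators_over R M N Y)"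
  shows "h w = \<zero>\<^bsub>P\<^esub>"
proof -
  interpret P: abelian_group P by fact
  interpret M: module R M by (rule MN(1))
  interpret N: module R N by (rule MN(2))
  have hc: "h a \<in> carrier P" if "keys a \<subseteq> carrier M \<times> carrier N" for a
    using h that by (auto simp: hom_def Pi_iff)
  have hadd: "h (a + b) = h a \<oplus>\<^bsub>P\<^esub> h b"
    if "keys a \<subseteq> carrier M \<times> carrier N" "keys b \<subseteq> carrier M \<times> carrier N" for a b
    using h that by (simp add: hom_def)
  have ksub: "keys (a - b) \<subseteq> carrier M \<times> carrier N"
    if "keys a \<subseteq> carrier M \<times> carrier N" "keys b \<subseteq> carrier M \<times> carrier N" for a b
    using that keys_diff[of a b] by blast
  have h0: "h (a - b) = \<zero>\<^bsub>P\<^esub>"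
    if "keys a \<subseteq> carrier M \<times> carrier N" "keys b \<subseteq> carrier M \<times> carrier N" "h a = h b" for a b
  proof -
    have "h (a - b) \<oplus>\<^bsub>P\<^esub> h b = h b" using hadd[OF ksub[OF that(1,2)] that(2)] that(3) by simp
    then show ?thesis using hc[OF that(2)] hc[OF ksub[OF that(1,2)]] P.add.r_cancel_one[of "h b" "h (a - b)"] by simp
  qed
  have kadd: "keys (a + b) \<subseteq> carrier M \<times> carrier N"
    if "keys a \<subseteq> carrier M \<times> carrier N" "keys b \<subseteq> carrier M \<times> carrier N" for a b
    using that keys_add[of a b] by blast
  have rel: "h k = \<zero>\<^bsub>P\<^esub> \<and> keys k \<subseteq> carrier M \<times> carrier N" if "k \<in> tensor_relators_over R M N Y" for k
    using that unfolding tensor_relators_over_def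
  proof (elim UnE CollectE exE conjE)
    fix x x' y assume k: "k = frag_of (x \<oplus>\<^bsub>M\<^esub> x', y) - frag_of (x, y) - frag_of (x', y)"
      and x: "x \<in> carrier M" "x' \<in> carrier M" "y \<in> Y"
    have ks: "keys (frag_of (x \<oplus>\<^bsub>M\<^esub> x', y)) \<subseteq> carrier M \<times> carrier N" "keys (frag_of (x, y)) \<subseteq> carrier M \<times> carrier N"
      "keys (frag_of (x', y)) \<subseteq> carrier M \<times> carrier N" using x Y by auto
    have k': "k = frag_of (x \<oplus>\<^bsub>M\<^esub> x', y) - (frag_of (x, y) + frag_of (x', y))" by (simp add: k)
    show ?thesis unfolding k'
      by (intro conjI h0 ksub kadd ks) (simp add: hadd[OF ks(2,3)] add_left x)
  next
    fix x y y' assume k: "k = frag_of (x, y \<oplus>\<^bsub>N\<^esub> y') - frag_of (x, y) - frag_of (x, y')"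
      and x: "x \<in> carrier M" "y \<in> Y" "y' \<in> Y" "y \<oplus>\<^bsub>N\<^esub> y' \<in> Y"
    have ks: "keys (frag_of (x, y \<oplus>\<^bsub>N\<^esub> y')) \<subseteq> carrier M \<times> carrier N" "keys (frag_of (x, y)) \<subseteq> carrier M \<times> carrier N"
      "keys (frag_of (x, y')) \<subseteq> carrier M \<times> carrier N" using x Y by auto
    have k': "k = frag_of (x, y \<oplus>\<^bsub>N\<^esub> y') - (frag_of (x, y) + frag_of (x, y'))" by (simp add: k)
    show ?thesis unfolding k'
      by (intro conjI h0 ksub kadd ks) (simp add: hadd[OF ks(2,3)] add_right x)
  next
    fix r x y assume k: "k = frag_of (r \<odot>\<^bsub>M\<^esub> x, y) - frag_of (x, r \<odot>\<^bsub>N\<^esub> y)"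
      and x: "r \<in> carrier R" "x \<in> carrier M" "y \<in> Y" "r \<odot>\<^bsub>N\<^esub> y \<in> Y"
    have ks: "keys (frag_of (r \<odot>\<^bsub>M\<^esub> x, y)) \<subseteq> carrier M \<times> carrier N"
      "keys (frag_of (x, r \<odot>\<^bsub>N\<^esub> y)) \<subseteq> carrier M \<times> carrier N" using x Y by auto
    show ?thesis unfolding k by (intro conjI h0 ksub ks smult x)
  qed
  have h00: "h 0 = \<zero>\<^bsub>P\<^esub>" using h0[of 0 0] by simp
  have "h w = \<zero>\<^bsub>P\<^esub> \<and> keys w \<subseteq> carrier M \<times> carrier N"
    using w
  proof (induction rule: generate.induct)
    case one then show ?case by (simp add: h00)
  next
    case (incl h) then show ?case by (rule rel)
  next
    case (inv k)
    then have k: "h k = \<zero>\<^bsub>P\<^esub>" "keys k \<subseteq> carrier M \<times> carrier N" using rel by auto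
    then show ?case using h0[of 0 k] h00 by simp
  next
    case (eng h1 h2) then show ?case by (simp add: hadd kadd)
  qed
  then show ?thesis by simp
qed

section \<open>Flatness of plain sheaves\<close>

lemma tensor_presheaf_simps [simp]:
  "sec (tensor_presheaf A B) U = tensor_module (hol_ring U) (sec A U) (sec B U)"
  "res (tensor_presheaf A B) U V = tensor_map (hol_ring V) (sec A V) (sec B V) (res A U V) (res B U V)"
  by (simp_all add: tensor_presheaf_def)

section \<open>Functoriality of the tensor presheaf\<close>

lemma semilinear_res:
  assumes A: "O_presheaf \<Omega> A" and UV: "open U" "open V" "V \<subseteq> U" "U \<subseteq> \<Omega>"
  shows "semilinear (hol_ring U) (hol_ring V) (\<lambda>c. restrict c V) (sec A U) (sec A V) (res A U V)"
  unfolding semilinear_def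
  using O_presheaf.res_closed[OF A UV] O_presheaf.res_add[OF A UV] O_presheaf.res_smult[OF A UV]
    hol_sections_restrict[OF UV(1,3,2)] by auto

lemma semilinear_hom:
  assumes "sheaf_hom \<Omega> A B \<phi>" and U: "open U" "U \<subseteq> \<Omega>"
  shows "semilinear (hol_ring U) (hol_ring U) (\<lambda>c. c) (sec A U) (sec B U) (\<phi> U)"
  using assms unfolding semilinear_def sheaf_hom_def by auto

lemma semilinear_id: "semilinear R R (\<lambda>c. c) M M (\<lambda>x. x)"
  by (simp add: semilinear_def)

lemma sheaf_hom_res:
  assumes "sheaf_hom \<Omega> A B \<phi>" "open U" "U \<subseteq> \<Omega>" "open V" "V \<subseteq> U" "s \<in> carrier (sec A U)"
  shows "\<phi> V (res A U V s) = res B U V (\<phi> U s)"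
  using assms by (simp add: sheaf_hom_def)

lemma sheaf_hom_closed:
  assumes "sheaf_hom \<Omega> A B \<phi>" "open U" "U \<subseteq> \<Omega>" "s \<in> carrier (sec A U)"
  shows "\<phi> U s \<in> carrier (sec B U)"
  using assms by (simp add: sheaf_hom_def Pi_iff)

lemma sheaf_hom_add:
  assumes "sheaf_hom \<Omega> A B \<phi>" "open U" "U \<subseteq> \<Omega>" "s \<in> carrier (sec A U)" "t \<in> carrier (sec A U)"
  shows "\<phi> U (s \<oplus>\<^bsub>sec A U\<^esub> t) = \<phi> U s \<oplus>\<^bsub>sec B U\<^esub> \<phi> U t"
  using assms by (simp add: sheaf_hom_def)

lemma sheaf_hom_smult:
  assumes "sheaf_hom \<Omega> A B \<phi>" "open U" "U \<subseteq> \<Omega>" "c \<in> carrier (hol_ring U)" "s \<in> carrier (sec A U)"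
  shows "\<phi> U (c \<odot>\<^bsub>sec A U\<^esub> s) = c \<odot>\<^bsub>sec B U\<^esub> \<phi> U s"
  using assms by (simp add: sheaf_hom_def)

lemma tensor_res_class:
  assumes A: "O_presheaf \<Omega> A" and B: "O_presheaf \<Omega> B" and UV: "open U" "open V" "V \<subseteq> U" "U \<subseteq> \<Omega>"
  shows "res (tensor_presheaf A B) U V (tensor_class (hol_ring U) (sec A U) (sec B U) w) =
    tensor_class (hol_ring V) (sec A V) (sec B V) (tensor_frag (res A U V) (res B U V) w)"
  unfolding tensor_presheaf_simps
  by (rule tensor_map_class[OF _ _ _ _ semilinear_res[OF A UV] semilinear_res[OF B UV]])
    (use UV in \<open>auto intro!: O_presheaf.sec_module[OF A] O_presheaf.sec_module[OF B]\<close>)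

lemma tensor_hom_class:
  assumes A: "O_presheaf \<Omega> A" and B: "O_presheaf \<Omega> B" and F: "O_presheaf \<Omega> F"
    and \<phi>: "sheaf_hom \<Omega> A B \<phi>" and U: "open U" "U \<subseteq> \<Omega>"
  shows "tensor_map (hol_ring U) (sec B U) (sec F U) (\<phi> U) (\<lambda>f. f) (tensor_class (hol_ring U) (sec A U) (sec F U) w) =
    tensor_class (hol_ring U) (sec B U) (sec F U) (tensor_frag (\<phi> U) (\<lambda>f. f) w)"
  by (rule tensor_map_class[OF _ _ _ _ semilinear_hom[OF \<phi> U] semilinear_id])
    (use U in \<open>auto intro!: O_presheaf.sec_module[OF A] O_presheaf.sec_module[OF B] O_presheaf.sec_module[OF F]\<close>)

lemma functorial_tensor_presheaf:
  assumes A: "O_presheaf \<Omega> A" and B: "O_presheaf \<Omega> B"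
  shows "functorial \<Omega> (tensor_presheaf A B)"
  unfolding functorial_def
proof (intro conjI allI impI; elim conjE)
  fix U V s assume UV: "open U" "open V" "V \<subseteq> U" "U \<subseteq> \<Omega>" and s: "s \<in> carrier (sec (tensor_presheaf A B) U)"
  obtain w where w: "keys w \<subseteq> carrier (sec A U) \<times> carrier (sec B U)" "s = tensor_class (hol_ring U) (sec A U) (sec B U) w"
    using s unfolding tensor_presheaf_simps tensor_module_carrier by blast
  have "keys (tensor_frag (res A U V) (res B U V) w) \<subseteq> carrier (sec A V) \<times> carrier (sec B V)"
    using O_presheaf.res_closed[OF A UV] O_presheaf.res_closed[OF B UV]
    by (intro tensor_frag_keys[OF w(1)]) auto
  then show "res (tensor_presheaf A B) U V s \<in> carrier (sec (tensor_presheaf A B) V)"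
    unfolding w(2) tensor_res_class[OF A B UV] unfolding tensor_presheaf_simps tensor_module_carrier by blast
next
  fix U V W s assume UVW: "open U" "open V" "open W" "W \<subseteq> V" "V \<subseteq> U" "U \<subseteq> \<Omega>"
    and s: "s \<in> carrier (sec (tensor_presheaf A B) U)"
  have V: "V \<subseteq> \<Omega>" and W: "W \<subseteq> U" using UVW by auto
  obtain w where w: "keys w \<subseteq> carrier (sec A U) \<times> carrier (sec B U)" "s = tensor_class (hol_ring U) (sec A U) (sec B U) w"
    using s unfolding tensor_presheaf_simps tensor_module_carrier by blast
  have "tensor_frag (\<lambda>x. res A V W (res A U V x)) (\<lambda>x. res B V W (res B U V x)) w = tensor_frag (res A U W) (res B U W) w"
    by (rule tensor_frag_cong[OF w(1)])
      (auto intro: O_presheaf.res_res[OF A UVW] O_presheaf.res_res[OF B UVW])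
  then show "res (tensor_presheaf A B) V W (res (tensor_presheaf A B) U V s) = res (tensor_presheaf A B) U W s"
    unfolding w(2) tensor_res_class[OF A B UVW(1,2,5,6)] tensor_res_class[OF A B UVW(2,3,4) V]
      tensor_res_class[OF A B UVW(1,3) W UVW(6)] tensor_frag_tensor_frag by simp
qed

lemma natural_tensor_map:
  assumes A: "O_presheaf \<Omega> A" and B: "O_presheaf \<Omega> B" and F: "O_presheaf \<Omega> F" and \<phi>: "sheaf_hom \<Omega> A B \<phi>"
  shows "natural_map \<Omega> (tensor_presheaf A F) (tensor_presheaf B F)
    (\<lambda>U. tensor_map (hol_ring U) (sec B U) (sec F U) (\<phi> U) (\<lambda>f. f))"
  unfolding natural_map_def
proof (intro allI impI conjI; elim conjE)
  fix U s assume U: "open U" "U \<subseteq> \<Omega>" and s: "s \<in> carrier (sec (tensor_presheaf A F) U)"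
  obtain w where w: "keys w \<subseteq> carrier (sec A U) \<times> carrier (sec F U)" "s = tensor_class (hol_ring U) (sec A U) (sec F U) w"
    using s unfolding tensor_presheaf_simps tensor_module_carrier by blast
  have "keys (tensor_frag (\<phi> U) (\<lambda>f. f) w) \<subseteq> carrier (sec B U) \<times> carrier (sec F U)"
    using sheaf_hom_closed[OF \<phi> U] by (intro tensor_frag_keys[OF w(1)]) auto
  then show "tensor_map (hol_ring U) (sec B U) (sec F U) (\<phi> U) (\<lambda>f. f) s \<in> carrier (sec (tensor_presheaf B F) U)"
    unfolding w(2) tensor_hom_class[OF A B F \<phi> U] tensor_presheaf_simps tensor_module_carrier by blast
  fix V assume V: "open V" "V \<subseteq> U"
  have V\<Omega>: "V \<subseteq> \<Omega>" using V U by blast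
  have "tensor_frag (\<lambda>x. \<phi> V (res A U V x)) (\<lambda>x. res F U V x) w = tensor_frag (\<lambda>x. res B U V (\<phi> U x)) (\<lambda>x. res F U V x) w"
    by (rule tensor_frag_cong[OF w(1)]) (auto intro: sheaf_hom_res[OF \<phi> U V])
  then show "tensor_map (hol_ring V) (sec B V) (sec F V) (\<phi> V) (\<lambda>f. f) (res (tensor_presheaf A F) U V s) =
      res (tensor_presheaf B F) U V (tensor_map (hol_ring U) (sec B U) (sec F U) (\<phi> U) (\<lambda>f. f) s)"
    unfolding w(2) tensor_res_class[OF A F U(1) V U(2)] tensor_hom_class[OF A B F \<phi> U]
      tensor_hom_class[OF A B F \<phi> V(1) V\<Omega>] tensor_res_class[OF B F U(1) V U(2)] tensor_frag_tensor_frag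
    by simp
qed

text \<open>Freeness allows \<open>co\<close> to be an arbitrary ring-valued function. In
  \<open>tensor_lift\<close> it is a coordinate with respect to a frame, for which linearity is
  known on a finite set only.\<close>

lemma tensor_coordinate_hom:
  assumes P: "module R P" and co: "\<And>y. co y \<in> carrier R" and r: "\<And>x. x \<in> S \<Longrightarrow> r x \<in> carrier P"
  obtains h where "h \<in> hom (free_Abelian_group (S \<times> T)) (add_monoid P)"
    "\<And>x y. x \<in> S \<Longrightarrow> y \<in> T \<Longrightarrow> h (frag_of (x, y)) = co y \<odot>\<^bsub>P\<^esub> r x"
proof -
  interpret P: module R P by fact
  have "(\<lambda>(x, y). co y \<odot>\<^bsub>P\<^esub> r x) ` (S \<times> T) \<subseteq> carrier (add_monoid P)"
    using co r by auto
  from comm_group.free_Abelian_group_universal[OF P.a_comm_group this]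
  obtain h where h: "h \<in> hom (free_Abelian_group (S \<times> T)) (add_monoid P)"
    "\<And>p. p \<in> S \<times> T \<Longrightarrow> h (frag_of p) = (\<lambda>(x, y). co y \<odot>\<^bsub>P\<^esub> r x) p" by blast
  show thesis by (rule that[OF h(1)]) (simp add: h(2))
qed

lemma hom_add_monoid:
  assumes P: "abelian_group P" and h: "h \<in> hom (free_Abelian_group S) (add_monoid P)"
  shows hom_add_monoid_closed: "keys v \<subseteq> S \<Longrightarrow> h v \<in> carrier P"
    and hom_add_monoid_0: "h 0 = \<zero>\<^bsub>P\<^esub>"
    and hom_add_monoid_diff: "keys v \<subseteq> S \<Longrightarrow> keys w \<subseteq> S \<Longrightarrow> h (v - w) \<oplus>\<^bsub>P\<^esub> h w = h v"
proof -
  interpret P: abelian_group P by fact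
  have add: "h (a + b) = h a \<oplus>\<^bsub>P\<^esub> h b" if "keys a \<subseteq> S" "keys b \<subseteq> S" for a b
    using h that by (simp add: hom_def)
  show c: "h v \<in> carrier P" if "keys v \<subseteq> S" for v
    using h that by (auto simp: hom_def Pi_iff)
  have c0: "h 0 \<in> carrier P" by (rule c) simp
  have "h (0 + 0) = h 0 \<oplus>\<^bsub>P\<^esub> h 0" by (rule add) simp_all
  then have "h 0 \<oplus>\<^bsub>P\<^esub> h 0 = h 0" unfolding add_0_left by (rule sym)
  with c0 c0 show "h 0 = \<zero>\<^bsub>P\<^esub>" by (rule P.add.r_cancel_one[THEN iffD1])
  show "h (v - w) \<oplus>\<^bsub>P\<^esub> h w = h v" if "keys v \<subseteq> S" "keys w \<subseteq> S" for v w
  proof -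
    have "keys (v - w) \<subseteq> S" using that keys_diff[of v w] by blast
    from add[OF this that(2)] show ?thesis unfolding diff_add_cancel by (rule sym)
  qed
qed

lemma abelian_group_idem_zero:
  assumes "abelian_group P" "x \<in> carrier P" "x \<oplus>\<^bsub>P\<^esub> x = x"
  shows "x = \<zero>\<^bsub>P\<^esub>"
proof -
  interpret P: abelian_group P by fact
  show ?thesis using assms(2,2,3) by (rule P.add.r_cancel_one[THEN iffD1])
qed

lemma O_presheaf_abelian_group:
  assumes "O_presheaf \<Omega> A" "open U" "U \<subseteq> \<Omega>"
  shows "abelian_group (sec A U)"
  by (rule module.axioms(2)[OF O_presheaf.sec_module[OF assms]])

lemma O_presheaf_zero_closed:
  assumes "O_presheaf \<Omega> A" "open U" "U \<subseteq> \<Omega>"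
  shows "\<zero>\<^bsub>sec A U\<^esub> \<in> carrier (sec A U)"
proof -
  interpret abelian_group "sec A U" by (rule O_presheaf_abelian_group[OF assms])
  show ?thesis by simp
qed

lemma O_presheaf_zero_add:
  assumes "O_presheaf \<Omega> A" "open U" "U \<subseteq> \<Omega>"
  shows "\<zero>\<^bsub>sec A U\<^esub> \<oplus>\<^bsub>sec A U\<^esub> \<zero>\<^bsub>sec A U\<^esub> = \<zero>\<^bsub>sec A U\<^esub>"
proof -
  interpret abelian_group "sec A U" by (rule O_presheaf_abelian_group[OF assms])
  show ?thesis by simp
qed

lemma sheaf_hom_zero:
  assumes A: "O_presheaf \<Omega> A" and B: "O_presheaf \<Omega> B" and \<phi>: "sheaf_hom \<Omega> A B \<phi>" and U: "open U" "U \<subseteq> \<Omega>"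
  shows "\<phi> U \<zero>\<^bsub>sec A U\<^esub> = \<zero>\<^bsub>sec B U\<^esub>"
proof (rule abelian_group_idem_zero[OF O_presheaf_abelian_group[OF B U]])
  note z = O_presheaf_zero_closed[OF A U]
  show "\<phi> U \<zero>\<^bsub>sec A U\<^esub> \<in> carrier (sec B U)" by (rule sheaf_hom_closed[OF \<phi> U z])
  show "\<phi> U \<zero>\<^bsub>sec A U\<^esub> \<oplus>\<^bsub>sec B U\<^esub> \<phi> U \<zero>\<^bsub>sec A U\<^esub> = \<phi> U \<zero>\<^bsub>sec A U\<^esub>"
    using sheaf_hom_add[OF \<phi> U z z] by (simp only: O_presheaf_zero_add[OF A U])
qed

lemma res_zero:
  assumes A: "O_presheaf \<Omega> A" and UV: "open U" "open V" "V \<subseteq> U" "U \<subseteq> \<Omega>"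
  shows "res A U V \<zero>\<^bsub>sec A U\<^esub> = \<zero>\<^bsub>sec A V\<^esub>"
proof (rule abelian_group_idem_zero)
  note z = O_presheaf_zero_closed[OF A UV(1,4)]
  show "abelian_group (sec A V)" by (rule O_presheaf_abelian_group[OF A UV(2)]) (use UV in auto)
  show "res A U V \<zero>\<^bsub>sec A U\<^esub> \<in> carrier (sec A V)" by (rule O_presheaf.res_closed[OF A UV z])
  show "res A U V \<zero>\<^bsub>sec A U\<^esub> \<oplus>\<^bsub>sec A V\<^esub> res A U V \<zero>\<^bsub>sec A U\<^esub> = res A U V \<zero>\<^bsub>sec A U\<^esub>"
    using O_presheaf.res_add[OF A UV z z] by (simp only: O_presheaf_zero_add[OF A UV(1,4)])
qed

lemma tensor_kernel_sum:
  assumes "module R M" "module R N" "\<And>i. i \<in> I \<Longrightarrow> k i \<in> tensor_kernel R M N"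
  shows "(\<Sum>i\<in>I. k i) \<in> tensor_kernel R M N"
  using assms(3)
  by (induction I rule: infinite_finite_induct)
    (simp_all add: tensor_kernel_0[OF assms(1,2)] tensor_kernel_add[OF assms(1,2)])

lemma tensor_frag_sum: "tensor_frag f g (\<Sum>i\<in>I. k i) = (\<Sum>i\<in>I. tensor_frag f g (k i))"
  by (induction I rule: infinite_finite_induct) auto

lemma tensor_frag_zero_kernel:
  assumes MN: "module R M" "module R N" and w: "keys w \<subseteq> S \<times> carrier N" and f: "\<And>x. x \<in> S \<Longrightarrow> f x = \<zero>\<^bsub>M\<^esub>"
  shows "tensor_frag f (\<lambda>y. y) w \<in> tensor_kernel R M N"
proof (rule free_Abelian_group_induct[OF w])
  show "tensor_frag f (\<lambda>y. y) 0 \<in> tensor_kernel R M N" by (simp add: tensor_kernel_0[OF MN])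
  show "tensor_frag f (\<lambda>y. y) (v - v') \<in> tensor_kernel R M N"
    if "tensor_frag f (\<lambda>y. y) v \<in> tensor_kernel R M N" "tensor_frag f (\<lambda>y. y) v' \<in> tensor_kernel R M N" for v v'
    using tensor_kernel_diff[OF MN that] by simp
  show "tensor_frag f (\<lambda>y. y) (frag_of p) \<in> tensor_kernel R M N" if "p \<in> S \<times> carrier N" for p
    using that by (cases p) (auto simp: f tensor_zero_left[OF MN])
qed

text \<open>The coefficients move across the tensor sign one term at a time. The additivity relator
  applies only if the partial sums are sections, hence the conjunction.\<close>

lemma tensor_smult_sum:
  fixes M :: "(complex ^ 'n::finite \<Rightarrow> complex, 'b) module" and q :: "nat \<Rightarrow> complex ^ 'n \<Rightarrow> 'e::complex_banach"
  assumes W: "open W" and M: "module (hol_ring W) M" and \<beta>: "\<beta> \<in> carrier M"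
    and c: "\<And>j. j < n \<Longrightarrow> c j \<in> hol_sections W" and q: "\<And>j. j < n \<Longrightarrow> q j \<in> hol_sections W"
  shows "(\<lambda>z\<in>W. \<Sum>j<n. c j z *\<^sub>C q j z) \<in> hol_sections W \<and>
    (\<Sum>j<n. frag_of (c j \<odot>\<^bsub>M\<^esub> \<beta>, q j)) - frag_of (\<beta>, \<lambda>z\<in>W. \<Sum>j<n. c j z *\<^sub>C q j z)
      \<in> tensor_kernel (hol_ring W) M (sec plain_sheaf W)"
  using c q
proof (induction n)
  let ?K = "tensor_kernel (hol_ring W) M (sec (plain_sheaf :: ('n, complex ^ 'n \<Rightarrow> 'e) mod_presheaf) W)"
  note N = module_plain_sheaf[OF W, where 'e = 'e]
  {
    case 0
    have "frag_of (\<beta>, \<lambda>z\<in>W. 0) \<in> ?K"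
      using tensor_zero_right[OF M N \<beta>] by simp
    from tensor_kernel_uminus[OF M N this]
    have "0 - frag_of (\<beta>, \<lambda>z\<in>W. 0) \<in> ?K" by (simp only: diff_0)
    with hol_sections_const[OF W, of 0] show ?case by (simp only: lessThan_0 sum.empty simp_thms)
  next
    case (Suc n)
    let ?p = "\<lambda>n. \<lambda>z\<in>W. \<Sum>j<n. c j z *\<^sub>C q j z"
    let ?d = "\<lambda>z\<in>W. c n z *\<^sub>C q n z"
    have "?p n \<in> hol_sections W \<and> (\<Sum>j<n. frag_of (c j \<odot>\<^bsub>M\<^esub> \<beta>, q j)) - frag_of (\<beta>, ?p n) \<in> ?K"
      by (rule Suc.IH) (simp_all add: Suc.prems)
    note IH = conjunct1[OF this] conjunct2[OF this]
    have cn: "c n \<in> hol_sections W" and qn: "q n \<in> hol_sections W" using Suc.prems by auto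
    have d: "?d \<in> hol_sections W" by (rule hol_sections_scaleC[OF W cn qn])
    have p: "?p (Suc n) = (\<lambda>z\<in>W. ?p n z + ?d z)" by (auto simp: fun_eq_iff)
    have 1: "frag_of (c n \<odot>\<^bsub>M\<^esub> \<beta>, q n) - frag_of (\<beta>, ?d) \<in> ?K"
      using tensor_rel_smult[of "c n" "hol_ring W" \<beta> M "q n" "sec plain_sheaf W"] cn qn \<beta> by simp
    have 2: "frag_of (\<beta>, ?p (Suc n)) - frag_of (\<beta>, ?p n) - frag_of (\<beta>, ?d) \<in> ?K"
      unfolding p using tensor_rel_add_right[of \<beta> M "?p n" "sec plain_sheaf W" ?d "hol_ring W"] IH(1) d \<beta> by simp
    let ?S = "\<lambda>n. \<Sum>j<n. frag_of (c j \<odot>\<^bsub>M\<^esub> \<beta>, q j)"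
    have "(?S n - frag_of (\<beta>, ?p n)) + (frag_of (c n \<odot>\<^bsub>M\<^esub> \<beta>, q n) - frag_of (\<beta>, ?d))
        - (frag_of (\<beta>, ?p (Suc n)) - frag_of (\<beta>, ?p n) - frag_of (\<beta>, ?d)) \<in> ?K"
      by (intro tensor_kernel_diff[OF M N] tensor_kernel_add[OF M N] IH(2) 1 2)
    moreover have "(s - p) + (t - d) - (p' - p - d) = (s + t) - p'" for s t p p' d :: "('b \<times> (complex ^ 'n \<Rightarrow> 'e)) \<Rightarrow>\<^sub>0 int"
      by simp
    ultimately have "?S (Suc n) - frag_of (\<beta>, ?p (Suc n)) \<in> ?K"
      by (simp only: sum.lessThan_Suc)
    moreover have "?p (Suc n) \<in> hol_sections W"
      unfolding p by (rule hol_sections_add[OF W IH(1) d])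
    ultimately show ?case by (intro conjI)
  }
qed

text \<open>Only finitely many elements of the plain sheaf occur in a proof that a tensor vanishes. Near \<open>x\<close>
  they lie in the span of a frame, and comparing coordinates shows that the coordinates of the
  tensor are in the kernel of \<open>\<psi>\<close>, hence in the image of \<open>\<phi>\<close>.\<close>

theorem tensor_lift:
  fixes A :: "('n::finite, 'a) mod_presheaf" and B :: "('n, 'b) mod_presheaf" and C :: "('n, 'c) mod_presheaf"
    and w :: "('b \<times> (complex ^ 'n \<Rightarrow> 'e::complex_banach)) \<Rightarrow>\<^sub>0 int"
  assumes A: "O_presheaf \<Omega> A" and B: "O_presheaf \<Omega> B" and C: "O_presheaf \<Omega> C"
    and \<phi>: "sheaf_hom \<Omega> A B \<phi>" and \<psi>: "sheaf_hom \<Omega> B C \<psi>" and ex: "exact_sheaf_seq \<Omega> A \<phi> B \<psi> C"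
    and U: "open U" "U \<subseteq> \<Omega>" and x: "x \<in> U"
    and w: "keys w \<subseteq> carrier (sec B U) \<times> hol_sections U"
    and T: "tensor_frag (\<psi> U) (\<lambda>f. f) w \<in> tensor_kernel (hol_ring U) (sec C U) (sec plain_sheaf U)"
  shows "\<exists>W t. open W \<and> x \<in> W \<and> W \<subseteq> U \<and> keys t \<subseteq> carrier (sec A W) \<times> hol_sections W \<and>
    tensor_frag (\<phi> W) (\<lambda>f. f) t - tensor_frag (res B U W) (\<lambda>f. restrict f W) w
      \<in> tensor_kernel (hol_ring W) (sec B W) (sec plain_sheaf W)"
proof -
  let ?F = "plain_sheaf :: ('n, complex ^ 'n \<Rightarrow> 'e) mod_presheaf"
  note CU = O_presheaf.sec_module[OF C U] and FU = module_plain_sheaf[OF U(1), where 'e = 'e]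
  obtain Y1 where Y1: "finite Y1" "Y1 \<subseteq> carrier (sec ?F U)"
    "tensor_frag (\<psi> U) (\<lambda>f. f) w \<in> generate (tensor_free (sec C U) (sec ?F U)) (tensor_relators_over (hol_ring U) (sec C U) (sec ?F U) Y1)"
    using tensor_kernel_finite_support[OF CU FU T] by blast
  \<comment> \<open>Besides the entries occurring in the relators, \<open>Y\<close> contains those
    of \<open>w\<close>, since \<open>w\<close> itself has to be written in the frame.\<close>
  define Y where "Y = Y1 \<union> snd ` keys w"
  have Y: "finite Y" "Y \<subseteq> hol_sections U" "keys w \<subseteq> carrier (sec B U) \<times> Y"
    using Y1 w by (force simp: Y_def)+
  have TY: "tensor_frag (\<psi> U) (\<lambda>f. f) w \<in> generate (tensor_free (sec C U) (sec ?F U)) (tensor_relators_over (hol_ring U) (sec C U) (sec ?F U) Y)"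
    by (rule subsetD[OF group.mono_generate[OF group_free_Abelian_group tensor_relators_over_mono] Y1(3)])
      (simp add: Y_def)
  obtain idx where idx: "bij_betw idx Y {0..<card Y}" using ex_bij_betw_finite_nat[OF Y(1)] by blast
  define f where "f = inv_into Y idx"
  have fY: "f i \<in> hol_sections U" if "i < card Y" for i
    using inv_into_into[of i idx Y] idx that Y(2) by (auto simp: f_def bij_betw_def)
  have fidx: "f (idx y) = y" "idx y < card Y" if "y \<in> Y" for y
    using idx that by (auto simp: f_def bij_betw_def)
  obtain V m a q where xV: "x \<in> V" and VU: "V \<subseteq> U" and q: "frame V m q"
    and a: "\<And>i j z. i < card Y \<Longrightarrow> j < m \<Longrightarrow> z \<in> V \<Longrightarrow> cdiff (a j i) z"
    and fa: "\<And>i z. i < card Y \<Longrightarrow> z \<in> V \<Longrightarrow> f i z = (\<Sum>j<m. a j i z *\<^sub>C q j z)"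
    by (rule local_frame[OF U(1) x, where k = "card Y" and f = f]) (assumption | rule fY | rule that)+
  have V: "open V" "V \<subseteq> \<Omega>" using q VU U by (auto simp: frame_def)
  \<comment> \<open>The default 0 off \<open>Y\<close> keeps \<open>co j\<close> ring-valued
    everywhere; linearity is claimed only for arguments and results in \<open>Y\<close>.\<close>
  define co where "co j y = (if j < m \<and> y \<in> Y then restrict (a j (idx y)) V else (\<lambda>z\<in>V. 0))" for j y
  have coV: "co j y \<in> hol_sections V" for j y
    using a fidx(2) hol_sections_const[OF V(1)] by (auto simp: co_def cdiff_const intro!: restrict_in_hol_sections[OF V(1)])
  have yco: "y z = (\<Sum>j<m. co j y z *\<^sub>C q j z)" if "y \<in> Y" "z \<in> V" for y z
    using fa[of "idx y" z] fidx[OF that(1)] that by (simp add: co_def)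
  have co_unique: "co j y = c j" if y: "y \<in> Y" and j: "j < m" and c: "\<And>j. j < m \<Longrightarrow> c j \<in> hol_sections V"
    and e: "\<And>z. z \<in> V \<Longrightarrow> y z = (\<Sum>j<m. c j z *\<^sub>C q j z)" for y j c
  proof (rule hol_sections_eqI[OF coV c[OF j]])
    fix z assume z: "z \<in> V"
    show "co j y z = c j z"
      by (rule frame_unique[OF q z _ j, where t = "\<lambda>j. co j y z" and u = "\<lambda>j. c j z"])
        (simp only: yco[OF y z, symmetric] e[OF z, symmetric])
  qed
  have co_add: "co j (y \<oplus>\<^bsub>sec ?F U\<^esub> y') = co j y \<oplus>\<^bsub>hol_ring V\<^esub> co j y'"
    if "y \<in> Y" "y' \<in> Y" "y \<oplus>\<^bsub>sec ?F U\<^esub> y' \<in> Y" "j < m" for j y y'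
  proof (rule co_unique[OF that(3,4), where c = "\<lambda>j. co j y \<oplus>\<^bsub>hol_ring V\<^esub> co j y'"])
    show "co i y \<oplus>\<^bsub>hol_ring V\<^esub> co i y' \<in> hol_sections V" for i
      using hol_sections_add[OF V(1) coV coV] by simp
    fix z assume z: "z \<in> V"
    have "(y \<oplus>\<^bsub>sec ?F U\<^esub> y') z = y z + y' z" using z VU by auto
    also have "\<dots> = (\<Sum>i<m. co i y z *\<^sub>C q i z) + (\<Sum>i<m. co i y' z *\<^sub>C q i z)"
      by (simp only: yco[OF that(1) z] yco[OF that(2) z])
    finally show "(y \<oplus>\<^bsub>sec ?F U\<^esub> y') z = (\<Sum>i<m. (co i y \<oplus>\<^bsub>hol_ring V\<^esub> co i y') z *\<^sub>C q i z)"
      using z by (simp add: scaleC_add_left sum.distrib)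
  qed
  have co_smult: "co j (r \<odot>\<^bsub>sec ?F U\<^esub> y) = restrict r V \<otimes>\<^bsub>hol_ring V\<^esub> co j y"
    if "y \<in> Y" "r \<in> hol_sections U" "r \<odot>\<^bsub>sec ?F U\<^esub> y \<in> Y" "j < m" for j r y
  proof (rule co_unique[OF that(3,4), where c = "\<lambda>j. restrict r V \<otimes>\<^bsub>hol_ring V\<^esub> co j y"])
    show "restrict r V \<otimes>\<^bsub>hol_ring V\<^esub> co i y \<in> hol_sections V" for i
      using hol_sections_mult[OF V(1) hol_sections_restrict[OF U(1) VU V(1) that(2)] coV] by simp
    fix z assume z: "z \<in> V"
    have "(r \<odot>\<^bsub>sec ?F U\<^esub> y) z = r z *\<^sub>C y z" using z VU by auto
    also have "\<dots> = r z *\<^sub>C (\<Sum>i<m. co i y z *\<^sub>C q i z)" by (simp only: yco[OF that(1) z])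
    finally show "(r \<odot>\<^bsub>sec ?F U\<^esub> y) z = (\<Sum>i<m. (restrict r V \<otimes>\<^bsub>hol_ring V\<^esub> co i y) z *\<^sub>C q i z)"
      using z by (simp add: scaleC.sum_right scaleC_scaleC)
  qed
  note CV = O_presheaf.sec_module[OF C V] and BV = O_presheaf.sec_module[OF B V]
  interpret CV: module "hol_ring V" "sec C V" by (rule CV)
  interpret BV: module "hol_ring V" "sec B V" by (rule BV)
  have "\<forall>j. \<exists>h. h \<in> hom (tensor_free (sec C U) (sec ?F U)) (add_monoid (sec C V)) \<and>
      (\<forall>c\<in>carrier (sec C U). \<forall>y\<in>carrier (sec ?F U). h (frag_of (c, y)) = co j y \<odot>\<^bsub>sec C V\<^esub> res C U V c)"
  proof
    fix j
    obtain h where "h \<in> hom (tensor_free (sec C U) (sec ?F U)) (add_monoid (sec C V))"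
      "\<And>c y. c \<in> carrier (sec C U) \<Longrightarrow> y \<in> carrier (sec ?F U) \<Longrightarrow> h (frag_of (c, y)) = co j y \<odot>\<^bsub>sec C V\<^esub> res C U V c"
      by (rule tensor_coordinate_hom[OF CV, where co = "co j" and r = "res C U V" and S = "carrier (sec C U)" and T = "carrier (sec ?F U)"])
        (simp add: coV, erule O_presheaf.res_closed[OF C U(1) V(1) VU U(2)], rule that)
    then show "\<exists>h. h \<in> hom (tensor_free (sec C U) (sec ?F U)) (add_monoid (sec C V)) \<and>
      (\<forall>c\<in>carrier (sec C U). \<forall>y\<in>carrier (sec ?F U). h (frag_of (c, y)) = co j y \<odot>\<^bsub>sec C V\<^esub> res C U V c)" by blast
  qed
  \<comment> \<open>\<open>hC j\<close> reads off the j-th coordinate of a formal sum as a section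
    of \<open>C\<close> over \<open>V\<close>; \<open>hB j\<close> below does the same for
    \<open>B\<close>.\<close>
  from choice[OF this] obtain hC where hC: "\<And>j. hC j \<in> hom (tensor_free (sec C U) (sec ?F U)) (add_monoid (sec C V))"
    and hCv: "\<And>j c y. c \<in> carrier (sec C U) \<Longrightarrow> y \<in> carrier (sec ?F U) \<Longrightarrow> hC j (frag_of (c, y)) = co j y \<odot>\<^bsub>sec C V\<^esub> res C U V c"
    by blast
  have "\<forall>j. \<exists>h. h \<in> hom (tensor_free (sec B U) (sec ?F U)) (add_monoid (sec B V)) \<and>
      (\<forall>c\<in>carrier (sec B U). \<forall>y\<in>carrier (sec ?F U). h (frag_of (c, y)) = co j y \<odot>\<^bsub>sec B V\<^esub> res B U V c)"
  proof
    fix j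
    obtain h where "h \<in> hom (tensor_free (sec B U) (sec ?F U)) (add_monoid (sec B V))"
      "\<And>c y. c \<in> carrier (sec B U) \<Longrightarrow> y \<in> carrier (sec ?F U) \<Longrightarrow> h (frag_of (c, y)) = co j y \<odot>\<^bsub>sec B V\<^esub> res B U V c"
      by (rule tensor_coordinate_hom[OF BV, where co = "co j" and r = "res B U V" and S = "carrier (sec B U)" and T = "carrier (sec ?F U)"])
        (simp add: coV, erule O_presheaf.res_closed[OF B U(1) V(1) VU U(2)], rule that)
    then show "\<exists>h. h \<in> hom (tensor_free (sec B U) (sec ?F U)) (add_monoid (sec B V)) \<and>
      (\<forall>c\<in>carrier (sec B U). \<forall>y\<in>carrier (sec ?F U). h (frag_of (c, y)) = co j y \<odot>\<^bsub>sec B V\<^esub> res B U V c)" by blast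
  qed
  from choice[OF this] obtain hB where hB: "\<And>j. hB j \<in> hom (tensor_free (sec B U) (sec ?F U)) (add_monoid (sec B V))"
    and hBv: "\<And>j c y. c \<in> carrier (sec B U) \<Longrightarrow> y \<in> carrier (sec ?F U) \<Longrightarrow> hB j (frag_of (c, y)) = co j y \<odot>\<^bsub>sec B V\<^esub> res B U V c"
    by blast
  note gC = CV.abelian_group_axioms and gB = BV.abelian_group_axioms
  have YF: "y \<in> carrier (sec ?F U)" if "y \<in> Y" for y using Y(2) that by auto
  have coR: "co j y \<in> carrier (hol_ring V)" for j y using coV by simp
  have resC: "res C U V c \<in> carrier (sec C V)" if "c \<in> carrier (sec C U)" for c
    by (rule O_presheaf.res_closed[OF C U(1) V(1) VU U(2) that])
  have resB: "res B U V c \<in> carrier (sec B V)" if "c \<in> carrier (sec B U)" for c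
    by (rule O_presheaf.res_closed[OF B U(1) V(1) VU U(2) that])
  interpret CU: module "hol_ring U" "sec C U" by (rule CU)
  interpret FU: module "hol_ring U" "sec ?F U" by (rule FU)
  \<comment> \<open>The relators over \<open>Y\<close> are respected because coordinates in a frame
    are unique: those of a sum or a multiple that lies in \<open>Y\<close> are the sum or the
    multiple of the coordinates.\<close>
  have van: "hC j (tensor_frag (\<psi> U) (\<lambda>f. f) w) = \<zero>\<^bsub>sec C V\<^esub>" if j: "j < m" for j
  proof (rule hom_tensor_relators_over[OF CU FU gC hC _ _ _ _ TY])
    show "Y \<subseteq> carrier (sec ?F U)" using YF by blast
    fix c c' y assume c: "c \<in> carrier (sec C U)" "c' \<in> carrier (sec C U)" and y: "y \<in> Y"
    have "hC j (frag_of (c \<oplus>\<^bsub>sec C U\<^esub> c', y)) = co j y \<odot>\<^bsub>sec C V\<^esub> res C U V (c \<oplus>\<^bsub>sec C U\<^esub> c')"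
      by (rule hCv[OF CU.M.add.m_closed[OF c] YF[OF y]])
    also have "\<dots> = co j y \<odot>\<^bsub>sec C V\<^esub> res C U V c \<oplus>\<^bsub>sec C V\<^esub> co j y \<odot>\<^bsub>sec C V\<^esub> res C U V c'"
      unfolding O_presheaf.res_add[OF C U(1) V(1) VU U(2) c]
      by (rule CV.smult_r_distr[OF coR resC[OF c(1)] resC[OF c(2)]])
    finally show "hC j (frag_of (c \<oplus>\<^bsub>sec C U\<^esub> c', y)) = hC j (frag_of (c, y)) \<oplus>\<^bsub>sec C V\<^esub> hC j (frag_of (c', y))"
      by (simp only: hCv[OF c(1) YF[OF y]] hCv[OF c(2) YF[OF y]])
  next
    fix c y y' assume c: "c \<in> carrier (sec C U)" and y: "y \<in> Y" "y' \<in> Y" "y \<oplus>\<^bsub>sec ?F U\<^esub> y' \<in> Y"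
    have "hC j (frag_of (c, y \<oplus>\<^bsub>sec ?F U\<^esub> y')) = (co j y \<oplus>\<^bsub>hol_ring V\<^esub> co j y') \<odot>\<^bsub>sec C V\<^esub> res C U V c"
      by (simp only: hCv[OF c YF[OF y(3)]] co_add[OF y j])
    also have "\<dots> = co j y \<odot>\<^bsub>sec C V\<^esub> res C U V c \<oplus>\<^bsub>sec C V\<^esub> co j y' \<odot>\<^bsub>sec C V\<^esub> res C U V c"
      by (rule CV.smult_l_distr[OF coR coR resC[OF c]])
    finally show "hC j (frag_of (c, y \<oplus>\<^bsub>sec ?F U\<^esub> y')) = hC j (frag_of (c, y)) \<oplus>\<^bsub>sec C V\<^esub> hC j (frag_of (c, y'))"
      by (simp only: hCv[OF c YF[OF y(1)]] hCv[OF c YF[OF y(2)]])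
  next
    fix r c y assume r: "r \<in> carrier (hol_ring U)" and c: "c \<in> carrier (sec C U)" and y: "y \<in> Y" "r \<odot>\<^bsub>sec ?F U\<^esub> y \<in> Y"
    have rh: "r \<in> hol_sections U" using r by simp
    have rV: "restrict r V \<in> carrier (hol_ring V)" using hol_sections_restrict[OF U(1) VU V(1) rh] by simp
    have "hC j (frag_of (r \<odot>\<^bsub>sec C U\<^esub> c, y)) = co j y \<odot>\<^bsub>sec C V\<^esub> (restrict r V \<odot>\<^bsub>sec C V\<^esub> res C U V c)"
      by (simp only: hCv[OF CU.smult_closed[OF r c] YF[OF y(1)]] O_presheaf.res_smult[OF C U(1) V(1) VU U(2) r c])
    also have "\<dots> = (restrict r V \<otimes>\<^bsub>hol_ring V\<^esub> co j y) \<odot>\<^bsub>sec C V\<^esub> res C U V c"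
      unfolding CV.smult_assoc1[OF coR rV resC[OF c], symmetric] CV.R.m_comm[OF coR rV] ..
    finally show "hC j (frag_of (r \<odot>\<^bsub>sec C U\<^esub> c, y)) = hC j (frag_of (c, r \<odot>\<^bsub>sec ?F U\<^esub> y))"
      by (simp only: hCv[OF c YF[OF y(2)]] co_smult[OF y(1) rh y(2) j])
  qed
  have sub: "keys v \<subseteq> carrier (sec B U) \<times> carrier (sec ?F U)" if "keys v \<subseteq> carrier (sec B U) \<times> Y" for v
    using that YF by blast
  \<comment> \<open>Taking coordinates commutes with the homomorphism; together with
    \<open>van\<close> this puts the first \<open>m\<close> coordinates of \<open>w\<close> into the
    kernel of \<open>\<psi>\<close> over \<open>V\<close>.\<close>
  have hom_rel: "\<psi> V (hB j v) = hC j (tensor_frag (\<psi> U) (\<lambda>f. f) v)"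
    if "keys v \<subseteq> carrier (sec B U) \<times> Y" for j v
    using that
  proof (induction v rule: free_Abelian_group_induct[consumes 1])
    case 1
    show ?case
      by (simp add: hom_add_monoid_0[OF gB hB] hom_add_monoid_0[OF gC hC] sheaf_hom_zero[OF B C \<psi> V])
  next
    case (2 v v')
    have k: "keys (v - v') \<subseteq> carrier (sec B U) \<times> carrier (sec ?F U)"
      using sub[OF 2(1)] sub[OF 2(2)] keys_diff[of v v'] by blast
    have tk: "keys (tensor_frag (\<psi> U) (\<lambda>f. f) u) \<subseteq> carrier (sec C U) \<times> carrier (sec ?F U)"
      if "keys u \<subseteq> carrier (sec B U) \<times> carrier (sec ?F U)" for u
      by (rule tensor_frag_keys[OF that]) (auto intro: sheaf_hom_closed[OF \<psi> U])
    have "\<psi> V (hB j (v - v')) \<oplus>\<^bsub>sec C V\<^esub> \<psi> V (hB j v') = \<psi> V (hB j v)"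
      unfolding sheaf_hom_add[OF \<psi> V hom_add_monoid_closed[OF gB hB k] hom_add_monoid_closed[OF gB hB sub[OF 2(2)]], symmetric]
      by (simp only: hom_add_monoid_diff[OF gB hB sub[OF 2(1)] sub[OF 2(2)]])
    also have "\<dots> = hC j (tensor_frag (\<psi> U) (\<lambda>f. f) (v - v')) \<oplus>\<^bsub>sec C V\<^esub> \<psi> V (hB j v')"
      unfolding 2(3,4) tensor_frag_simps(4)
      by (rule hom_add_monoid_diff[OF gC hC tk[OF sub[OF 2(1)]] tk[OF sub[OF 2(2)]], symmetric])
    finally show ?case
      by (rule CV.M.add.right_cancel[THEN iffD1, rotated 3])
        (use sheaf_hom_closed[OF \<psi> V hom_add_monoid_closed[OF gB hB k]]
          sheaf_hom_closed[OF \<psi> V hom_add_monoid_closed[OF gB hB sub[OF 2(2)]]]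
          hom_add_monoid_closed[OF gC hC tk[OF k]] in simp_all)
  next
    case (3 p)
    then obtain b y where p: "p = (b, y)" "b \<in> carrier (sec B U)" "y \<in> Y" by auto
    show ?case
      unfolding p(1) tensor_frag_simps(2) hBv[OF p(2) YF[OF p(3)]] hCv[OF sheaf_hom_closed[OF \<psi> U p(2)] YF[OF p(3)]]
        sheaf_hom_smult[OF \<psi> V coR resB[OF p(2)]] sheaf_hom_res[OF \<psi> U V(1) VU p(2)] ..
  qed
  define b' where "b' j = hB j w" for j
  have b'c: "b' j \<in> carrier (sec B V)" for j
    unfolding b'_def by (rule hom_add_monoid_closed[OF gB hB sub[OF Y(3)]])
  have "b' j \<in> image_sheaf A B \<phi> V" if "j < m" for j
  proof -
    have "b' j \<in> kernel_sheaf B C \<psi> V"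
      using b'c hom_rel[OF Y(3)] van[OF that] by (simp add: kernel_sheaf_def b'_def)
    then show ?thesis using ex V unfolding exact_sheaf_seq_def by blast
  qed
  then have "\<forall>j\<in>{..<m}. \<exists>p. open (fst p) \<and> x \<in> fst p \<and> fst p \<subseteq> V \<and> snd p \<in> carrier (sec A (fst p)) \<and>
      res B V (fst p) (b' j) = \<phi> (fst p) (snd p)"
    using xV by (fastforce simp: image_sheaf_def)
  from bchoice[OF this] obtain P where P: "\<And>j. j < m \<Longrightarrow> open (fst (P j)) \<and> x \<in> fst (P j) \<and> fst (P j) \<subseteq> V \<and>
      snd (P j) \<in> carrier (sec A (fst (P j))) \<and> res B V (fst (P j)) (b' j) = \<phi> (fst (P j)) (snd (P j))"
    by blast
  \<comment> \<open>Each coordinate lifts through \<open>\<phi>\<close> on a neighbourhood of its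
    own, and finitely many of these have a common one. Intersecting with \<open>V\<close> covers the
    case \<open>m = 0\<close>, where the other intersection is the whole space.\<close>
  define W where "W = V \<inter> (\<Inter>j\<in>{..<m}. fst (P j))"
  have W: "open W" "x \<in> W" "W \<subseteq> V"
    unfolding W_def using P V(1) xV by (auto intro!: open_Int open_INT)
  have WP: "W \<subseteq> fst (P j)" if "j < m" for j using that by (auto simp: W_def)
  have W\<Omega>: "W \<subseteq> \<Omega>" and WU: "W \<subseteq> U" using W V VU by auto
  define a' where "a' j = res A (fst (P j)) W (snd (P j))" for j
  have P\<Omega>: "fst (P j) \<subseteq> \<Omega>" if "j < m" for j using P[OF that] V by blast
  have a'c: "a' j \<in> carrier (sec A W)" if "j < m" for j
    unfolding a'_def using P[OF that] WP[OF that] P\<Omega>[OF that] W(1) by (intro O_presheaf.res_closed[OF A]) auto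
  have \<phi>a': "\<phi> W (a' j) = res B V W (b' j)" if j: "j < m" for j
  proof -
    have "\<phi> W (a' j) = res B (fst (P j)) W (\<phi> (fst (P j)) (snd (P j)))"
      unfolding a'_def using P[OF j] P\<Omega>[OF j] WP[OF j] W(1) by (intro sheaf_hom_res[OF \<phi>]) auto
    also have "\<dots> = res B (fst (P j)) W (res B V (fst (P j)) (b' j))" using P[OF j] by simp
    also have "\<dots> = res B V W (b' j)"
      using P[OF j] WP[OF j] W(1) V b'c by (intro O_presheaf.res_res[OF B]) auto
    finally show ?thesis .
  qed
  define q' where "q' j = restrict (q j) W" for j
  have q'h: "q' j \<in> hol_sections W" if "j < m" for j
    unfolding q'_def using q W(3) that by (intro restrict_in_hol_sections W(1)) (auto simp: frame_def)
  note BW = O_presheaf.sec_module[OF B W(1) W\<Omega>] and FW = module_plain_sheaf[OF W(1), where 'e = 'e]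
  let ?K = "tensor_kernel (hol_ring W) (sec B W) (sec ?F W)"
  have resVW: "res B V W c \<in> carrier (sec B W)" if "c \<in> carrier (sec B V)" for c
    by (rule O_presheaf.res_closed[OF B V(1) W(1,3) V(2) that])
  \<comment> \<open>Over \<open>W\<close> the tensor is the sum of its coordinates tensored with the
    frame. In the induction over formal sums, differences are settled by the additivity relator and
    generators by \<open>tensor_smult_sum\<close>.\<close>
  have "(\<Sum>j<m. frag_of (res B V W (hB j v), q' j)) - tensor_frag (res B U W) (\<lambda>f. restrict f W) v \<in> ?K"
    if "keys v \<subseteq> carrier (sec B U) \<times> Y" for v
    using that
  proof (induction v rule: free_Abelian_group_induct[consumes 1])
    case 1
    have "(\<Sum>j<m. frag_of (\<zero>\<^bsub>sec B W\<^esub>, q' j)) \<in> ?K"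
      by (intro tensor_kernel_sum[OF BW FW] tensor_zero_left[OF BW FW]) (simp add: q'h)
    then show ?case
      by (simp add: hom_add_monoid_0[OF gB hB] res_zero[OF B V(1) W(1,3) V(2)])
  next
    case (2 v v')
    have k: "keys (v - v') \<subseteq> carrier (sec B U) \<times> carrier (sec ?F U)"
      using sub[OF 2(1)] sub[OF 2(2)] keys_diff[of v v'] by blast
    let ?r = "\<lambda>v j. frag_of (res B V W (hB j v), q' j)"
    have r: "?r v j - ?r (v - v') j - ?r v' j \<in> ?K" if "j < m" for j
    proof -
      have eq: "res B V W (hB j (v - v')) \<oplus>\<^bsub>sec B W\<^esub> res B V W (hB j v') = res B V W (hB j v)"
        unfolding O_presheaf.res_add[OF B V(1) W(1,3) V(2) hom_add_monoid_closed[OF gB hB k]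
            hom_add_monoid_closed[OF gB hB sub[OF 2(2)]], symmetric]
        by (simp only: hom_add_monoid_diff[OF gB hB sub[OF 2(1)] sub[OF 2(2)]])
      have "frag_of (res B V W (hB j (v - v')) \<oplus>\<^bsub>sec B W\<^esub> res B V W (hB j v'), q' j)
          - frag_of (res B V W (hB j (v - v')), q' j) - frag_of (res B V W (hB j v'), q' j) \<in> ?K"
        by (rule tensor_rel_add_left[OF resVW[OF hom_add_monoid_closed[OF gB hB k]]
              resVW[OF hom_add_monoid_closed[OF gB hB sub[OF 2(2)]]]]) (simp add: q'h[OF that])
      then show ?thesis unfolding eq .
    qed
    have "((\<Sum>j<m. ?r v j) - tensor_frag (res B U W) (\<lambda>f. restrict f W) v)
        - ((\<Sum>j<m. ?r v' j) - tensor_frag (res B U W) (\<lambda>f. restrict f W) v')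
        - (\<Sum>j<m. ?r v j - ?r (v - v') j - ?r v' j) \<in> ?K"
      by (rule tensor_kernel_diff[OF BW FW tensor_kernel_diff[OF BW FW 2(3,4)] tensor_kernel_sum[OF BW FW r]]) simp
    moreover have "(s - t) - (s' - t') - (s - d - s') = d - (t - t')"
      for s s' t t' d :: "('b \<times> (complex ^ 'n \<Rightarrow> 'e)) \<Rightarrow>\<^sub>0 int" by simp
    ultimately show ?case by (simp only: sum_subtractf tensor_frag_simps(4))
  next
    case (3 p)
    then obtain b y where p: "p = (b, y)" "b \<in> carrier (sec B U)" "y \<in> Y" by auto
    let ?c = "\<lambda>j. restrict (co j y) W" and ?b = "res B U W b"
    have h1: "res B V W (hB j (frag_of (b, y))) = ?c j \<odot>\<^bsub>sec B W\<^esub> ?b" for j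
      unfolding hBv[OF p(2) YF[OF p(3)]]
        O_presheaf.res_smult[OF B V(1) W(1,3) V(2) coR resB[OF p(2)]]
        O_presheaf.res_res[OF B U(1) V(1) W(1,3) VU U(2) p(2)] ..
    have h2: "(\<Sum>j<m. frag_of (?c j \<odot>\<^bsub>sec B W\<^esub> ?b, q' j)) - frag_of (?b, \<lambda>z\<in>W. \<Sum>j<m. ?c j z *\<^sub>C q' j z) \<in> ?K"
    proof (rule tensor_smult_sum[OF W(1) BW, THEN conjunct2])
      show "?b \<in> carrier (sec B W)" by (rule O_presheaf.res_closed[OF B U(1) W(1) WU U(2) p(2)])
      show "?c j \<in> hol_sections W" for j by (rule hol_sections_restrict[OF V(1) W(3,1) coV])
    qed (rule q'h)
    have h3: "(\<lambda>z\<in>W. \<Sum>j<m. ?c j z *\<^sub>C q' j z) = restrict y W"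
      using yco[OF p(3)] W(3) by (auto simp: fun_eq_iff q'_def)
    show ?case using h2 by (simp only: p(1) h1 h3 tensor_frag_simps(2))
  qed
  from this[OF Y(3)]
  have D: "(\<Sum>j<m. frag_of (res B V W (b' j), q' j)) - tensor_frag (res B U W) (\<lambda>f. restrict f W) w \<in> ?K"
    by (simp add: b'_def)
  define t where "t = (\<Sum>j<m. frag_of (a' j, q' j))"
  have "tensor_frag (\<phi> W) (\<lambda>f. f) t = (\<Sum>j<m. frag_of (res B V W (b' j), q' j))"
    unfolding t_def tensor_frag_sum by (rule sum.cong) (simp_all add: \<phi>a')
  moreover have "keys t \<subseteq> carrier (sec A W) \<times> hol_sections W"
    unfolding t_def using sum_closed_free_Abelian_group[of "{..<m}" "\<lambda>j. frag_of (a' j, q' j)" "carrier (sec A W) \<times> hol_sections W"]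
      a'c q'h by simp
  ultimately show ?thesis using W WU D by (intro exI[of _ W] exI[of _ t]) simp
qed

text \<open>An instance of \<open>sheafify_exact\<close>: that the tensor presheaves form a complex
  is seen on generators, and the local lifting is \<open>tensor_lift\<close>.\<close>

theorem plain_sheaf_flat:
  fixes A :: "('n::finite, 'a) mod_presheaf" and B :: "('n, 'b) mod_presheaf" and C :: "('n, 'c) mod_presheaf"
    and F :: "('n, complex ^ 'n \<Rightarrow> 'e::complex_banach) mod_presheaf"
  assumes F: "F = plain_sheaf"
    and A: "O_presheaf \<Omega> A" and B: "O_presheaf \<Omega> B" and C: "O_presheaf \<Omega> C"
    and \<phi>: "sheaf_hom \<Omega> A B \<phi>" and \<psi>: "sheaf_hom \<Omega> B C \<psi>" and ex: "exact_sheaf_seq \<Omega> A \<phi> B \<psi> C"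
  shows "exact_sheaf_seq \<Omega> (tensor_sheaf \<Omega> A F) (tensor_sheaf_map \<Omega> B F \<phi>)
    (tensor_sheaf \<Omega> B F) (tensor_sheaf_map \<Omega> C F \<psi>) (tensor_sheaf \<Omega> C F)"
  unfolding tensor_sheaf_def tensor_sheaf_map_def
proof (rule sheafify_exact)
  have PF: "O_presheaf \<Omega> F" unfolding F by (rule O_presheaf_plain_sheaf)
  show "functorial \<Omega> (tensor_presheaf A F)" "functorial \<Omega> (tensor_presheaf B F)" "functorial \<Omega> (tensor_presheaf C F)"
    by (intro functorial_tensor_presheaf A B C PF)+
  show "natural_map \<Omega> (tensor_presheaf A F) (tensor_presheaf B F)
      (\<lambda>U. tensor_map (hol_ring U) (sec B U) (sec F U) (\<phi> U) (\<lambda>f. f))"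
    by (rule natural_tensor_map[OF A B PF \<phi>])
  show "natural_map \<Omega> (tensor_presheaf B F) (tensor_presheaf C F)
      (\<lambda>U. tensor_map (hol_ring U) (sec C U) (sec F U) (\<psi> U) (\<lambda>f. f))"
    by (rule natural_tensor_map[OF B C PF \<psi>])
  fix U assume U: "open U" "U \<subseteq> \<Omega>"
  note AU = O_presheaf.sec_module[OF A U] and BU = O_presheaf.sec_module[OF B U]
    and CU = O_presheaf.sec_module[OF C U] and FU = O_presheaf.sec_module[OF PF U]
  show "\<zero>\<^bsub>sec (tensor_presheaf C F) U\<^esub> \<in> carrier (sec (tensor_presheaf C F) U)"
    unfolding tensor_presheaf_simps tensor_module_zero tensor_module_carrier by (auto intro!: exI[of _ 0])
  show "res (tensor_presheaf C F) U V \<zero>\<^bsub>sec (tensor_presheaf C F) U\<^esub> = \<zero>\<^bsub>sec (tensor_presheaf C F) V\<^esub>"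
    if V: "open V" "V \<subseteq> U" for V
    using tensor_res_class[OF C PF U(1) V U(2), of 0]
    by (simp only: tensor_presheaf_simps(1) tensor_module_zero tensor_frag_simps)
  show "tensor_map (hol_ring U) (sec C U) (sec F U) (\<psi> U) (\<lambda>f. f)
      (tensor_map (hol_ring U) (sec B U) (sec F U) (\<phi> U) (\<lambda>f. f) s) = \<zero>\<^bsub>sec (tensor_presheaf C F) U\<^esub>"
    if s: "s \<in> carrier (sec (tensor_presheaf A F) U)" for s
  proof -
    obtain w where w: "keys w \<subseteq> carrier (sec A U) \<times> carrier (sec F U)" "s = tensor_class (hol_ring U) (sec A U) (sec F U) w"
      using s unfolding tensor_presheaf_simps tensor_module_carrier by blast
    have zero: "\<psi> U (\<phi> U x) = \<zero>\<^bsub>sec C U\<^esub>" if x: "x \<in> carrier (sec A U)" for x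
    proof -
      have \<phi>x: "\<phi> U x \<in> carrier (sec B U)" by (rule sheaf_hom_closed[OF \<phi> U x])
      \<comment> \<open>An honest image over \<open>U\<close> lies in the sheaf image with
        \<open>U\<close> itself as the neighbourhood; exactness then places it in the
        kernel.\<close>
      have "\<phi> U x \<in> image_sheaf A B \<phi> U"
        unfolding image_sheaf_def using \<phi>x x U(1) O_presheaf.res_id[OF B U \<phi>x] by fastforce
      then show ?thesis using ex U unfolding exact_sheaf_seq_def kernel_sheaf_def by blast
    qed
    have "tensor_frag (\<lambda>x. \<psi> U (\<phi> U x)) (\<lambda>f. f) w \<in> tensor_kernel (hol_ring U) (sec C U) (sec F U)"
      by (rule tensor_frag_zero_kernel[OF CU FU w(1) zero])
    then show ?thesis
      unfolding w(2) tensor_hom_class[OF A B PF \<phi> U] tensor_hom_class[OF B C PF \<psi> U] tensor_frag_tensor_frag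
        tensor_presheaf_simps tensor_module_zero tensor_class_eq_iff[OF CU FU] by simp
  qed
  show "\<exists>W t. open W \<and> x \<in> W \<and> W \<subseteq> U \<and> t \<in> carrier (sec (tensor_presheaf A F) W) \<and>
      tensor_map (hol_ring W) (sec B W) (sec F W) (\<phi> W) (\<lambda>f. f) t = res (tensor_presheaf B F) U W s"
    if s: "s \<in> carrier (sec (tensor_presheaf B F) U)"
      and sz: "tensor_map (hol_ring U) (sec C U) (sec F U) (\<psi> U) (\<lambda>f. f) s = \<zero>\<^bsub>sec (tensor_presheaf C F) U\<^esub>"
      and x: "x \<in> U" for s x
  proof -
    obtain w where w: "keys w \<subseteq> carrier (sec B U) \<times> carrier (sec F U)" "s = tensor_class (hol_ring U) (sec B U) (sec F U) w"
      using s unfolding tensor_presheaf_simps tensor_module_carrier by blast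
    have "tensor_frag (\<psi> U) (\<lambda>f. f) w - 0 \<in> tensor_kernel (hol_ring U) (sec C U) (sec F U)"
      using sz unfolding w(2) tensor_hom_class[OF B C PF \<psi> U] tensor_presheaf_simps tensor_module_zero
        tensor_class_eq_iff[OF CU FU] .
    then have "tensor_frag (\<psi> U) (\<lambda>f. f) w \<in> tensor_kernel (hol_ring U) (sec C U) (sec plain_sheaf U)"
      by (simp add: F)
    from tensor_lift[OF A B C \<phi> \<psi> ex U x _ this] w(1)
    obtain W t where W: "open W" "x \<in> W" "W \<subseteq> U" and t: "keys t \<subseteq> carrier (sec A W) \<times> hol_sections W"
      "tensor_frag (\<phi> W) (\<lambda>f. f) t - tensor_frag (res B U W) (\<lambda>f. restrict f W) w
        \<in> tensor_kernel (hol_ring W) (sec B W) (sec plain_sheaf W)"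
      by (auto simp: F)
    have W\<Omega>: "W \<subseteq> \<Omega>" using W U by blast
    have resF: "res F U W = (\<lambda>f. restrict f W)" by (simp add: F fun_eq_iff)
    let ?t = "tensor_class (hol_ring W) (sec A W) (sec F W) t"
    have "?t \<in> carrier (sec (tensor_presheaf A F) W)"
      unfolding tensor_presheaf_simps tensor_module_carrier using t(1) by (auto simp: F)
    moreover have "tensor_map (hol_ring W) (sec B W) (sec F W) (\<phi> W) (\<lambda>f. f) ?t = res (tensor_presheaf B F) U W s"
      unfolding w(2) tensor_hom_class[OF A B PF \<phi> W(1) W\<Omega>] tensor_res_class[OF B PF U(1) W(1,3) U(2)]
        tensor_class_eq_iff[OF O_presheaf.sec_module[OF B W(1) W\<Omega>] O_presheaf.sec_module[OF PF W(1) W\<Omega>]] resF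
      using t(2) by (simp add: F)
    ultimately show ?thesis using W by blast
  qed
qed

theorem theorem4p1:
  fixes \<Omega> :: "(complex ^ 'n) set"
    and F :: "('n, complex ^ 'n \<Rightarrow> 'e::complex_banach) mod_presheaf"
  assumes "open \<Omega>" and "F = plain_sheaf"
  shows
    "(\<forall>A \<zeta>. O_submodule \<Omega> F A \<and> finitely_generated \<Omega> (subsheaf F A) \<and> \<zeta> \<in> \<Omega> \<longrightarrow>
        (\<exists>U E. open U \<and> \<zeta> \<in> U \<and> U \<subseteq> \<Omega> \<and>
           O_submodule U F E \<and> finitely_generated_free U (subsheaf F E) \<and>
           (\<forall>V. open V \<and> V \<subseteq> U \<longrightarrow> A V \<subseteq> E V)))
     \<and>
     (\<forall>(A :: ('n, 'a) mod_presheaf) (B :: ('n, 'b) mod_presheaf) (C :: ('n, 'c) mod_presheaf) \<phi> \<psi>.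
        O_module \<Omega> A \<and> O_module \<Omega> B \<and> O_module \<Omega> C \<and>
        sheaf_hom \<Omega> A B \<phi> \<and> sheaf_hom \<Omega> B C \<psi> \<and> exact_sheaf_seq \<Omega> A \<phi> B \<psi> C \<longrightarrow>
        exact_sheaf_seq \<Omega> (tensor_sheaf \<Omega> A F) (tensor_sheaf_map \<Omega> B F \<phi>)
          (tensor_sheaf \<Omega> B F) (tensor_sheaf_map \<Omega> C F \<psi>) (tensor_sheaf \<Omega> C F))"
proof (intro conjI allI impI; elim conjE)
  fix A \<zeta> assume "O_submodule \<Omega> F A" "finitely_generated \<Omega> (subsheaf F A)" "\<zeta> \<in> \<Omega>"
  then show "\<exists>U E. open U \<and> \<zeta> \<in> U \<and> U \<subseteq> \<Omega> \<and> O_submodule U F E \<and>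
      finitely_generated_free U (subsheaf F E) \<and> (\<forall>V. open V \<and> V \<subseteq> U \<longrightarrow> A V \<subseteq> E V)"
    using finitely_generated_in_free[OF assms(1), of A \<zeta>] by (simp only: assms(2))
next
  fix A :: "('n, 'a) mod_presheaf" and B :: "('n, 'b) mod_presheaf" and C :: "('n, 'c) mod_presheaf" and \<phi> \<psi>
  assume "O_module \<Omega> A" "O_module \<Omega> B" "O_module \<Omega> C" "sheaf_hom \<Omega> A B \<phi>" "sheaf_hom \<Omega> B C \<psi>"
    "exact_sheaf_seq \<Omega> A \<phi> B \<psi> C"
  then show "exact_sheaf_seq \<Omega> (tensor_sheaf \<Omega> A F) (tensor_sheaf_map \<Omega> B F \<phi>)
      (tensor_sheaf \<Omega> B F) (tensor_sheaf_map \<Omega> C F \<psi>) (tensor_sheaf \<Omega> C F)"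
    by (intro plain_sheaf_flat[OF assms(2)] O_module.axioms(1))
qed

end
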